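(* Let $D\ge1$ be an integer. Let $X$ be the boundary of the $(D+1)$-simplex with vertex set $\{0,1,\dots,D+1\}$, and for $i\in\{0,\dots,D+1\}$ let $U_i$ be the $D$-simplex (with all its faces) spanned by $\{0,\dots,D+1\}\setminus\{i\}$. Filter $X$ by $X^{m}=\emptyset$ for $m<0$, $X^{2j}=X^{2j+1}=U_0\cup U_1\cup\dots\cup U_j$ for $0\le j\le D+1$, and $X^m=X$ for $m\ge 2D+2$. Equip each $U_i$ with the induced filtration $U_i^m=U_i\cap X^m$, and let $\mathcal U=(U_i)_{i}$ be the resulting filtered cover of $X$, with filtered nerve $\mathcal N$ and Mayer-Vietoris spectral sequence $E$. Then $\mathcal U$ is a $1$-acyclic cover of $X$, and for $\eta\in\mathbb N_0$: (i) $E^2_{*,0}\overset{\eta}{\sim}H_*(\mathcal N)$ holds for $\eta=2$ but not for $\eta<2$; (ii) $E^2_{*,0}\overset{\eta}{\sim}E^\infty_{*,0}$ holds for $\eta=2(D-1)$ but not for $\eta<2(D-1)$.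
   Context: Modules and interleavings. Let $\mathbf k$ be a field and let $\mathbf k[t]$ be graded by degree. A $\mathbf k[t]$-module means a $\mathbb Z$-graded module $M=\bigoplus_{j\in\mathbb Z}M^j$ with $tM^j\subseteq M^{j+1}$. For $\eta\in\mathbb N_0$, an $\eta$-morphism $f:M\to N$ is a $\mathbf k[t]$-linear map with $f(M^j)\subseteq N^{j+\eta}$ for all $j$. Let $\mathrm{id}_\eta:M\to M$ be $m\mapsto t^\eta m$. $M\overset{\eta}{\sim}N$ ($\eta$-interleaved) means there are $\eta$-morphisms $\phi:M\to N$, $\psi:N\to M$ with $\phi\psi=\mathrm{id}_{2\eta}$ and $\psi\phi=\mathrm{id}_{2\eta}$. Interleavings of graded $\mathbf k[t]$-modules (families $(M_p)_{p\in\mathbb Z}$) are defined componentwise. $t^a\mathbf k[t]$ denotes the free module on one generator of degree $a\in\mathbb Z$. Filtered complexes. A $\mathbb Z$-filtered simplicial complex is a simplicial complex $X$ with an increasing family of subcomplexes $(X^j)_{j\in\mathbb Z}$ with empty intersection and union $X$. For a filtered cover $\mathcal U=(U_i)_{i\in\Lambda}$ by filtered subcomplexes (with $X^j=\bigcup_iU_i^j$ for all $j$) and nonempty finite $I\subseteq\Lambda$, $U_I=\bigcap_{i\in I}U_i$ is filtered by $U_I^j=\bigcap_{i\in I}U_i^j$. Persistent homology is $H_q(X)=\bigoplus_jH_q(X^j;\mathbf k)$ with $t$ acting by inclusion-induced maps. The nerve $\mathcal N$ consists of nonempty finite $I\subseteq\Lambda$ with $U_I\ne\emptyset$, filtered by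 sublevel sets of $g(I)=\min\{j\mid U_I^j\neq\emptyset\}$. $\mathcal U$ is $\varepsilon$-acyclic if for each $I\in\mathcal N$ there is $a\in\mathbb Z$ with $H_0(U_I)\overset{\varepsilon}{\sim}t^a\mathbf k[t]$ and $H_q(U_I)\overset{\varepsilon}{\sim}0$ for $q\ne0$. Mayer-Vietoris spectral sequence. Let $E^0_{p,q}=\bigoplus_{|I|=p+1}C_q(U_I)$, where $C_q(U_I)$ is the free $\mathbf k[t]$-module on the $q$-simplices $(\sigma,I)$, $\sigma\in U_I$, in degree $\deg(\sigma,I)=\min\{j\mid\sigma\in U_I^j\}$. After totally ordering the vertices of $X$ and the index set $\Lambda$, put $\partial^0(\sigma,I)=\sum_{k=0}^q(-1)^kt^{\deg(\sigma,I)-\deg(\sigma_k,I)}(\sigma_k,I)$ and $\partial^1(\sigma,I)=\sum_{l=0}^p(-1)^lt^{\deg(\sigma,I)-\deg(\sigma,I_l)}(\sigma,I_l)$, where $\sigma_k$, $I_l$ are obtained by deleting the $k$-th vertex of $\sigma$, resp. the $l$-th element of $I$. (These commute; replace $\partial^0$ by $(-1)^p\partial^0$ to get an anticommuting double complex.) $(E^r,d^r)$ is the spectral sequence of this first-quadrant double complex obtained by first taking homology with respect to $\partial^0$ (i.e. from filtering the total complex by $p$), with $d^r:E^r_{p,q}\to E^r_{p-r,q+r-1}$, so $E^1_{p,q}=\bigoplus_{|I|=p+1}H_q(U_I)$; $E^\infty$ is its limit page. $E^r_{*,0}$ denotes the graded module $(E^r_{p,0})_p$. *)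

theory Defs
  imports
    "HOL-Algebra.Module"
    "HOL-Algebra.AbelCoset"
    "HOL-Library.Poly_Mapping"
    "HOL-Computational_Algebra.Polynomial"
begin

section \<open>Graded modules over \<open>k[t]\<close> and interleavings\<close>

text \<open>
  A \<open>k[t]\<close>-module is a module record (the additive and scalar operations are those of
  HOL-Algebra) whose scalars are the polynomials \<open>'k poly\<close>; \<open>hcomp M j\<close> is the homogeneous
  component of degree \<open>j\<close>. As usual for module records, the ring multiplication inherited
  from the record \<open>ring\<close> carries no meaning.
\<close>

record ('k::zero, 'a) graded_module = "('k poly, 'a) module" +
  hcomp :: "int \<Rightarrow> 'a set"

abbreviation graded :: "('k::zero poly, 'a) module \<Rightarrow> (int \<Rightarrow> 'a set) \<Rightarrow> ('k, 'a) graded_module"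
  where "graded M G \<equiv> module.extend M (graded_module.fields G)"

definition graded_morphisms ::
  "nat \<Rightarrow> ('k::field, 'a) graded_module \<Rightarrow> ('k, 'b) graded_module \<Rightarrow> ('a \<Rightarrow> 'b) set"
  where "graded_morphisms \<eta> M N =
    {f \<in> hom (add_monoid M) (add_monoid N).
       (\<forall>r. \<forall>x\<in>carrier M. f (r \<odot>\<^bsub>M\<^esub> x) = r \<odot>\<^bsub>N\<^esub> f x) \<and>
       (\<forall>j. f ` hcomp M j \<subseteq> hcomp N (j + int \<eta>))}"

definition interleaved ::
  "nat \<Rightarrow> ('k::field, 'a) graded_module \<Rightarrow> ('k, 'b) graded_module \<Rightarrow> bool"
  where "interleaved \<eta> M N \<longleftrightarrow>
    (\<exists>\<phi> \<in> graded_morphisms \<eta> M N. \<exists>\<psi> \<in> graded_morphisms \<eta> N M.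
       (\<forall>x\<in>carrier M. \<psi> (\<phi> x) = monom 1 (2 * \<eta>) \<odot>\<^bsub>M\<^esub> x) \<and>
       (\<forall>y\<in>carrier N. \<phi> (\<psi> y) = monom 1 (2 * \<eta>) \<odot>\<^bsub>N\<^esub> y))"

definition family_interleaved ::
  "nat \<Rightarrow> (int \<Rightarrow> ('k::field, 'a) graded_module) \<Rightarrow> (int \<Rightarrow> ('k, 'b) graded_module) \<Rightarrow> bool"
  where "family_interleaved \<eta> M N \<longleftrightarrow> (\<forall>p. interleaved \<eta> (M p) (N p))"


section \<open>Free modules, subquotients and direct sums\<close>

definition free_module :: "'s set \<Rightarrow> ('r::comm_ring_1, 's \<Rightarrow>\<^sub>0 'r) module"
  where "free_module S =
    \<lparr>carrier = {c. Poly_Mapping.keys c \<subseteq> S}, monoid.mult = undefined, one = undefined,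
     zero = 0, add = (+), module.smult = (\<lambda>a. Poly_Mapping.map ((*) a))\<rparr>"

definition lin_ext :: "('s \<Rightarrow> ('u \<Rightarrow>\<^sub>0 'r::comm_ring_1)) \<Rightarrow> ('s \<Rightarrow>\<^sub>0 'r) \<Rightarrow> ('u \<Rightarrow>\<^sub>0 'r)"
  where "lin_ext f c =
    (\<Sum>s\<in>Poly_Mapping.keys c. Poly_Mapping.map ((*) (Poly_Mapping.lookup c s)) (f s))"

definition free_graded :: "('s \<Rightarrow> int) \<Rightarrow> 's set \<Rightarrow> ('k::field, 's \<Rightarrow>\<^sub>0 'k poly) graded_module"
  where "free_graded d S = graded (free_module S)
    (\<lambda>j. {c. Poly_Mapping.keys c \<subseteq> S \<and>
      (\<forall>s\<in>Poly_Mapping.keys c. d s \<le> j \<and>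
         (\<exists>a. Poly_Mapping.lookup c s = monom a (nat (j - d s))))})"

definition shifted_kt :: "int \<Rightarrow> ('k::field, unit \<Rightarrow>\<^sub>0 'k poly) graded_module"
  where "shifted_kt a = free_graded (\<lambda>_. a) UNIV"

definition zero_graded :: "('k::field, unit \<Rightarrow>\<^sub>0 'k poly) graded_module"
  where "zero_graded = free_graded (\<lambda>_. 0) {}"

text \<open>\<open>A / B\<close> for submodules \<open>B \<subseteq> A\<close> of \<open>M\<close>; its elements are cosets.\<close>

definition subquotient ::
  "('r, 'a, 'm) module_scheme \<Rightarrow> 'a set \<Rightarrow> 'a set \<Rightarrow> ('r, 'a set) module"
  where "subquotient M A B =
    \<lparr>carrier = (\<lambda>x. B +>\<^bsub>M\<^esub> x) ` A, monoid.mult = undefined, one = undefined,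
     zero = B, add = set_add M, module.smult = (\<lambda>a C. \<Union>x\<in>C. B +>\<^bsub>M\<^esub> (a \<odot>\<^bsub>M\<^esub> x))\<rparr>"

definition graded_subquotient ::
  "('k::field, 'a) graded_module \<Rightarrow> 'a set \<Rightarrow> 'a set \<Rightarrow> ('k, 'a set) graded_module"
  where "graded_subquotient M A B =
    graded (subquotient M A B) (\<lambda>j. (\<lambda>x. B +>\<^bsub>M\<^esub> x) ` (A \<inter> hcomp M j))"

text \<open>
  The graded module \<open>\<Oplus>\<^sub>j V j\<close> for vector spaces \<open>V j\<close> and transition maps
  \<open>\<tau> i j : V i \<rightarrow> V j\<close> (\<open>i \<le> j\<close>), with \<open>t^n\<close> acting on \<open>V j\<close> by \<open>\<tau> j (j + n)\<close>.
\<close>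

definition graded_sum ::
  "(int \<Rightarrow> ('k::field, 'a) module) \<Rightarrow> (int \<Rightarrow> int \<Rightarrow> 'a \<Rightarrow> 'a) \<Rightarrow> ('k, int \<Rightarrow> 'a) graded_module"
  where "graded_sum V \<tau> =
   (let C = {h. (\<forall>j. h j \<in> carrier (V j)) \<and> finite {j. h j \<noteq> \<zero>\<^bsub>V j\<^esub>}} in
    graded
      \<lparr>carrier = C, monoid.mult = undefined, one = undefined,
       zero = (\<lambda>j. \<zero>\<^bsub>V j\<^esub>), add = (\<lambda>h h' j. h j \<oplus>\<^bsub>V j\<^esub> h' j),
       module.smult = (\<lambda>r h j. \<Oplus>\<^bsub>V j\<^esub>n\<in>{..degree r}. coeff r n \<odot>\<^bsub>V j\<^esub> \<tau> (j - int n) j (h (j - int n)))\<rparr>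
      (\<lambda>j. {h \<in> C. \<forall>i. i \<noteq> j \<longrightarrow> h i = \<zero>\<^bsub>V i\<^esub>}))"


section \<open>Simplicial complexes and their homology over \<open>k\<close>\<close>

definition abstract_complex :: "'v set set \<Rightarrow> bool"
  where "abstract_complex K \<longleftrightarrow>
    (\<forall>\<sigma>\<in>K. finite \<sigma> \<and> \<sigma> \<noteq> {}) \<and> (\<forall>\<sigma>\<in>K. \<forall>\<tau>. \<tau> \<noteq> {} \<and> \<tau> \<subseteq> \<sigma> \<longrightarrow> \<tau> \<in> K)"

definition simplices :: "int \<Rightarrow> 'v set set \<Rightarrow> 'v set set"
  where "simplices q K = {\<sigma>\<in>K. int (card \<sigma>) = q + 1}"

definition del_nth :: "nat \<Rightarrow> 'v::linorder set \<Rightarrow> 'v set"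
  where "del_nth k \<sigma> = \<sigma> - {sorted_list_of_set \<sigma> ! k}"

definition bd_simplex :: "'v::linorder set \<Rightarrow> ('v set \<Rightarrow>\<^sub>0 'k::field)"
  where "bd_simplex \<sigma> =
    (if card \<sigma> \<le> 1 then 0 else \<Sum>k<card \<sigma>. Poly_Mapping.single (del_nth k \<sigma>) ((-1) ^ k))"

definition chains :: "int \<Rightarrow> 'v set set \<Rightarrow> ('k::field, 'v set \<Rightarrow>\<^sub>0 'k) module"
  where "chains q K = free_module (simplices q K)"

definition cycles :: "int \<Rightarrow> 'v::linorder set set \<Rightarrow> ('v set \<Rightarrow>\<^sub>0 'k::field) set"
  where "cycles q K = {c \<in> carrier (chains q K). lin_ext bd_simplex c = 0}"

definition boundaries :: "int \<Rightarrow> 'v::linorder set set \<Rightarrow> ('v set \<Rightarrow>\<^sub>0 'k::field) set"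
  where "boundaries q K = lin_ext bd_simplex ` carrier (chains (q + 1) K)"

definition homology :: "int \<Rightarrow> 'v::linorder set set \<Rightarrow> ('k::field, ('v set \<Rightarrow>\<^sub>0 'k) set) module"
  where "homology q K = subquotient (chains q K) (cycles q K) (boundaries q K)"

text \<open>The map \<open>H\<^sub>q(K) \<rightarrow> H\<^sub>q(L)\<close> induced by an inclusion \<open>K \<subseteq> L\<close>; it depends only on \<open>L\<close>.\<close>

definition homology_incl ::
  "int \<Rightarrow> 'v::linorder set set \<Rightarrow> ('v set \<Rightarrow>\<^sub>0 'k::field) set \<Rightarrow> ('v set \<Rightarrow>\<^sub>0 'k) set"
  where "homology_incl q L C = (\<Union>c\<in>C. boundaries q L +>\<^bsub>chains q L\<^esub> c)"


section \<open>Filtered complexes, covers and nerves\<close>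

record 'v filtered_complex =
  cplx :: "'v set set"
  filt :: "int \<Rightarrow> 'v set set"

definition is_filtered_complex :: "'v filtered_complex \<Rightarrow> bool"
  where "is_filtered_complex X \<longleftrightarrow>
    abstract_complex (cplx X) \<and> (\<forall>j. abstract_complex (filt X j)) \<and> mono (filt X) \<and>
    (\<Inter>j. filt X j) = {} \<and> (\<Union>j. filt X j) = cplx X"

definition filtered_cover ::
  "'v filtered_complex \<Rightarrow> 'i set \<Rightarrow> ('i \<Rightarrow> 'v filtered_complex) \<Rightarrow> bool"
  where "filtered_cover X \<Lambda> U \<longleftrightarrow>
    is_filtered_complex X \<and>
    (\<forall>i\<in>\<Lambda>. is_filtered_complex (U i) \<and> cplx (U i) \<subseteq> cplx X) \<and>
    (\<forall>j. filt X j = (\<Union>i\<in>\<Lambda>. filt (U i) j))"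

definition intersection ::
  "('i \<Rightarrow> 'v filtered_complex) \<Rightarrow> 'i set \<Rightarrow> 'v filtered_complex"
  where "intersection U I =
    \<lparr>cplx = (\<Inter>i\<in>I. cplx (U i)), filt = (\<lambda>j. \<Inter>i\<in>I. filt (U i) j)\<rparr>"

definition persistent_homology ::
  "int \<Rightarrow> 'v::linorder filtered_complex \<Rightarrow> ('k::field, int \<Rightarrow> ('v set \<Rightarrow>\<^sub>0 'k) set) graded_module"
  where "persistent_homology q X =
    graded_sum (\<lambda>j. homology q (filt X j)) (\<lambda>i j. homology_incl q (filt X j))"

definition nerve :: "'i set \<Rightarrow> ('i \<Rightarrow> 'v filtered_complex) \<Rightarrow> 'i filtered_complex"
  where "nerve \<Lambda> U =
   (let N = {I. I \<noteq> {} \<and> finite I \<and> I \<subseteq> \<Lambda> \<and> cplx (intersection U I) \<noteq> {}} in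
    \<lparr>cplx = N, filt = (\<lambda>j. {I\<in>N. (LEAST j'. filt (intersection U I) j' \<noteq> {}) \<le> j})\<rparr>)"

text \<open>The first argument only serves to name the coefficient field.\<close>

definition acyclic_cover ::
  "'k::field itself \<Rightarrow> nat \<Rightarrow> 'v::linorder filtered_complex \<Rightarrow> 'i set
    \<Rightarrow> ('i \<Rightarrow> 'v filtered_complex) \<Rightarrow> bool"
  where "acyclic_cover _ \<epsilon> X \<Lambda> U \<longleftrightarrow>
    filtered_cover X \<Lambda> U \<and>
    (\<forall>I \<in> cplx (nerve \<Lambda> U).
       (\<exists>a. interleaved \<epsilon>
          (persistent_homology 0 (intersection U I) :: ('k, _) graded_module) (shifted_kt a)) \<and>
       (\<forall>q. q \<noteq> 0 \<longrightarrow> interleaved \<epsilon>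
          (persistent_homology q (intersection U I) :: ('k, _) graded_module) zero_graded))"


section \<open>The Mayer-Vietoris spectral sequence\<close>

text \<open>
  All groups of the double complex are submodules of one free module, on the pairs
  \<open>(\<sigma>, I)\<close>; \<open>mv_basis \<Lambda> U p q\<close> is the basis of \<open>E\<^sup>0\<^sub>p\<^sub>,\<^sub>q\<close>. The indices
  \<open>p\<close> and \<open>q\<close> range over all integers, the basis being empty outside the first quadrant.
\<close>

definition mv_basis ::
  "'i set \<Rightarrow> ('i \<Rightarrow> 'v filtered_complex) \<Rightarrow> int \<Rightarrow> int \<Rightarrow> ('v set \<times> 'i set) set"
  where "mv_basis \<Lambda> U p q =
    {(\<sigma>, I). I \<in> simplices p (cplx (nerve \<Lambda> U)) \<and> \<sigma> \<in> simplices q (cplx (intersection U I))}"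

definition mv_deg :: "('i \<Rightarrow> 'v filtered_complex) \<Rightarrow> 'v set \<times> 'i set \<Rightarrow> int"
  where "mv_deg U = (\<lambda>(\<sigma>, I). LEAST j. \<sigma> \<in> filt (intersection U I) j)"

definition mv_d0 ::
  "('i \<Rightarrow> 'v::linorder filtered_complex) \<Rightarrow> 'v set \<times> 'i set \<Rightarrow> (('v set \<times> 'i set) \<Rightarrow>\<^sub>0 'k::field poly)"
  where "mv_d0 U = (\<lambda>(\<sigma>, I). if card \<sigma> \<le> 1 then 0 else
    \<Sum>k<card \<sigma>. Poly_Mapping.single (del_nth k \<sigma>, I)
      (monom ((-1) ^ k) (nat (mv_deg U (\<sigma>, I) - mv_deg U (del_nth k \<sigma>, I)))))"

definition mv_d1 ::
  "('i::linorder \<Rightarrow> 'v filtered_complex) \<Rightarrow> 'v set \<times> 'i set \<Rightarrow> (('v set \<times> 'i set) \<Rightarrow>\<^sub>0 'k::field poly)"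
  where "mv_d1 U = (\<lambda>(\<sigma>, I). if card I \<le> 1 then 0 else
    \<Sum>l<card I. Poly_Mapping.single (\<sigma>, del_nth l I)
      (monom ((-1) ^ l) (nat (mv_deg U (\<sigma>, I) - mv_deg U (\<sigma>, del_nth l I)))))"

text \<open>The differential \<open>(-1)^p \<partial>\<^sup>0 + \<partial>\<^sup>1\<close> of the total complex, where \<open>p = card I - 1\<close>.\<close>

definition mv_D ::
  "('i::linorder \<Rightarrow> 'v::linorder filtered_complex)
    \<Rightarrow> (('v set \<times> 'i set) \<Rightarrow>\<^sub>0 'k::field poly) \<Rightarrow> (('v set \<times> 'i set) \<Rightarrow>\<^sub>0 'k poly)"
  where "mv_D U = lin_ext (\<lambda>b.
    Poly_Mapping.map ((*) ((-1) ^ (card (snd b) - 1))) (mv_d0 U b) + mv_d1 U b)"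

text \<open>\<open>F\<^sub>p Tot\<^sub>n\<close>\<close>

definition mv_F ::
  "'i set \<Rightarrow> ('i \<Rightarrow> 'v filtered_complex) \<Rightarrow> int \<Rightarrow> int \<Rightarrow> (('v set \<times> 'i set) \<Rightarrow>\<^sub>0 'k::field poly) set"
  where "mv_F \<Lambda> U p n = {c. Poly_Mapping.keys c \<subseteq> (\<Union>p'\<in>{..p}. mv_basis \<Lambda> U p' (n - p'))}"

text \<open>
  The pages of the spectral sequence of a filtered complex:
  \<open>E\<^sup>r\<^sub>p\<^sub>,\<^sub>q = Z\<^sup>r\<^sub>p\<^sub>,\<^sub>q / (Z\<^sup>r\<^sup>-\<^sup>1\<^sub>p\<^sub>-\<^sub>1\<^sub>,\<^sub>q\<^sub>+\<^sub>1 + B\<^sup>r\<^sup>-\<^sup>1\<^sub>p\<^sub>,\<^sub>q)\<close> with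
  \<open>Z\<^sup>r\<^sub>p\<^sub>,\<^sub>q = {c \<in> F\<^sub>p Tot\<^sub>p\<^sub>+\<^sub>q. D c \<in> F\<^sub>p\<^sub>-\<^sub>r Tot\<^sub>p\<^sub>+\<^sub>q\<^sub>-\<^sub>1}\<close> and
  \<open>B\<^sup>r\<^sub>p\<^sub>,\<^sub>q = D(F\<^sub>p\<^sub>+\<^sub>r Tot\<^sub>p\<^sub>+\<^sub>q\<^sub>+\<^sub>1) \<inter> F\<^sub>p Tot\<^sub>p\<^sub>+\<^sub>q = D(Z\<^sup>r\<^sub>p\<^sub>+\<^sub>r\<^sub>,\<^sub>q\<^sub>-\<^sub>r\<^sub>+\<^sub>1)\<close>. The page index is an
  integer, so that \<open>r = 0\<close> needs no special treatment.
\<close>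

definition mv_Z ::
  "'i::linorder set \<Rightarrow> ('i \<Rightarrow> 'v::linorder filtered_complex) \<Rightarrow> int \<Rightarrow> int \<Rightarrow> int
    \<Rightarrow> (('v set \<times> 'i set) \<Rightarrow>\<^sub>0 'k::field poly) set"
  where "mv_Z \<Lambda> U r p q = {c \<in> mv_F \<Lambda> U p (p + q). mv_D U c \<in> mv_F \<Lambda> U (p - r) (p + q - 1)}"

definition mv_B ::
  "'i::linorder set \<Rightarrow> ('i \<Rightarrow> 'v::linorder filtered_complex) \<Rightarrow> int \<Rightarrow> int \<Rightarrow> int
    \<Rightarrow> (('v set \<times> 'i set) \<Rightarrow>\<^sub>0 'k::field poly) set"
  where "mv_B \<Lambda> U r p q = mv_D U ` mv_F \<Lambda> U (p + r) (p + q + 1) \<inter> mv_F \<Lambda> U p (p + q)"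

definition mv_total ::
  "'i set \<Rightarrow> ('i \<Rightarrow> 'v filtered_complex)
    \<Rightarrow> ('k::field, ('v set \<times> 'i set) \<Rightarrow>\<^sub>0 'k poly) graded_module"
  where "mv_total \<Lambda> U = free_graded (mv_deg U) (\<Union>p q. mv_basis \<Lambda> U p q)"

definition mv_page ::
  "'i::linorder set \<Rightarrow> ('i \<Rightarrow> 'v::linorder filtered_complex) \<Rightarrow> int \<Rightarrow> int \<Rightarrow> int
    \<Rightarrow> ('k::field, (('v set \<times> 'i set) \<Rightarrow>\<^sub>0 'k poly) set) graded_module"
  where "mv_page \<Lambda> U r p q = graded_subquotient (mv_total \<Lambda> U) (mv_Z \<Lambda> U r p q)
    (set_add (mv_total \<Lambda> U) (mv_Z \<Lambda> U (r - 1) (p - 1) (q + 1)) (mv_B \<Lambda> U (r - 1) p q))"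

text \<open>
  The limit page, built from \<open>Z\<^sup>\<infinity> = \<Inter>\<^sub>r Z\<^sup>r\<close> and \<open>B\<^sup>\<infinity> = \<Union>\<^sub>r B\<^sup>r\<close>; since the double complex
  lives in the first quadrant, \<open>mv_page \<Lambda> U r p q\<close> equals it for all large \<open>r\<close>.
\<close>

definition mv_limit_page ::
  "'i::linorder set \<Rightarrow> ('i \<Rightarrow> 'v::linorder filtered_complex) \<Rightarrow> int \<Rightarrow> int
    \<Rightarrow> ('k::field, (('v set \<times> 'i set) \<Rightarrow>\<^sub>0 'k poly) set) graded_module"
  where "mv_limit_page \<Lambda> U p q = graded_subquotient (mv_total \<Lambda> U) (\<Inter>r. mv_Z \<Lambda> U r p q)
    (set_add (mv_total \<Lambda> U) (\<Inter>r. mv_Z \<Lambda> U r (p - 1) (q + 1)) (\<Union>r. mv_B \<Lambda> U r p q))"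

end

theory Submission
  imports Defs
begin

text \<open>
  Write \<open>S_a\<close> for \<open>t^a k[t]\<close>. All three graded modules turn out to be those of a sphere: up to
  isomorphism each is \<open>S_0\<close> in dimension 0, a single \<open>S_a\<close> in dimension \<open>D\<close>, and zero elsewhere.
  The degree \<open>a\<close> is 2 for the homology of the nerve (\<open>nerve_homology_D\<close>), 4 for the second page and
  \<open>2D + 2\<close> for the limit page (\<open>bottom_row_D\<close>). As \<open>S_a\<close> and \<open>S_b\<close> are \<open>\<eta>\<close>-interleaved exactly
  if \<open>\<bar>a - b\<bar> \<le> \<eta>\<close> (\<open>interleaved_shifted_kt_iff\<close>), the optimal shifts are \<open>4 - 2 = 2\<close> and
  \<open>(2D + 2) - 4 = 2(D - 1)\<close>.

  The reason for the delays is visible in the cover. Let \<open>V = {0..D + 1}\<close>. A simplex \<open>s\<close> is born in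
  degree \<open>2 min (V - s)\<close>, whatever the cover element. So in degrees \<open>2j\<close> and \<open>2j + 1\<close> the intersection
  \<open>U_I\<close> consists of the simplices on \<open>V - I\<close> not containing \<open>{0..j}\<close>. It is contractible or
  empty, except for \<open>I = {j + 1..D + 1}\<close>, where it is the sphere bounding \<open>{0..j}\<close> for exactly two
  degrees. The cover is therefore 1-acyclic (\<open>acyclic\<close>), and each column before column \<open>D\<close> has
  one torsion class of length 2, the one for \<open>j \<ge> 1\<close> sitting in row \<open>j - 1\<close> and column
  \<open>D - j\<close>. All of these have total degree \<open>D - 1\<close>, so they can only interact with the top class
  in column \<open>D\<close> and row 0: each differential \<open>d^j\<close> hits the torsion class for \<open>j\<close> and delays the
  top class by 2.

  The proof works with explicit chains instead of computing the pages one by one. In dimension \<open>D\<close>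
  the coefficients of a total chain are indexed by complementary pairs \<open>(s, V - s)\<close>, and the
  condition that its differential lies \<open>n + 1\<close> filtration steps lower links the coefficients at
  \<open>s\<close> and \<open>s \<union> {w}\<close>, up to sign and a power of \<open>t\<close>, when \<open>s\<close> has at most \<open>n\<close> elements. Following
  \<open>{0}, {0, 1}, ..., {0..n}\<close> shows that the coefficient at \<open>{0..n}\<close>, a simplex of degree \<open>2n + 2\<close>,
  determines the class, and the alternating sum of all small pairs realises the value 1
  (\<open>bottom_row_D\<close>, used for \<open>n = 1\<close> and \<open>n = D\<close>). Below dimension \<open>D\<close> a row cycle has an augmentation
  in the chains of the nerve which bounds, and a correction by boundaries moves the cycle into lower
  filtration (\<open>fill\<close>). The torsion class in row 0 does no harm there, being the boundary of a lift
  of the fundamental cycle of the nerve (\<open>fill_last_edge\<close>).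
\<close>

section \<open>Linear algebra in free modules\<close>

abbreviation scale :: "'r::comm_ring_1 \<Rightarrow> ('s \<Rightarrow>\<^sub>0 'r) \<Rightarrow> ('s \<Rightarrow>\<^sub>0 'r)"
  where "scale a \<equiv> Poly_Mapping.map ((*) a)"

abbreviation coef :: "('s \<Rightarrow>\<^sub>0 'r::zero) \<Rightarrow> 's \<Rightarrow> 'r"
  where "coef \<equiv> Poly_Mapping.lookup"

abbreviation supp :: "('s \<Rightarrow>\<^sub>0 'r::zero) \<Rightarrow> 's set"
  where "supp \<equiv> Poly_Mapping.keys"

lemma coef_scale [simp]: "coef (scale a c) s = a * coef c s"
  by (simp add: map.rep_eq when_def)

lemma scale_add: "scale a (x + y) = scale a x + scale a y"
  by (rule poly_mapping_eqI) (simp add: lookup_add algebra_simps)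

lemma scale_diff: "scale a (x - y) = scale a x - scale a y"
  by (rule poly_mapping_eqI) (simp add: lookup_minus algebra_simps)

lemma scale_add_left: "scale (a + b) x = scale a x + scale b x"
  by (rule poly_mapping_eqI) (simp add: lookup_add algebra_simps)

lemma scale_scale: "scale a (scale b x) = scale (a * b) x"
  by (rule poly_mapping_eqI) (simp add: algebra_simps)

lemma scale_simps [simp]: "scale 1 x = x" "scale 0 x = 0" "scale a 0 = 0"
  by (auto intro!: poly_mapping_eqI)

lemma scale_minus_one: "scale (- 1) x = - x"
  by (rule poly_mapping_eqI) simp

lemma supp_add_subset: "supp x \<subseteq> S \<Longrightarrow> supp y \<subseteq> S \<Longrightarrow> supp (x + y) \<subseteq> S"
  using Poly_Mapping.keys_add[of x y] by auto

lemma supp_scale_subset: "supp x \<subseteq> S \<Longrightarrow> supp (scale a x) \<subseteq> S"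
  by (metis coef_scale in_keys_iff mult_zero_right subsetD subsetI)

lemma coef_eq_0: "supp x \<subseteq> S \<Longrightarrow> s \<notin> S \<Longrightarrow> coef x s = 0"
  by (auto simp: in_keys_iff)

definition lin_closed :: "('s \<Rightarrow>\<^sub>0 'r::comm_ring_1) set \<Rightarrow> bool"
  where "lin_closed B \<longleftrightarrow>
    0 \<in> B \<and> (\<forall>x\<in>B. \<forall>y\<in>B. x + y \<in> B) \<and> (\<forall>a. \<forall>x\<in>B. scale a x \<in> B)"

lemma lin_closedI:
  assumes "0 \<in> B" "\<And>x y. x \<in> B \<Longrightarrow> y \<in> B \<Longrightarrow> x + y \<in> B" "\<And>a x. x \<in> B \<Longrightarrow> scale a x \<in> B"
  shows "lin_closed B"
  using assms by (simp add: lin_closed_def)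

lemma lin_closedD:
  assumes "lin_closed B"
  shows "0 \<in> B" "x \<in> B \<Longrightarrow> y \<in> B \<Longrightarrow> x + y \<in> B" "x \<in> B \<Longrightarrow> scale a x \<in> B"
    "x \<in> B \<Longrightarrow> - x \<in> B" "x \<in> B \<Longrightarrow> y \<in> B \<Longrightarrow> x - y \<in> B"
proof -
  show 1: "0 \<in> B" "x \<in> B \<Longrightarrow> y \<in> B \<Longrightarrow> x + y \<in> B" "x \<in> B \<Longrightarrow> scale a x \<in> B" for x y a
    using assms by (auto simp: lin_closed_def)
  show 2: "x \<in> B \<Longrightarrow> - x \<in> B" for x using 1(3)[of x "-1"] by (simp add: scale_minus_one)
  show "x \<in> B \<Longrightarrow> y \<in> B \<Longrightarrow> x - y \<in> B" using 1(2)[of x "- y"] 2[of y] by simp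
qed

lemma lin_closed_supp: "lin_closed {c. supp c \<subseteq> S}"
  by (rule lin_closedI) (simp_all add: supp_scale_subset supp_add_subset)

lemma lin_closed_Int: "lin_closed A \<Longrightarrow> lin_closed B \<Longrightarrow> lin_closed (A \<inter> B)"
  by (auto simp: lin_closed_def)

definition linear_map :: "(('s \<Rightarrow>\<^sub>0 'r::comm_ring_1) \<Rightarrow> ('u \<Rightarrow>\<^sub>0 'r)) \<Rightarrow> bool"
  where "linear_map f \<longleftrightarrow> (\<forall>x y. f (x + y) = f x + f y) \<and> (\<forall>a x. f (scale a x) = scale a (f x))"

definition linear_form :: "(('s \<Rightarrow>\<^sub>0 'r::comm_ring_1) \<Rightarrow> 'r) \<Rightarrow> bool"
  where "linear_form f \<longleftrightarrow> (\<forall>x y. f (x + y) = f x + f y) \<and> (\<forall>a x. f (scale a x) = a * f x)"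

lemma linear_formD:
  assumes "linear_form f"
  shows "f (x + y) = f x + f y" "f (scale a x) = a * f x" "f 0 = 0" "f (x - y) = f x - f y"
proof -
  show 1: "f (x + y) = f x + f y" "f (scale a x) = a * f x" for x y a
    using assms by (auto simp: linear_form_def)
  show "f 0 = 0" using 1(2)[of 0 0] by simp
  show "f (x - y) = f x - f y" using 1(1)[of "x - y" y] by simp
qed

lemma linear_form_residual:
  "linear_form f \<Longrightarrow> f z = 1 \<Longrightarrow> f (x - scale (f x) z) = 0"
  by (simp add: linear_formD(2,4))

lemma linear_mapD:
  assumes "linear_map f"
  shows "f (x + y) = f x + f y" "f (scale a x) = scale a (f x)" "f 0 = 0" "f (x - y) = f x - f y"
proof -
  show 1: "f (x + y) = f x + f y" "f (scale a x) = scale a (f x)" for x y a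
    using assms by (auto simp: linear_map_def)
  show "f 0 = 0" using 1(2)[of 0 0] by simp
  show "f (x - y) = f x - f y" using 1(1)[of "x - y" y] by simp
qed

lemma lin_closed_image:
  assumes f: "linear_map f" and B: "lin_closed B"
  shows "lin_closed (f ` B)"
proof (rule lin_closedI)
  show "0 \<in> f ` B" using linear_mapD(3)[OF f] lin_closedD(1)[OF B] by (metis imageI)
  show "x + y \<in> f ` B" if "x \<in> f ` B" "y \<in> f ` B" for x y
    using that lin_closedD(2)[OF B] linear_mapD(1)[OF f] by (metis (no_types, lifting) image_iff)
  show "scale a x \<in> f ` B" if "x \<in> f ` B" for a x
    using that lin_closedD(3)[OF B] linear_mapD(2)[OF f] by (metis (no_types, lifting) image_iff)
qed

lemma lin_closed_vimage:
  assumes f: "linear_map f" and B: "lin_closed B"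
  shows "lin_closed {x. f x \<in> B}"
  by (rule lin_closedI) (simp_all add: linear_mapD[OF f] lin_closedD[OF B])

lemma lin_closed_zero: "lin_closed {0}"
  by (rule lin_closedI) auto

lemma coef_sum: "coef (sum f A) s = (\<Sum>x\<in>A. coef (f x) s)"
  by (induction A rule: infinite_finite_induct) (auto simp: lookup_add)

lemma coef_lin_ext:
  assumes "finite S" "supp c \<subseteq> S"
  shows "coef (lin_ext f c) u = (\<Sum>s\<in>S. coef c s * coef (f s) u)"
proof -
  have "coef (lin_ext f c) u = (\<Sum>s\<in>supp c. coef c s * coef (f s) u)"
    by (simp add: lin_ext_def coef_sum)
  also have "\<dots> = (\<Sum>s\<in>S. coef c s * coef (f s) u)"
    using assms by (intro sum.mono_neutral_left) (auto simp: in_keys_iff)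
  finally show ?thesis .
qed

lemma linear_map_lin_ext: "linear_map (lin_ext f)"
  unfolding linear_map_def
proof (intro conjI allI; rule poly_mapping_eqI)
  fix x y :: "'a \<Rightarrow>\<^sub>0 'b" and k a
  let ?S = "supp x \<union> supp y"
  have *: "supp (x + y) \<subseteq> ?S" by (simp add: Poly_Mapping.keys_add)
  show "coef (lin_ext f (x + y)) k = coef (lin_ext f x + lin_ext f y) k"
    using * by (simp add: coef_lin_ext[of ?S] lookup_add sum.distrib algebra_simps)
  show "coef (lin_ext f (scale a x)) k = coef (scale a (lin_ext f x)) k"
    using supp_scale_subset[of x "supp x" a]
    by (simp add: coef_lin_ext[of "supp x"] sum_distrib_left algebra_simps)
qed

definition of_fun :: "'s set \<Rightarrow> ('s \<Rightarrow> 'r::comm_ring_1) \<Rightarrow> ('s \<Rightarrow>\<^sub>0 'r)"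
  where "of_fun S g = (\<Sum>s\<in>S. Poly_Mapping.single s (g s))"

lemma coef_of_fun: "finite S \<Longrightarrow> coef (of_fun S g) s = (if s \<in> S then g s else 0)"
  by (simp add: of_fun_def coef_sum lookup_single when_def sum.delta)

lemma supp_of_fun: "finite S \<Longrightarrow> supp (of_fun S g) \<subseteq> S"
  by (auto simp: in_keys_iff coef_of_fun split: if_splits)

section \<open>Cosets and subquotients\<close>

abbreviation coset :: "('s \<Rightarrow>\<^sub>0 'r::comm_ring_1) set \<Rightarrow> ('s \<Rightarrow>\<^sub>0 'r) \<Rightarrow> ('s \<Rightarrow>\<^sub>0 'r) set"
  where "coset B x \<equiv> (\<lambda>b. b + x) ` B"

lemma mem_coset: "y \<in> coset B x \<longleftrightarrow> y - x \<in> B"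
  by (auto simp: image_iff intro: bexI[of _ "y - x"])

lemma coset_eq_iff:
  assumes "lin_closed B"
  shows "coset B x = coset B y \<longleftrightarrow> x - y \<in> B"
proof
  assume "coset B x = coset B y"
  moreover have "x \<in> coset B x" unfolding mem_coset using lin_closedD(1)[OF assms] by simp
  ultimately have "x \<in> coset B y" by (rule subst)
  then show "x - y \<in> B" by (simp only: mem_coset)
next
  assume *: "x - y \<in> B"
  have "u - x \<in> B \<longleftrightarrow> u - y \<in> B" for u
  proof -
    have "u - y = (u - x) + (x - y)" "u - x = (u - y) - (x - y)" by simp_all
    then show ?thesis using * lin_closedD(2,5)[OF assms] by metis
  qed
  then show "coset B x = coset B y" by (intro subset_antisym subsetI; unfold mem_coset; blast)
qed

lemma coset_zero [simp]: "coset B 0 = B"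
  by simp

lemma coset_add:
  assumes "lin_closed B"
  shows "{u + v |u v. u \<in> coset B x \<and> v \<in> coset B y} = coset B (x + y)" (is "?L = ?R")
proof (intro subset_antisym subsetI)
  fix w assume "w \<in> ?L"
  then obtain b b' where "b \<in> B" "b' \<in> B" "w = (b + b') + (x + y)" by (auto simp: algebra_simps)
  then show "w \<in> ?R" using lin_closedD(2)[OF assms] by blast
next
  fix w assume "w \<in> ?R"
  then obtain b where b: "b \<in> B" "w = b + (x + y)" by blast
  then have "w = (b + x) + (0 + y)" by (simp add: algebra_simps)
  then show "w \<in> ?L" using b lin_closedD(1)[OF assms] by blast
qed

lemma coset_scl:
  assumes "lin_closed B"
  shows "(\<Union>c\<in>coset B x. coset B (scale a c)) = coset B (scale a x)"
proof -
  have "coset B (scale a c) = coset B (scale a x)" if "c \<in> coset B x" for c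
    using that assms lin_closedD(3)[OF assms] by (simp only: mem_coset coset_eq_iff flip: scale_diff)
  moreover have "x \<in> coset B x" using lin_closedD(1)[OF assms] by (simp only: mem_coset) simp
  ultimately show ?thesis by blast
qed

text \<open>A form that vanishes on \<open>B\<close> descends to the quotient. The choice of a representative is how
  the descended form is evaluated below on a coset that comes without one.\<close>

lemma linear_form_coset:
  assumes "lin_closed B" "linear_form F" "\<And>b. b \<in> B \<Longrightarrow> F b = 0"
  shows "F (SOME y. y \<in> coset B x) = F x"
proof -
  have "x \<in> coset B x" using lin_closedD(1)[OF assms(1)] by (simp only: mem_coset) simp
  then have "(SOME y. y \<in> coset B x) - x \<in> B" by (metis mem_coset someI)
  then show ?thesis using assms(3) linear_formD(4)[OF assms(2)] by fastforce
qed

lemma r_coset_plus: "add M = (+) \<Longrightarrow> B +>\<^bsub>M\<^esub> x = coset B x"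
  by (auto simp: a_r_coset_def r_coset_def)

lemma set_add_plus: "add M = (+) \<Longrightarrow> set_add M P Q = {u + v |u v. u \<in> P \<and> v \<in> Q}"
  by (auto simp: set_add_def set_mult_def)

lemma subquotient_fields:
  fixes M :: "('r::comm_ring_1, 's \<Rightarrow>\<^sub>0 'r, 'm) module_scheme"
  assumes "add M = (+)" "module.smult M = scale" "lin_closed B"
  shows "carrier (subquotient M A B) = coset B ` A" "zero (subquotient M A B) = B"
    "coset B x \<oplus>\<^bsub>subquotient M A B\<^esub> coset B y = coset B (x + y)"
    "a \<odot>\<^bsub>subquotient M A B\<^esub> coset B x = coset B (scale a x)"
  using assms(1,2)
  by (simp_all only: subquotient_def partial_object.simps monoid.simps ring.simps module.simps
      r_coset_plus[OF assms(1)] set_add_plus[OF assms(1)] coset_add[OF assms(3)] coset_scl[OF assms(3)])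

section \<open>Interleavings of graded modules\<close>

text \<open>Module records carry no axioms; composing interleavings needs that \<open>t^0\<close> acts as the identity.\<close>

definition unital :: "('k::field, 'a) graded_module \<Rightarrow> bool"
  where "unital M \<longleftrightarrow> (\<forall>x\<in>carrier M. 1 \<odot>\<^bsub>M\<^esub> x = x)"

lemma graded_morphismsI:
  assumes "\<And>x. x \<in> carrier M \<Longrightarrow> f x \<in> carrier N"
    and "\<And>x y. x \<in> carrier M \<Longrightarrow> y \<in> carrier M \<Longrightarrow> f (x \<oplus>\<^bsub>M\<^esub> y) = f x \<oplus>\<^bsub>N\<^esub> f y"
    and "\<And>r x. x \<in> carrier M \<Longrightarrow> f (r \<odot>\<^bsub>M\<^esub> x) = r \<odot>\<^bsub>N\<^esub> f x"
    and "\<And>j x. x \<in> hcomp M j \<Longrightarrow> f x \<in> hcomp N (j + int \<eta>)"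
  shows "f \<in> graded_morphisms \<eta> M N"
  using assms by (auto simp: graded_morphisms_def hom_def)

lemma graded_morphismsD:
  assumes "f \<in> graded_morphisms \<eta> M N"
  shows "x \<in> carrier M \<Longrightarrow> f x \<in> carrier N"
    and "x \<in> carrier M \<Longrightarrow> y \<in> carrier M \<Longrightarrow> f (x \<oplus>\<^bsub>M\<^esub> y) = f x \<oplus>\<^bsub>N\<^esub> f y"
    and "x \<in> carrier M \<Longrightarrow> f (r \<odot>\<^bsub>M\<^esub> x) = r \<odot>\<^bsub>N\<^esub> f x"
    and "x \<in> hcomp M j \<Longrightarrow> f x \<in> hcomp N (j + int \<eta>)"
  using assms unfolding graded_morphisms_def hom_def by auto blast

lemma graded_morphisms_comp:
  assumes "f \<in> graded_morphisms a M N" "g \<in> graded_morphisms b N P"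
  shows "g \<circ> f \<in> graded_morphisms (a + b) M P"
proof (rule graded_morphismsI)
  fix j x assume "x \<in> hcomp M j"
  then have "g (f x) \<in> hcomp P (j + int a + int b)"
    using assms by (auto dest: graded_morphismsD(4))
  then show "(g \<circ> f) x \<in> hcomp P (j + int (a + b))" by (simp add: add.assoc)
qed (use graded_morphismsD[OF assms(1)] graded_morphismsD[OF assms(2)] in auto)

lemma interleaved_sym: "interleaved \<eta> M N \<Longrightarrow> interleaved \<eta> N M"
  unfolding interleaved_def by blast

text \<open>A 0-interleaving is a graded isomorphism, up to multiplication by \<open>t^0\<close>; composing with it
  does not change the shift. Hence interleavings may be tested on the model modules
  \<open>t^a k[t]\<close> and \<open>0\<close>.\<close>

lemma interleaved_iso_left:
  assumes MN: "interleaved 0 M N" and NP: "interleaved \<eta> N P" and "unital M" "unital P"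
  shows "interleaved \<eta> M P"
proof -
  obtain f g where f: "f \<in> graded_morphisms 0 M N" and g: "g \<in> graded_morphisms 0 N M"
    and gf: "\<And>x. x \<in> carrier M \<Longrightarrow> g (f x) = x"
    and fg: "\<And>y. y \<in> carrier N \<Longrightarrow> f (g y) = 1 \<odot>\<^bsub>N\<^esub> y"
    using MN \<open>unital M\<close> unfolding interleaved_def unital_def by (fastforce simp: monom_0 pCons_one)
  obtain \<phi> \<psi> where \<phi>: "\<phi> \<in> graded_morphisms \<eta> N P" and \<psi>: "\<psi> \<in> graded_morphisms \<eta> P N"
    and \<psi>\<phi>: "\<And>x. x \<in> carrier N \<Longrightarrow> \<psi> (\<phi> x) = monom 1 (2 * \<eta>) \<odot>\<^bsub>N\<^esub> x"
    and \<phi>\<psi>: "\<And>y. y \<in> carrier P \<Longrightarrow> \<phi> (\<psi> y) = monom 1 (2 * \<eta>) \<odot>\<^bsub>P\<^esub> y"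
    using NP unfolding interleaved_def by blast
  note fD = graded_morphismsD[OF f] and gD = graded_morphismsD[OF g]
    and \<phi>D = graded_morphismsD[OF \<phi>] and \<psi>D = graded_morphismsD[OF \<psi>]
  show ?thesis
    unfolding interleaved_def
  proof (intro bexI conjI ballI)
    show "\<phi> \<circ> f \<in> graded_morphisms \<eta> M P" using graded_morphisms_comp[OF f \<phi>] by simp
    show "g \<circ> \<psi> \<in> graded_morphisms \<eta> P M" using graded_morphisms_comp[OF \<psi> g] by simp
    show "(g \<circ> \<psi>) ((\<phi> \<circ> f) x) = monom 1 (2 * \<eta>) \<odot>\<^bsub>M\<^esub> x" if "x \<in> carrier M" for x
      using that by (simp add: \<psi>\<phi> fD gD gf)
    show "(\<phi> \<circ> f) ((g \<circ> \<psi>) y) = monom 1 (2 * \<eta>) \<odot>\<^bsub>P\<^esub> y" if "y \<in> carrier P" for y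
    proof -
      have "\<phi> (f (g (\<psi> y))) = 1 \<odot>\<^bsub>P\<^esub> \<phi> (\<psi> y)" using that by (simp add: fg \<psi>D \<phi>D)
      also have "\<dots> = \<phi> (\<psi> y)" using that \<open>unital P\<close> \<phi>D(1) \<psi>D(1) by (simp add: unital_def)
      finally show ?thesis using \<phi>\<psi>[OF that] by simp
    qed
  qed
qed

lemma interleaved_iso:
  assumes "interleaved 0 M M'" "interleaved 0 N N'" "unital M" "unital M'" "unital N" "unital N'"
  shows "interleaved \<eta> M N \<longleftrightarrow> interleaved \<eta> M' N'"
  using assms by (metis interleaved_iso_left interleaved_sym)

lemma free_graded_simps:
  "carrier (free_graded d S) = {c. supp c \<subseteq> S}"
  "add (free_graded d S) = (+)"
  "module.smult (free_graded d S) = scale"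
  "hcomp (free_graded d S) j = {c. supp c \<subseteq> S \<and>
      (\<forall>s\<in>supp c. d s \<le> j \<and> (\<exists>a. coef c s = monom a (nat (j - d s))))}"
  by (simp_all add: free_graded_def free_module_def module.defs graded_module.defs)

lemma unital_free: "unital (free_graded d S)"
  by (simp add: unital_def free_graded_simps)

lemma unital_shifted_kt: "unital (shifted_kt a)"
  by (simp add: unital_free shifted_kt_def)

lemma unital_zero_graded: "unital zero_graded"
  by (simp add: unital_free zero_graded_def)

lemma poly_mapping_unit_eq_0: "x = 0 \<longleftrightarrow> coef x () = 0"
  by (auto intro!: poly_mapping_eqI)

lemma shifted_kt_simps:
  fixes x :: "unit \<Rightarrow>\<^sub>0 'k::field poly"
  shows "carrier (shifted_kt a :: ('k, _) graded_module) = UNIV"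
    "add (shifted_kt a :: ('k, _) graded_module) = (+)"
    "module.smult (shifted_kt a :: ('k, _) graded_module) = scale"
    "x \<in> hcomp (shifted_kt a) j \<longleftrightarrow> (if j < a then x = 0 else \<exists>b. coef x () = monom b (nat (j - a)))"
proof -
  show "x \<in> hcomp (shifted_kt a) j \<longleftrightarrow> (if j < a then x = 0 else \<exists>b. coef x () = monom b (nat (j - a)))"
    by (auto simp: shifted_kt_def free_graded_simps in_keys_iff poly_mapping_unit_eq_0 UNIV_unit intro: exI[of _ 0])
qed (simp_all add: shifted_kt_def free_graded_simps)

lemma zero_graded_simps:
  "carrier zero_graded = {0}"
  "add zero_graded = (+)"
  "module.smult zero_graded = scale"
  "hcomp zero_graded j = {0}"
  by (auto simp: zero_graded_def free_graded_simps)

lemma interleaved_zero_graded: "interleaved \<eta> zero_graded zero_graded"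
  unfolding interleaved_def
  by (rule bexI[of _ "\<lambda>x. x"], rule bexI[of _ "\<lambda>x. x"]; (rule graded_morphismsI)?; simp add: zero_graded_simps)

text \<open>If \<open>a + \<eta> < b\<close>, an \<open>\<eta>\<close>-morphism \<open>t^a k[t] \<rightarrow> t^b k[t]\<close> sends the generator to a zero
  component, so no round trip through it can be \<open>t^(2\<eta>)\<close>. Otherwise powers of \<open>t\<close> interleave.
  All lower bounds in the theorem come from here.\<close>

lemma interleaved_shifted_kt_iff:
  "interleaved \<eta> (shifted_kt a :: ('k::field, _) graded_module) (shifted_kt b) \<longleftrightarrow> \<bar>a - b\<bar> \<le> int \<eta>"
proof
  have le: "b \<le> a + int \<eta>"
    if ab: "interleaved \<eta> (shifted_kt a :: ('k, _) graded_module) (shifted_kt b :: ('k, _) graded_module)" for a b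
  proof (rule ccontr)
    assume "\<not> b \<le> a + int \<eta>"
    then have b: "b > a + int \<eta>" by simp
    obtain \<phi> \<psi> where \<phi>: "\<phi> \<in> graded_morphisms \<eta> (shifted_kt a) (shifted_kt b :: ('k, _) graded_module)"
      and \<psi>: "\<psi> \<in> graded_morphisms \<eta> (shifted_kt b) (shifted_kt a :: ('k, _) graded_module)"
      and \<psi>\<phi>: "\<And>x. \<psi> (\<phi> x) = scale (monom 1 (2 * \<eta>)) x"
      using ab unfolding interleaved_def Ball_def Bex_def shifted_kt_simps by blast
    define e :: "unit \<Rightarrow>\<^sub>0 'k poly" where "e = Poly_Mapping.single () 1"
    have "e \<in> hcomp (shifted_kt a) a"
      by (auto simp: shifted_kt_simps e_def monom_0 pCons_one intro!: exI[of _ 1])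
    then have "\<phi> e \<in> hcomp (shifted_kt b) (a + int \<eta>)" using \<phi> by (rule graded_morphismsD(4)[rotated])
    then have "\<phi> e = 0" using b by (simp add: shifted_kt_simps)
    moreover have "\<psi> 0 = 0" using graded_morphismsD(3)[OF \<psi>, of 0 0] by (simp add: shifted_kt_simps)
    ultimately have "coef (scale (monom 1 (2 * \<eta>)) e) () = 0" using \<psi>\<phi>[of e] by simp
    then show False by (simp add: e_def)
  qed
  show "\<bar>a - b\<bar> \<le> int \<eta>" if "interleaved \<eta> (shifted_kt a :: ('k, _) graded_module) (shifted_kt b :: ('k, _) graded_module)"
    using le[OF that] le[OF interleaved_sym[OF that]] by simp
next
  assume *: "\<bar>a - b\<bar> \<le> int \<eta>"
  have mor: "scale (monom 1 (nat (a + int \<eta> - b))) \<in> graded_morphisms \<eta> (shifted_kt a) (shifted_kt b :: ('k, _) graded_module)"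
    if "\<bar>a - b\<bar> \<le> int \<eta>" for a b
  proof (rule graded_morphismsI)
    fix j and x :: "unit \<Rightarrow>\<^sub>0 'k poly"
    assume x: "x \<in> hcomp (shifted_kt a) j"
    show "scale (monom 1 (nat (a + int \<eta> - b))) x \<in> hcomp (shifted_kt b) (j + int \<eta>)"
    proof (cases "j < a")
      case True
      then show ?thesis using x by (simp add: shifted_kt_simps)
    next
      case False
      then obtain c where c: "coef x () = monom c (nat (j - a))" using x by (auto simp: shifted_kt_simps)
      have "nat (a + int \<eta> - b) + nat (j - a) = nat (j + int \<eta> - b)" using that False by simp
      then show ?thesis using that False by (auto simp: shifted_kt_simps c mult_monom)
    qed
  qed (simp_all add: shifted_kt_simps scale_add scale_scale mult.commute[of "monom _ _"])
  have eq: "nat (a + int \<eta> - b) + nat (b + int \<eta> - a) = 2 * \<eta>"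
    "nat (b + int \<eta> - a) + nat (a + int \<eta> - b) = 2 * \<eta>" using * by simp_all
  show "interleaved \<eta> (shifted_kt a :: ('k, _) graded_module) (shifted_kt b)"
    unfolding interleaved_def
    by (intro bexI[OF _ mor[OF *]] bexI[OF _ mor[of b a]])
      (use * in \<open>simp_all add: shifted_kt_simps scale_scale mult_monom eq\<close>)
qed

section \<open>Graded subquotients of free modules\<close>

lemma graded_subquotient_fields:
  fixes d :: "'s \<Rightarrow> int" and S :: "'s set" and A B :: "('s \<Rightarrow>\<^sub>0 'k::field poly) set"
  defines "Q \<equiv> graded_subquotient (free_graded d S) A B"
  assumes "lin_closed B"
  shows "carrier Q = coset B ` A" "coset B x \<oplus>\<^bsub>Q\<^esub> coset B y = coset B (x + y)"
    "a \<odot>\<^bsub>Q\<^esub> coset B x = coset B (scale a x)"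
    "hcomp Q j = coset B ` (A \<inter> hcomp (free_graded d S) j)"
proof -
  note * = subquotient_fields[OF free_graded_simps(2,3) assms(2)]
  show "carrier Q = coset B ` A" "coset B x \<oplus>\<^bsub>Q\<^esub> coset B y = coset B (x + y)"
    "a \<odot>\<^bsub>Q\<^esub> coset B x = coset B (scale a x)"
    "hcomp Q j = coset B ` (A \<inter> hcomp (free_graded d S) j)"
    using *[where A=A]
    by (simp_all add: Q_def graded_subquotient_def module.defs graded_module.defs r_coset_plus free_graded_simps(2))
qed

lemma unital_graded_subquotient:
  fixes A B :: "('s \<Rightarrow>\<^sub>0 'k::field poly) set"
  assumes B: "lin_closed B"
  shows "unital (graded_subquotient (free_graded d S) A B)"
  unfolding unital_def graded_subquotient_fields(1)[OF B]
proof
  fix x assume "x \<in> coset B ` A"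
  then obtain u where "x = coset B u" by blast
  then show "1 \<odot>\<^bsub>graded_subquotient (free_graded d S) A B\<^esub> x = x"
    by (simp only: graded_subquotient_fields(3)[OF B] scale_simps)
qed

lemma graded_subquotient_zero:
  fixes A B :: "('s \<Rightarrow>\<^sub>0 'k::field poly) set"
  assumes A: "lin_closed A" and B: "lin_closed B" and "A \<subseteq> B"
  shows "interleaved 0 (graded_subquotient (free_graded d S) A B) zero_graded"
proof -
  let ?Q = "graded_subquotient (free_graded d S) A B"
  note Q = graded_subquotient_fields[OF B, where A=A and d=d and S=S]
  have cB: "coset B x = B" if "x \<in> A" for x
    using coset_eq_iff[OF B, of x 0] that \<open>A \<subseteq> B\<close> by auto
  have h0: "0 \<in> A \<inter> hcomp (free_graded d S) j" for j
    using lin_closedD(1)[OF A] by (simp add: free_graded_simps)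
  have add: "B \<oplus>\<^bsub>?Q\<^esub> B = B" and smult: "r \<odot>\<^bsub>?Q\<^esub> B = B" for r
    using Q(2)[of 0 0] Q(3)[of r 0] by simp_all
  have car: "carrier ?Q = {B}" using Q(1) cB lin_closedD(1)[OF A] by auto
  show ?thesis
    unfolding interleaved_def
  proof (intro bexI conjI ballI)
    show "(\<lambda>_. 0) \<in> graded_morphisms 0 ?Q zero_graded"
      by (rule graded_morphismsI) (auto simp: zero_graded_simps)
    show "(\<lambda>_. B) \<in> graded_morphisms 0 zero_graded ?Q"
    proof (rule graded_morphismsI)
      show "B \<in> hcomp ?Q (j + int 0)" for j
        using h0[of j] coset_zero[of B] by (auto simp: Q(4) intro: image_eqI[of _ _ 0])
    qed (auto simp: car add smult)
  qed (auto simp: car smult zero_graded_simps)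
qed

text \<open>If \<open>A\<close> is \<open>B\<close> plus the multiples of a homogeneous \<open>z\<close>, and a linear form \<open>F\<close> that is zero on
  \<open>B\<close> reads off the multiple, then \<open>A / B\<close> is free on the class of \<open>z\<close>. An explicit form makes
  both the inverse map and its homogeneity immediate.\<close>

lemma graded_subquotient_free:
  fixes A B :: "('s \<Rightarrow>\<^sub>0 'k::field poly) set"
  assumes A: "lin_closed A" and B: "lin_closed B"
    and F: "linear_form F" and FB: "\<And>b. b \<in> B \<Longrightarrow> F b = 0"
    and Fh: "\<And>j x. x \<in> hcomp (free_graded d S) j \<Longrightarrow> if j < a then F x = 0 else \<exists>b. F x = monom b (nat (j - a))"
    and z: "z \<in> A" "z \<in> hcomp (free_graded d S) a" "F z = 1"
    and gen: "\<And>x. x \<in> A \<Longrightarrow> x - scale (F x) z \<in> B"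
  shows "interleaved 0 (graded_subquotient (free_graded d S) A B) (shifted_kt a)"
proof -
  let ?Q = "graded_subquotient (free_graded d S) A B"
  note Q = graded_subquotient_fields[OF B, where A=A and d=d and S=S]
  note FD = linear_formD[OF F]
  define \<phi> :: "('s \<Rightarrow>\<^sub>0 'k poly) set \<Rightarrow> unit \<Rightarrow>\<^sub>0 'k poly"
    where "\<phi> C = Poly_Mapping.single () (F (SOME y. y \<in> C))" for C
  define \<psi> :: "(unit \<Rightarrow>\<^sub>0 'k poly) \<Rightarrow> ('s \<Rightarrow>\<^sub>0 'k poly) set"
    where "\<psi> c = coset B (scale (coef c ()) z)" for c
  have \<phi>: "\<phi> (coset B x) = Poly_Mapping.single () (F x)" for x
    unfolding \<phi>_def by (rule arg_cong[OF linear_form_coset[OF B F FB]])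
  show ?thesis
    unfolding interleaved_def
  proof (intro bexI conjI ballI)
    show "\<phi> \<in> graded_morphisms 0 ?Q (shifted_kt a)"
    proof (rule graded_morphismsI)
      show "\<phi> x \<in> hcomp (shifted_kt a) (j + int 0)" if "x \<in> hcomp ?Q j" for j x
        using that Fh[of _ j] unfolding Q(4) shifted_kt_simps
        by (auto simp del: image_iff simp: \<phi> split: if_splits)
    next
      fix x y assume "x \<in> carrier ?Q" "y \<in> carrier ?Q"
      then show "\<phi> (x \<oplus>\<^bsub>?Q\<^esub> y) = \<phi> x \<oplus>\<^bsub>shifted_kt a\<^esub> \<phi> y"
        by (auto simp only: Q(1,2) \<phi> FD shifted_kt_simps single_add)
    next
      fix r x assume "x \<in> carrier ?Q"
      then obtain u where u: "x = coset B u" by (auto simp only: Q(1))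
      show "\<phi> (r \<odot>\<^bsub>?Q\<^esub> x) = r \<odot>\<^bsub>shifted_kt a\<^esub> \<phi> x"
        unfolding u Q(3) \<phi> FD shifted_kt_simps by (rule poly_mapping_eqI) simp
    qed (simp add: shifted_kt_simps)
    show "\<psi> \<in> graded_morphisms 0 (shifted_kt a) ?Q"
    proof (rule graded_morphismsI)
      show "\<psi> x \<in> carrier ?Q" for x
        unfolding Q(1) \<psi>_def using z(1) lin_closedD(3)[OF A] by blast
      show "\<psi> (x \<oplus>\<^bsub>shifted_kt a\<^esub> y) = \<psi> x \<oplus>\<^bsub>?Q\<^esub> \<psi> y" for x y
        unfolding \<psi>_def Q(2) shifted_kt_simps by (simp only: lookup_add scale_add_left)
      show "\<psi> (r \<odot>\<^bsub>shifted_kt a\<^esub> x) = r \<odot>\<^bsub>?Q\<^esub> \<psi> x" for r x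
        unfolding \<psi>_def Q(3) shifted_kt_simps by (simp only: coef_scale scale_scale)
      fix j and x :: "unit \<Rightarrow>\<^sub>0 'k poly" assume x: "x \<in> hcomp (shifted_kt a) j"
      have "scale (coef x ()) z \<in> hcomp (free_graded d S) j"
        unfolding free_graded_simps mem_Collect_eq
      proof (intro conjI ballI)
        show "supp (scale (coef x ()) z) \<subseteq> S" using z(2) supp_scale_subset by (auto simp: free_graded_simps)
        fix s assume s: "s \<in> supp (scale (coef x ()) z)"
        then have sz: "s \<in> supp z" and x0: "coef x () \<noteq> 0" by (auto simp: in_keys_iff)
        from x0 x obtain b where b: "a \<le> j" "coef x () = monom b (nat (j - a))"
          by (auto simp: shifted_kt_simps split: if_splits)
        from sz z(2) obtain b' where b': "d s \<le> a" "coef z s = monom b' (nat (a - d s))"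
          by (auto simp: free_graded_simps)
        show "d s \<le> j" using b b' by simp
        show "\<exists>c. coef (scale (coef x ()) z) s = monom c (nat (j - d s))"
          using b b' by (auto simp: mult_monom nat_add_distrib[symmetric])
      qed
      then show "\<psi> x \<in> hcomp ?Q (j + int 0)"
        unfolding Q(4) \<psi>_def using z(1) lin_closedD(3)[OF A] by auto
    qed
    show "\<psi> (\<phi> x) = monom 1 (2 * 0) \<odot>\<^bsub>?Q\<^esub> x" if "x \<in> carrier ?Q" for x
    proof -
      from that obtain u where u: "x = coset B u" "u \<in> A" by (auto simp only: Q(1))
      have "\<psi> (\<phi> x) = coset B (scale (F u) z)" by (simp add: u(1) \<phi> \<psi>_def)
      also have "\<dots> = coset B u"
        using gen[OF u(2)] lin_closedD(4)[OF B gen[OF u(2)]] by (subst coset_eq_iff[OF B]) simp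
      finally show ?thesis by (simp add: u(1) Q(3) monom_0 pCons_one)
    qed
    show "\<phi> (\<psi> y) = monom 1 (2 * 0) \<odot>\<^bsub>shifted_kt a\<^esub> y" for y
      by (rule poly_mapping_eqI) (simp add: \<psi>_def \<phi> FD z(3) shifted_kt_simps monom_0 pCons_one)
  qed
qed

section \<open>Persistent homology\<close>

text \<open>Coefficients indexed by integers turn the degree shifts below into plain subtraction.\<close>

definition icoeff :: "'k::comm_ring_1 poly \<Rightarrow> int \<Rightarrow> 'k"
  where "icoeff P i = (if i < 0 then 0 else coeff P (nat i))"

lemma icoeff_add: "icoeff (P + Q) i = icoeff P i + icoeff Q i"
  by (simp add: icoeff_def)

lemma icoeff_sum: "icoeff (sum f A) i = (\<Sum>x\<in>A. icoeff (f x) i)"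
  by (simp add: icoeff_def coeff_sum)

lemma icoeff_monom: "icoeff (monom c n) i = (if i = int n then c else 0)"
  by (auto simp: icoeff_def)

lemma icoeff_0 [simp]: "icoeff 0 i = 0"
  by (simp add: icoeff_def)

lemma icoeff_mult: "icoeff (r * P) i = (\<Sum>n\<le>degree r. coeff r n * icoeff P (i - int n))"
proof (cases "i < 0")
  case False
  then obtain m where m: "i = int m" using nonneg_int_cases by (metis not_less)
  have "coeff (r * P) m = (\<Sum>n\<le>m. coeff r n * coeff P (m - n))" by (rule coeff_mult)
  also have "\<dots> = (\<Sum>n\<le>degree r. coeff r n * icoeff P (int m - int n))"
    by (rule sum.mono_neutral_cong) (auto simp: icoeff_def coeff_eq_0 nat_diff_distrib' not_le)
  finally show ?thesis by (simp add: m icoeff_def)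
qed (simp add: icoeff_def)

lemma icoeff_monom_mult: "icoeff (monom 1 m * P) i = icoeff P (i - int m)"
  by (auto simp: icoeff_def coeff_monom_mult nat_diff_distrib' nat_le_iff)

lemma poly_eq_icoeffI: "(\<And>i. icoeff P i = icoeff Q i) \<Longrightarrow> P = Q"
proof (rule poly_eqI)
  fix n assume "\<And>i. icoeff P i = icoeff Q i"
  from this[of "int n"] show "coeff P n = coeff Q n" by (simp add: icoeff_def)
qed

lemma finite_icoeff: "finite {i. icoeff P i \<noteq> 0}"
proof (rule finite_subset)
  show "{i. icoeff P i \<noteq> 0} \<subseteq> int ` {..degree P}"
  proof
    fix i assume "i \<in> {i. icoeff P i \<noteq> 0}"
    then have "0 \<le> i" "coeff P (nat i) \<noteq> 0" by (auto simp: icoeff_def split: if_splits)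
    then show "i \<in> int ` {..degree P}" by (intro image_eqI[of _ _ "nat i"]) (auto intro: le_degree)
  qed
qed simp

lemma chains_simps:
  "carrier (chains q K) = {c. supp c \<subseteq> simplices q K}"
  "add (chains q K) = (+)" "module.smult (chains q K) = scale" "zero (chains q K) = 0"
  by (simp_all add: chains_def free_module_def)

lemma simplices_mono: "K \<subseteq> L \<Longrightarrow> simplices q K \<subseteq> simplices q L"
  by (auto simp: simplices_def)

lemma lin_closed_cycles: "lin_closed (cycles q K)"
proof -
  have "cycles q K = {c. supp c \<subseteq> simplices q K} \<inter> {c. lin_ext bd_simplex c \<in> {0}}"
    by (auto simp: cycles_def chains_simps)
  then show ?thesis
    by (rule ssubst) (intro lin_closed_Int lin_closed_supp lin_closed_vimage linear_map_lin_ext lin_closed_zero)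
qed

lemma lin_closed_boundaries: "lin_closed (boundaries q K)"
  unfolding boundaries_def chains_simps
  by (intro lin_closed_image linear_map_lin_ext lin_closed_supp)

lemma cycles_mono: "K \<subseteq> L \<Longrightarrow> cycles q K \<subseteq> cycles q L"
  using simplices_mono[of K L q] by (auto simp: cycles_def chains_simps)

lemma boundaries_mono: "K \<subseteq> L \<Longrightarrow> boundaries q K \<subseteq> boundaries q L"
  using simplices_mono[of K L "q + 1"] by (auto simp: boundaries_def chains_simps)

lemma homology_simps:
  "carrier (homology q K) = coset (boundaries q K) ` cycles q K"
  "zero (homology q K) = boundaries q K"
  "coset (boundaries q K) x \<oplus>\<^bsub>homology q K\<^esub> coset (boundaries q K) y = coset (boundaries q K) (x + y)"
  "a \<odot>\<^bsub>homology q K\<^esub> coset (boundaries q K) x = coset (boundaries q K) (scale a x)"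
  unfolding homology_def
  by (rule subquotient_fields[OF chains_simps(2,3) lin_closed_boundaries])+

lemma homology_incl_coset:
  assumes "K \<subseteq> L"
  shows "homology_incl q L (coset (boundaries q K) x) = coset (boundaries q L) x"
proof -
  let ?B = "boundaries q L"
  have "coset ?B c = coset ?B x" if "c \<in> coset (boundaries q K) x" for c
  proof -
    from that have "c - x \<in> boundaries q K" by (simp only: mem_coset)
    then have "c - x \<in> ?B" using boundaries_mono[OF assms] by blast
    then show ?thesis by (simp only: coset_eq_iff[OF lin_closed_boundaries])
  qed
  moreover have "x \<in> coset (boundaries q K) x"
    unfolding mem_coset using lin_closedD(1)[OF lin_closed_boundaries] by simp
  ultimately show ?thesis
    unfolding homology_incl_def r_coset_plus[OF chains_simps(2)] by blast
qed

lemma comm_monoid_homology: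
  "comm_monoid (add_monoid (homology q K :: ('k::field, ('v::linorder set \<Rightarrow>\<^sub>0 'k) set) module))"
proof (rule comm_monoidI; simp)
  note lc = lin_closedD[OF lin_closed_cycles[of q K]]
  show "\<zero>\<^bsub>homology q K\<^esub> \<in> carrier (homology q K)"
    unfolding homology_simps using lc(1) coset_zero[of "boundaries q K"] by (metis imageI)
  fix x y z :: "('v set \<Rightarrow>\<^sub>0 'k) set"
  assume x: "x \<in> carrier (homology q K)"
  then obtain x' where x': "x = coset (boundaries q K) x'" "x' \<in> cycles q K" by (auto simp only: homology_simps)
  have "boundaries q K = coset (boundaries q K) 0" by simp
  then show "\<zero>\<^bsub>homology q K\<^esub> \<oplus>\<^bsub>homology q K\<^esub> x = x"
    unfolding x' homology_simps(2) by (metis homology_simps(3) add_0)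
  assume "y \<in> carrier (homology q K)"
  then obtain y' where y': "y = coset (boundaries q K) y'" "y' \<in> cycles q K" by (auto simp only: homology_simps)
  show "x \<oplus>\<^bsub>homology q K\<^esub> y \<in> carrier (homology q K)"
    unfolding x' y' homology_simps(1,3) using lc(2) x' y' by blast
  show "x \<oplus>\<^bsub>homology q K\<^esub> y = y \<oplus>\<^bsub>homology q K\<^esub> x"
    unfolding x' y' homology_simps(3) by (simp only: add.commute)
  assume "z \<in> carrier (homology q K)"
  then obtain z' where z': "z = coset (boundaries q K) z'" "z' \<in> cycles q K" by (auto simp only: homology_simps)
  show "x \<oplus>\<^bsub>homology q K\<^esub> y \<oplus>\<^bsub>homology q K\<^esub> z = x \<oplus>\<^bsub>homology q K\<^esub> (y \<oplus>\<^bsub>homology q K\<^esub> z)"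
    unfolding x' y' z' homology_simps(3) by (simp only: add.assoc)
qed

lemma finsum_homology:
  assumes "finite A" "\<And>n. n \<in> A \<Longrightarrow> f n \<in> cycles q K"
  shows "(\<Oplus>\<^bsub>homology q K\<^esub>n\<in>A. coset (boundaries q K) (f n)) = coset (boundaries q K) (sum f A)"
proof -
  interpret abelian_monoid "homology q K" using comm_monoid_homology by (rule abelian_monoid.intro)
  have car: "coset (boundaries q K) x \<in> carrier (homology q K)" if "x \<in> cycles q K" for x
    unfolding homology_simps using that by blast
  show ?thesis
    using assms
  proof (induction rule: finite_induct)
    case empty
    then show ?case by (simp add: homology_simps(2))
  next
    case (insert n A)
    then have "(\<Oplus>\<^bsub>homology q K\<^esub>n\<in>insert n A. coset (boundaries q K) (f n))
      = coset (boundaries q K) (f n) \<oplus>\<^bsub>homology q K\<^esub> (\<Oplus>\<^bsub>homology q K\<^esub>n\<in>A. coset (boundaries q K) (f n))"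
      by (intro finsum_insert) (auto intro!: car)
    moreover have "(\<Oplus>\<^bsub>homology q K\<^esub>n\<in>A. coset (boundaries q K) (f n)) = coset (boundaries q K) (sum f A)"
      using insert by blast
    ultimately show ?case using insert(1,2) by (simp only: homology_simps(3) sum.insert not_False_eq_True)
  qed
qed

abbreviation hclass :: "int \<Rightarrow> 'v::linorder filtered_complex \<Rightarrow> int \<Rightarrow> ('v set \<Rightarrow>\<^sub>0 'k::field) \<Rightarrow> ('v set \<Rightarrow>\<^sub>0 'k) set"
  where "hclass q X j \<equiv> coset (boundaries q (filt X j))"

lemma persistent_homology_simps:
  fixes X :: "'v::linorder filtered_complex" and q :: int
  defines "M \<equiv> persistent_homology q X :: ('k::field, _) graded_module"
  shows "carrier M = {h. (\<forall>j. h j \<in> hclass q X j ` cycles q (filt X j)) \<and>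
      finite {j. h j \<noteq> boundaries q (filt X j)}}"
    "hcomp M j = {h \<in> carrier M. \<forall>i. i \<noteq> j \<longrightarrow> h i = boundaries q (filt X i)}"
    "(\<lambda>j. hclass q X j (c j)) \<oplus>\<^bsub>M\<^esub> (\<lambda>j. hclass q X j (c' j)) = (\<lambda>j. hclass q X j (c j + c' j))"
  unfolding M_def persistent_homology_def graded_sum_def Let_def
  by (simp_all add: module.defs graded_module.defs homology_simps)

text \<open>All operations of \<open>graded_sum\<close> are computed on representatives; this is possible since the
  boundaries of a subcomplex remain boundaries.\<close>

lemma persistent_homology_smult:
  fixes X :: "'v::linorder filtered_complex" and c :: "int \<Rightarrow> 'v set \<Rightarrow>\<^sub>0 'k::field"
  assumes "mono (filt X)" "\<And>j. c j \<in> cycles q (filt X j)"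
  shows "r \<odot>\<^bsub>persistent_homology q X\<^esub> (\<lambda>j. hclass q X j (c j))
    = (\<lambda>j. hclass q X j (\<Sum>n\<le>degree r. scale (coeff r n) (c (j - int n))))"
proof
  fix j
  have mono: "filt X (j - int n) \<subseteq> filt X j" for n using assms(1) by (rule monoD) simp
  have "(r \<odot>\<^bsub>persistent_homology q X\<^esub> (\<lambda>j. hclass q X j (c j))) j
    = (\<Oplus>\<^bsub>homology q (filt X j)\<^esub>n\<in>{..degree r}. coeff r n \<odot>\<^bsub>homology q (filt X j)\<^esub>
        homology_incl q (filt X j) (hclass q X (j - int n) (c (j - int n))))"
    unfolding persistent_homology_def graded_sum_def Let_def by (simp add: module.defs graded_module.defs)
  also have "\<dots> = (\<Oplus>\<^bsub>homology q (filt X j)\<^esub>n\<in>{..degree r}. hclass q X j (scale (coeff r n) (c (j - int n))))"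
    by (simp only: homology_incl_coset[OF mono] homology_simps(4))
  also have "\<dots> = hclass q X j (\<Sum>n\<le>degree r. scale (coeff r n) (c (j - int n)))"
  proof (rule finsum_homology)
    show "scale (coeff r n) (c (j - int n)) \<in> cycles q (filt X j)" for n
      using assms(2)[of "j - int n"] cycles_mono[OF mono] lin_closedD(3)[OF lin_closed_cycles] by blast
  qed simp
  finally show "(r \<odot>\<^bsub>persistent_homology q X\<^esub> (\<lambda>j. hclass q X j (c j))) j
    = hclass q X j (\<Sum>n\<le>degree r. scale (coeff r n) (c (j - int n)))" .
qed

lemma persistent_homology_monom:
  fixes X :: "'v::linorder filtered_complex" and c :: "int \<Rightarrow> 'v set \<Rightarrow>\<^sub>0 'k::field"
  assumes "mono (filt X)" "\<And>j. c j \<in> cycles q (filt X j)"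
  shows "monom 1 m \<odot>\<^bsub>persistent_homology q X\<^esub> (\<lambda>j. hclass q X j (c j))
    = (\<lambda>j. hclass q X j (c (j - int m)))"
proof -
  have "(\<Sum>n\<le>degree (monom (1::'k) m). scale (coeff (monom 1 m) n) (c (j - int n))) = c (j - int m)" for j
  proof -
    have "(\<Sum>n\<le>m. scale (coeff (monom 1 m) n) (c (j - int n)))
      = (\<Sum>n\<in>{m}. scale (coeff (monom 1 m) n) (c (j - int n)))"
      by (rule sum.mono_neutral_right) auto
    then show ?thesis by (simp add: degree_monom_eq)
  qed
  then show ?thesis by (simp only: persistent_homology_smult[OF assms])
qed

lemma persistent_homology_rep:
  assumes "h \<in> carrier (persistent_homology q X :: ('k::field, _) graded_module)"
  obtains c where "h = (\<lambda>j. hclass q X j (c j))" "\<And>j. c j \<in> cycles q (filt X j)"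
proof -
  have "\<forall>j. \<exists>c. c \<in> cycles q (filt X j) \<and> h j = hclass q X j c"
    using assms unfolding persistent_homology_simps(1) by blast
  then obtain c where "\<And>j. c j \<in> cycles q (filt X j) \<and> h j = hclass q X j (c j)" by metis
  then have "h = (\<lambda>j. hclass q X j (c j))" "\<And>j. c j \<in> cycles q (filt X j)" by auto
  then show thesis by (rule that)
qed

lemma unital_persistent_homology:
  assumes "mono (filt X)"
  shows "unital (persistent_homology q X :: ('k::field, _) graded_module)"
  unfolding unital_def
proof
  fix h assume "h \<in> carrier (persistent_homology q X :: ('k, _) graded_module)"
  then obtain c where "h = (\<lambda>j. hclass q X j (c j))" "\<And>j. c j \<in> cycles q (filt X j)"
    by (rule persistent_homology_rep) (rule that)
  then show "1 \<odot>\<^bsub>persistent_homology q X\<^esub> h = h"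
    using persistent_homology_monom[OF assms, of c q 0] by (simp add: monom_0 pCons_one)
qed

lemma persistent_homology_zero:
  fixes X :: "'v::linorder filtered_complex"
  assumes mono: "mono (filt X)"
    and van: "\<And>j c. c \<in> cycles q (filt X j) \<Longrightarrow> (c :: 'v set \<Rightarrow>\<^sub>0 'k::field) \<in> boundaries q (filt X (j + 2 * int \<eta>))"
  shows "interleaved \<eta> (persistent_homology q X :: ('k, _) graded_module) zero_graded"
proof -
  let ?M = "persistent_homology q X :: ('k, _) graded_module"
  let ?z = "\<lambda>j. hclass q X j 0 :: ('v set \<Rightarrow>\<^sub>0 'k) set"
  have z: "?z \<in> carrier ?M"
  proof -
    have "?z j \<in> hclass q X j ` cycles q (filt X j)" for j
      using lin_closedD(1)[OF lin_closed_cycles] by (rule imageI)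
    then show ?thesis unfolding persistent_homology_simps by simp
  qed
  have zadd: "?z \<oplus>\<^bsub>?M\<^esub> ?z = ?z" by (simp only: persistent_homology_simps add_0)
  have zs: "r \<odot>\<^bsub>?M\<^esub> ?z = ?z" for r
    using persistent_homology_smult[OF mono lin_closedD(1)[OF lin_closed_cycles], where r=r] by simp
  show ?thesis
    unfolding interleaved_def
  proof (intro bexI conjI ballI)
    show "(\<lambda>_. 0) \<in> graded_morphisms \<eta> ?M zero_graded"
      by (rule graded_morphismsI) (auto simp: zero_graded_simps)
    show "(\<lambda>_. ?z) \<in> graded_morphisms \<eta> zero_graded ?M"
      by (rule graded_morphismsI) (use z zadd zs in \<open>simp_all add: persistent_homology_simps(2)\<close>)
    show "?z = monom 1 (2 * \<eta>) \<odot>\<^bsub>?M\<^esub> h" if "h \<in> carrier ?M" for h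
    proof -
      from that obtain c where c: "h = (\<lambda>j. hclass q X j (c j))" "\<And>j. c j \<in> cycles q (filt X j)"
        by (rule persistent_homology_rep) (rule that)
      have "hclass q X j (c (j - int (2 * \<eta>))) = hclass q X j 0" for j
        using van[OF c(2)[of "j - int (2 * \<eta>)"]]
        by (subst coset_eq_iff[OF lin_closed_boundaries]) simp
      then show ?thesis unfolding c(1) persistent_homology_monom[OF mono c(2)] by simp
    qed
  qed (auto simp: zero_graded_simps)
qed

text \<open>The persistent analogue of the criterion for subquotients, with slack \<open>\<eta>\<close>: the relation
  \<open>c = F(c) z\<close> may hold only \<open>2\<eta>\<close> degrees later. The two maps are \<open>c \<mapsto> t^\<eta> F(c)\<close> and
  \<open>r \<mapsto> t^\<eta> r z\<close>.\<close>

lemma persistent_homology_free: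
  fixes X :: "'v::linorder filtered_complex" and z :: "'v set \<Rightarrow>\<^sub>0 'k::field"
  assumes mono: "mono (filt X)"
    and F: "linear_form F" and FB: "\<And>j b. b \<in> boundaries q (filt X j) \<Longrightarrow> F b = 0"
    and z: "z \<in> cycles q (filt X a)" "F z = 1"
    and low: "\<And>j c. j < a \<Longrightarrow> c \<in> cycles q (filt X j) \<Longrightarrow> F c = 0"
    and gen: "\<And>j c. c \<in> cycles q (filt X j) \<Longrightarrow> c - scale (F c) z \<in> boundaries q (filt X (j + 2 * int \<eta>))"
  shows "interleaved \<eta> (persistent_homology q X :: ('k, _) graded_module) (shifted_kt a)"
proof -
  let ?M = "persistent_homology q X :: ('k, _) graded_module"
  note FD = linear_formD[OF F] and lB = lin_closed_boundaries and lC = lin_closed_cycles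
  define fh where "fh h j = F (SOME y. y \<in> h j)" for h :: "int \<Rightarrow> ('v set \<Rightarrow>\<^sub>0 'k) set" and j
  have fh: "fh (\<lambda>j. hclass q X j (c j)) j = F (c j)" for c j
    unfolding fh_def by (rule linear_form_coset[OF lB F FB])
  have fh0: "fh h j = 0" if "h j = boundaries q (filt X j)" for h j
    unfolding fh_def that using linear_form_coset[OF lB F FB, where x=0] by (simp add: FD)
  \<comment> \<open>The image of \<open>h\<close> is characterised by its coefficients; linearity then follows from uniqueness,
    without tracking the finite support of sums and multiples.\<close>
  define P where "P h = (THE Q. \<forall>i. icoeff Q i = fh h (i + a - int \<eta>))" for h
  have P_eq: "P h = Q" if "\<And>i. icoeff Q i = fh h (i + a - int \<eta>)" for h Q
    unfolding P_def using that by (intro the_equality) (auto intro: poly_eq_icoeffI)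
  have P: "icoeff (P h) i = fh h (i + a - int \<eta>)" if h: "h \<in> carrier ?M" for h i
  proof -
    from h obtain c where c: "h = (\<lambda>j. hclass q X j (c j))" "\<And>j. c j \<in> cycles q (filt X j)"
      by (rule persistent_homology_rep) (rule that)
    have ge: "a \<le> j" if "fh h j \<noteq> 0" for j
      using that low[OF _ c(2)] unfolding c(1) fh by force
    have "{j. fh h j \<noteq> 0} \<subseteq> {j. h j \<noteq> boundaries q (filt X j)}" using fh0 by blast
    then have fin: "finite {j. fh h j \<noteq> 0}"
      using h unfolding persistent_homology_simps(1) by (auto intro: finite_subset)
    have "icoeff (\<Sum>j | fh h j \<noteq> 0. monom (fh h j) (nat (j - a + int \<eta>))) i
      = fh h (i + a - int \<eta>)" for i
    proof -
      have "icoeff (\<Sum>j | fh h j \<noteq> 0. monom (fh h j) (nat (j - a + int \<eta>))) i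
        = (\<Sum>j | fh h j \<noteq> 0. if j = i + a - int \<eta> then fh h j else 0)"
        unfolding icoeff_sum by (rule sum.cong) (auto simp: icoeff_monom dest!: ge)
      also have "\<dots> = fh h (i + a - int \<eta>)" using fin by (simp add: sum.delta)
      finally show ?thesis .
    qed
    then show ?thesis using P_eq by metis
  qed
  define \<phi> where "\<phi> h = Poly_Mapping.single () (P h)" for h
  define \<psi> where "\<psi> x = (\<lambda>j. hclass q X j (scale (icoeff (coef x ()) (j - a - int \<eta>)) z))"
    for x :: "unit \<Rightarrow>\<^sub>0 'k poly"
  have cyc: "scale (icoeff p (j - a - int \<eta>)) z \<in> cycles q (filt X j)" for p j
  proof (cases "j < a")
    case True
    then show ?thesis using lin_closedD(1)[OF lC] by (simp add: icoeff_def)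
  next
    case False
    then have "filt X a \<subseteq> filt X j" using mono by (simp add: monoD)
    then show ?thesis using z(1) cycles_mono lin_closedD(3)[OF lC] by blast
  qed
  have \<psi>c: "\<psi> x \<in> carrier ?M" for x
    unfolding persistent_homology_simps(1) mem_Collect_eq
  proof (intro conjI allI)
    show "\<psi> x j \<in> hclass q X j ` cycles q (filt X j)" for j
      unfolding \<psi>_def using cyc by blast
    have "{j. \<psi> x j \<noteq> boundaries q (filt X j)} \<subseteq> (\<lambda>i. i + a + int \<eta>) ` {i. icoeff (coef x ()) i \<noteq> 0}"
    proof
      fix j assume "j \<in> {j. \<psi> x j \<noteq> boundaries q (filt X j)}"
      then have "icoeff (coef x ()) (j - a - int \<eta>) \<noteq> 0" by (auto simp: \<psi>_def)
      then show "j \<in> (\<lambda>i. i + a + int \<eta>) ` {i. icoeff (coef x ()) i \<noteq> 0}"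
        by (intro image_eqI[of _ _ "j - a - int \<eta>"]) auto
    qed
    then show "finite {j. \<psi> x j \<noteq> boundaries q (filt X j)}"
      using finite_icoeff finite_surj by blast
  qed
  have \<phi>\<psi>_at: "fh (\<psi> x) j = icoeff (coef x ()) (j - a - int \<eta>)" for x j
    unfolding \<psi>_def fh FD z(2) by simp
  have hom_\<phi>: "\<phi> \<in> graded_morphisms \<eta> ?M (shifted_kt a)"
  proof (rule graded_morphismsI)
    fix h h' assume h: "h \<in> carrier ?M" and h': "h' \<in> carrier ?M"
    from h obtain c where c: "h = (\<lambda>j. hclass q X j (c j))" "\<And>j. c j \<in> cycles q (filt X j)"
      by (rule persistent_homology_rep) (rule that)
    from h' obtain c' where c': "h' = (\<lambda>j. hclass q X j (c' j))" "\<And>j. c' j \<in> cycles q (filt X j)"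
      by (rule persistent_homology_rep) (rule that)
    have "fh (h \<oplus>\<^bsub>?M\<^esub> h') j = fh h j + fh h' j" for j
      unfolding c(1) c'(1) persistent_homology_simps(3) fh FD ..
    then have "P (h \<oplus>\<^bsub>?M\<^esub> h') = P h + P h'"
      by (intro P_eq) (simp add: icoeff_add P h h')
    then show "\<phi> (h \<oplus>\<^bsub>?M\<^esub> h') = \<phi> h \<oplus>\<^bsub>shifted_kt a\<^esub> \<phi> h'"
      by (simp add: \<phi>_def shifted_kt_simps single_add)
  next
    fix r h assume h: "h \<in> carrier ?M"
    then obtain c where c: "h = (\<lambda>j. hclass q X j (c j))" "\<And>j. c j \<in> cycles q (filt X j)"
      by (rule persistent_homology_rep) (rule that)
    have Fsum: "F (sum f A) = (\<Sum>x\<in>A. F (f x))" if "finite A" for f and A :: "nat set"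
      using that by (induction A rule: finite_induct) (auto simp: FD)
    have "fh (r \<odot>\<^bsub>?M\<^esub> h) j = (\<Sum>n\<le>degree r. coeff r n * fh h (j - int n))" for j
      unfolding c(1) persistent_homology_smult[OF mono c(2)] fh by (simp add: Fsum FD)
    then have "P (r \<odot>\<^bsub>?M\<^esub> h) = r * P h"
      by (intro P_eq) (simp add: icoeff_mult P h algebra_simps)
    then show "\<phi> (r \<odot>\<^bsub>?M\<^esub> h) = r \<odot>\<^bsub>shifted_kt a\<^esub> \<phi> h"
      by (auto simp: \<phi>_def shifted_kt_simps intro!: poly_mapping_eqI)
  next
    fix j h assume hj: "h \<in> hcomp ?M j"
    then have h: "h \<in> carrier ?M" by (simp add: persistent_homology_simps(2))
    then obtain c where c: "h = (\<lambda>j. hclass q X j (c j))" "\<And>j. c j \<in> cycles q (filt X j)"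
      by (rule persistent_homology_rep) (rule that)
    have fj: "fh h i = 0" if "i \<noteq> j" for i
      using hj that by (intro fh0) (simp add: persistent_homology_simps(2))
    show "\<phi> h \<in> hcomp (shifted_kt a) (j + int \<eta>)"
    proof (cases "j + int \<eta> < a")
      case True
      then have "fh h j = 0" using low[OF _ c(2)[of j]] unfolding c(1) fh by simp
      then have "P h = 0" using fj by (intro P_eq) (simp, metis)
      then show ?thesis using True by (simp add: shifted_kt_simps \<phi>_def)
    next
      case False
      have "P h = monom (fh h j) (nat (j + int \<eta> - a))"
        using False fj by (intro P_eq) (auto simp: icoeff_monom)
      then show ?thesis using False by (auto simp: shifted_kt_simps \<phi>_def)
    qed
  qed (simp add: shifted_kt_simps)
  have hom_\<psi>: "\<psi> \<in> graded_morphisms \<eta> (shifted_kt a) ?M"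
  proof (rule graded_morphismsI)
    show "\<psi> (x \<oplus>\<^bsub>shifted_kt a\<^esub> y) = \<psi> x \<oplus>\<^bsub>?M\<^esub> \<psi> y" for x y
      unfolding \<psi>_def persistent_homology_simps(3) shifted_kt_simps
      by (simp only: lookup_add icoeff_add scale_add_left)
    show "\<psi> (r \<odot>\<^bsub>shifted_kt a\<^esub> x) = r \<odot>\<^bsub>?M\<^esub> \<psi> x" for r x
    proof -
      have *: "scale (\<Sum>n\<in>A. f n) z = (\<Sum>n\<in>A. scale (f n) z)" for f and A :: "nat set"
        by (rule poly_mapping_eqI) (simp add: coef_sum sum_distrib_right)
      have "scale (icoeff (r * coef x ()) (j - a - int \<eta>)) z
        = (\<Sum>n\<le>degree r. scale (coeff r n) (scale (icoeff (coef x ()) (j - int n - a - int \<eta>)) z))" for j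
        unfolding icoeff_mult * scale_scale by (simp add: algebra_simps)
      then show ?thesis
        unfolding \<psi>_def persistent_homology_smult[OF mono cyc] shifted_kt_simps by (simp only: coef_scale)
    qed
    fix j and x :: "unit \<Rightarrow>\<^sub>0 'k poly" assume x: "x \<in> hcomp (shifted_kt a) j"
    have "icoeff (coef x ()) (i - a - int \<eta>) = 0" if "i \<noteq> j + int \<eta>" for i
      using x that by (auto simp: shifted_kt_simps icoeff_monom split: if_splits)
    then show "\<psi> x \<in> hcomp ?M (j + int \<eta>)"
      unfolding persistent_homology_simps(2) using \<psi>c by (simp add: \<psi>_def)
  qed (rule \<psi>c)
  show ?thesis
    unfolding interleaved_def
  proof (intro bexI[OF _ hom_\<phi>] bexI[OF _ hom_\<psi>] conjI ballI)
    fix h assume h: "h \<in> carrier ?M"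
    then obtain c where c: "h = (\<lambda>j. hclass q X j (c j))" "\<And>j. c j \<in> cycles q (filt X j)"
      by (rule persistent_homology_rep) (rule that)
    have "hclass q X j (scale (icoeff (P h) (j - a - int \<eta>)) z) = hclass q X j (c (j - int (2 * \<eta>)))" for j
    proof -
      have "icoeff (P h) (j - a - int \<eta>) = F (c (j - int (2 * \<eta>)))"
        unfolding P[OF h] unfolding c(1) fh by (simp add: algebra_simps)
      then show ?thesis
        using lin_closedD(4)[OF lB gen[OF c(2)[of "j - int (2 * \<eta>)"]]]
        by (subst coset_eq_iff[OF lB]) simp
    qed
    then show "\<psi> (\<phi> h) = monom 1 (2 * \<eta>) \<odot>\<^bsub>?M\<^esub> h"
      unfolding c(1) persistent_homology_monom[OF mono c(2)]
      unfolding c(1)[symmetric] by (simp add: \<psi>_def \<phi>_def)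
  next
    fix x :: "unit \<Rightarrow>\<^sub>0 'k poly"
    have "P (\<psi> x) = monom 1 (2 * \<eta>) * coef x ()"
      by (rule P_eq) (simp only: \<phi>\<psi>_at icoeff_monom_mult, simp add: algebra_simps)
    then show "\<phi> (\<psi> x) = monom 1 (2 * \<eta>) \<odot>\<^bsub>shifted_kt a\<^esub> x"
      by (auto simp: \<phi>_def shifted_kt_simps intro!: poly_mapping_eqI)
  qed
qed

section \<open>The augmented boundary operator\<close>

definition pos_sign :: "'v::linorder \<Rightarrow> 'v set \<Rightarrow> 'r::comm_ring_1"
  where "pos_sign x s = (- 1) ^ card {y \<in> s. y < x}"

lemma pos_sign_insert_self [simp]: "pos_sign x (insert x s) = pos_sign x s"
proof -
  have "{y \<in> insert x s. y < x} = {y \<in> s. y < x}" by auto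
  then show ?thesis by (simp add: pos_sign_def)
qed

lemma pos_sign_remove_self [simp]: "pos_sign x (s - {x}) = pos_sign x s"
proof -
  have "{y \<in> s - {x}. y < x} = {y \<in> s. y < x}" by auto
  then show ?thesis by (simp add: pos_sign_def)
qed

lemma pos_sign_insert:
  assumes "finite s" "y \<notin> s"
  shows "pos_sign x (insert y s) = (if y < x then - pos_sign x s else pos_sign x s)"
proof (cases "y < x")
  case True
  then have "{z \<in> insert y s. z < x} = insert y {z \<in> s. z < x}" by auto
  then show ?thesis using assms True by (simp add: pos_sign_def)
next
  case False
  then have "{z \<in> insert y s. z < x} = {z \<in> s. z < x}" by auto
  then show ?thesis using False by (simp add: pos_sign_def)
qed

lemma pos_sign_square [simp]: "pos_sign x s * pos_sign x s = (1 :: 'a::comm_ring_1)" "pos_sign x s * (pos_sign x s * a) = (a :: 'a)"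
proof -
  show *: "pos_sign x s * pos_sign x s = (1 :: 'a)" by (simp add: pos_sign_def flip: power_mult_distrib)
  show "pos_sign x s * (pos_sign x s * a) = a" by (simp only: mult.assoc[symmetric] * mult_1)
qed

lemma pos_sign_empty [simp]: "pos_sign x {} = 1"
  by (simp add: pos_sign_def)

text \<open>Two vertices inserted in either order contribute opposite signs; this is the source of both
  \<open>\<partial>\<partial> = 0\<close> and the cone formula.\<close>

lemma pos_sign_swap:
  assumes "finite s" "x \<notin> s" "y \<notin> s" "x \<noteq> y"
  shows "pos_sign x s * pos_sign y (insert x s) = - (pos_sign y s * pos_sign x (insert y s))"
  using assms by (cases "x < y") (auto simp: pos_sign_insert mult.commute)

text \<open>Terms cancel in pairs, which is valid in characteristic 2 as well, where a sum equal to its own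
  negative need not vanish.\<close>

lemma sum_antisym_eq_0:
  assumes "finite W" "\<And>x y. x \<in> W \<Longrightarrow> y \<in> W \<Longrightarrow> x \<noteq> y \<Longrightarrow> f x y = - f y x"
  shows "(\<Sum>x\<in>W. \<Sum>y\<in>W - {x}. f x y) = (0::'r::comm_ring_1)"
  using assms
proof (induction rule: finite_induct)
  case (insert a W)
  have IH: "(\<Sum>x\<in>W. \<Sum>y\<in>W - {x}. f x y) = 0" using insert by blast
  note hyps = insert.hyps
  have "(\<Sum>x\<in>W. \<Sum>y\<in>insert a W - {x}. f x y) = (\<Sum>x\<in>W. f x a + (\<Sum>y\<in>W - {x}. f x y))"
  proof (rule sum.cong)
    fix x assume "x \<in> W"
    then have "insert a W - {x} = insert a (W - {x})" using hyps by auto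
    then show "(\<Sum>y\<in>insert a W - {x}. f x y) = f x a + (\<Sum>y\<in>W - {x}. f x y)" using hyps by simp
  qed simp
  also have "\<dots> = (\<Sum>x\<in>W. f x a)" using IH by (simp add: sum.distrib)
  also have "\<dots> = (\<Sum>x\<in>W. - f a x)"
  proof (rule sum.cong)
    fix x assume "x \<in> W"
    then have "x \<noteq> a" using insert.hyps by blast
    then show "f x a = - f a x" using insert.prems \<open>x \<in> W\<close> by blast
  qed simp
  also have "\<dots> = - (\<Sum>x\<in>W. f a x)" by (rule sum_negf)
  finally show ?case using hyps by simp
qed simp

text \<open>The simplicial boundary read coefficientwise: the coefficient at \<open>t\<close> collects the cofaces of \<open>t\<close>
  in \<open>V\<close>. The value at \<open>t = {}\<close> is the augmentation, so this is the augmented complex of the full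
  simplex on \<open>V\<close>, and cones contract it in every degree.\<close>

definition bdry :: "'v::linorder set \<Rightarrow> ('v set \<Rightarrow> 'r::comm_ring_1) \<Rightarrow> 'v set \<Rightarrow> 'r"
  where "bdry V c t = (\<Sum>w\<in>V - t. pos_sign w t * c (insert w t))"

definition cone :: "'v::linorder \<Rightarrow> ('v set \<Rightarrow> 'r::comm_ring_1) \<Rightarrow> 'v set \<Rightarrow> 'r"
  where "cone v c s = (if v \<in> s then pos_sign v s * c (s - {v}) else 0)"

lemma bdry_bdry:
  assumes "finite V" "finite t"
  shows "bdry V (bdry V c) t = 0"
proof -
  have "bdry V (bdry V c) t
    = (\<Sum>w\<in>V - t. \<Sum>u\<in>V - t - {w}. pos_sign w t * pos_sign u (insert w t) * c (insert u (insert w t)))"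
    unfolding bdry_def by (intro sum.cong refl) (auto simp: sum_distrib_left mult.assoc intro!: sum.cong)
  also have "\<dots> = 0"
  proof (rule sum_antisym_eq_0)
    fix x y assume "x \<in> V - t" "y \<in> V - t" "x \<noteq> y"
    then have "pos_sign x t * pos_sign y (insert x t) = - (pos_sign y t * pos_sign x (insert y t) :: 'b)"
      using assms by (intro pos_sign_swap) auto
    then show "pos_sign x t * pos_sign y (insert x t) * c (insert y (insert x t))
      = - (pos_sign y t * pos_sign x (insert y t) * c (insert x (insert y t)))"
      by (metis insert_commute minus_mult_left)
  qed (use assms in simp)
  finally show ?thesis .
qed

text \<open>The cone with apex \<open>v\<close> is a contracting homotopy.\<close>

lemma bdry_cone:
  assumes "finite V" "finite t" "v \<in> V"
  shows "bdry V (cone v c) t = c t - cone v (bdry V c) t"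
proof (cases "v \<in> t")
  case False
  have "bdry V (cone v c) t = (\<Sum>w\<in>V - t. if w = v then c t else 0)"
    unfolding bdry_def
  proof (rule sum.cong)
    fix w assume "w \<in> V - t"
    then show "pos_sign w t * cone v c (insert w t) = (if w = v then c t else 0)"
      using False by (simp add: cone_def)
  qed simp
  also have "\<dots> = c t" using assms False by (simp add: sum.delta)
  finally show ?thesis using False by (simp add: cone_def)
next
  case True
  let ?s = "t - {v}"
  have V: "V - ?s = insert v (V - t)" using True assms(3) by auto
  have "cone v (bdry V c) t = pos_sign v t * (\<Sum>w\<in>V - ?s. pos_sign w ?s * c (insert w ?s))"
    using True by (simp add: cone_def bdry_def)
  also have "\<dots> = c t + (\<Sum>w\<in>V - t. pos_sign v t * (pos_sign w ?s * c (insert w ?s)))"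
    unfolding V using assms True by (simp add: distrib_left sum_distrib_left insert_absorb)
  also have "(\<Sum>w\<in>V - t. pos_sign v t * (pos_sign w ?s * c (insert w ?s))) = - bdry V (cone v c) t"
    unfolding bdry_def sum_negf[symmetric]
  proof (rule sum.cong)
    fix w assume w: "w \<in> V - t"
    then have wv: "w \<noteq> v" "w \<notin> ?s" using True by auto
    have ins: "insert v ?s = t" "insert w t - {v} = insert w ?s" using True wv by auto
    have "pos_sign v ?s * pos_sign w (insert v ?s) = - (pos_sign w ?s * pos_sign v (insert w ?s) :: 'b)"
      using wv assms by (intro pos_sign_swap) auto
    then have 1: "pos_sign v t * pos_sign w t = - (pos_sign w ?s * pos_sign v (insert w ?s) :: 'b)" by (simp only: ins pos_sign_remove_self)
    have 2: "pos_sign v (insert w t) = (pos_sign v (insert w ?s) :: 'b)"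
      using pos_sign_remove_self[of v "insert w t"] unfolding ins by (rule sym)
    have "pos_sign w ?s = - (pos_sign v t * pos_sign w t * pos_sign v (insert w ?s) :: 'b)"
      unfolding 1 by (simp add: mult.assoc)
    then have "pos_sign v t * (pos_sign w ?s * c (insert w ?s)) = - (pos_sign w t * pos_sign v (insert w ?s) * c (insert w ?s))"
      by (simp add: mult.assoc)
    then show "pos_sign v t * (pos_sign w ?s * c (insert w ?s)) = - (pos_sign w t * cone v c (insert w t))"
      using True by (simp add: cone_def ins 2 mult.assoc)
  qed simp
  finally show ?thesis by simp
qed

lemma bdry_add: "bdry V (\<lambda>s. c s + c' s) t = bdry V c t + bdry V c' t"
  by (simp add: bdry_def algebra_simps sum.distrib)

lemma bdry_diff: "bdry V (\<lambda>s. c s - c' s) t = bdry V c t - bdry V c' t"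
  by (simp add: bdry_def algebra_simps sum_subtractf)

lemma bdry_scale: "bdry V (\<lambda>s. a * c s) t = a * bdry V c t"
  by (simp add: bdry_def algebra_simps sum_distrib_left)

lemma bdry_eq_0: "(\<And>w. w \<in> V \<Longrightarrow> w \<notin> t \<Longrightarrow> c (insert w t) = 0) \<Longrightarrow> bdry V c t = 0"
  by (auto simp: bdry_def intro!: sum.neutral)

lemma bdry_cong: "(\<And>w. w \<in> V \<Longrightarrow> w \<notin> t \<Longrightarrow> c (insert w t) = c' (insert w t)) \<Longrightarrow> bdry V c t = bdry V c' t"
  by (auto simp: bdry_def intro!: sum.cong)

lemma bdry_empty: "bdry V c {} = (\<Sum>v\<in>V. c {v})"
  by (simp add: bdry_def)

lemma bdry_single:
  assumes "finite V" "w \<in> V" "w \<notin> t" "\<And>u. u \<in> V \<Longrightarrow> u \<notin> t \<Longrightarrow> u \<noteq> w \<Longrightarrow> c (insert u t) = 0"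
  shows "bdry V c t = pos_sign w t * c (insert w t)"
proof -
  have "bdry V c t = (\<Sum>u\<in>{w}. pos_sign u t * c (insert u t))"
    unfolding bdry_def using assms by (intro sum.mono_neutral_right) auto
  then show ?thesis by simp
qed

lemma sum_del_nth:
  fixes s :: "'v::linorder set"
  assumes "finite s"
  shows "(\<Sum>k<card s. G (del_nth k s) k) = (\<Sum>x\<in>s. G (s - {x}) (card {y \<in> s. y < x}))"
proof -
  define xs where "xs = sorted_list_of_set s"
  have xs: "length xs = card s" "set xs = s" "sorted_wrt (<) xs" "distinct xs"
    using assms by (simp_all add: xs_def)
  have card: "card {y \<in> s. y < xs ! k} = k" if "k < card s" for k
  proof -
    have "{y \<in> s. y < xs ! k} = (!) xs ` {..<k}"
    proof safe
      fix y assume "y \<in> s" "y < xs ! k"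
      then obtain i where i: "i < length xs" "y = xs ! i" using xs(2) by (metis in_set_conv_nth)
      have "i < k"
        using i \<open>y < xs ! k\<close> that xs sorted_wrt_nth_less[OF xs(3), of k i]
        by (metis linorder_neqE_nat order_less_asym order_less_irrefl)
      then show "y \<in> (!) xs ` {..<k}" using i by auto
    qed (use that xs sorted_wrt_nth_less[OF xs(3)] in \<open>auto intro: nth_mem\<close>)
    moreover have "inj_on ((!) xs) {..<k}" using that xs by (auto intro!: inj_on_nth)
    ultimately show ?thesis by (simp add: card_image)
  qed
  have "bij_betw ((!) xs) {..<card s} s" using bij_betw_nth[OF xs(4)] xs by metis
  then have "(\<Sum>x\<in>s. G (s - {x}) (card {y \<in> s. y < x}))
    = (\<Sum>k<card s. G (s - {xs ! k}) (card {y \<in> s. y < xs ! k}))"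
    by (rule sum.reindex_bij_betw[symmetric])
  also have "\<dots> = (\<Sum>k<card s. G (del_nth k s) k)"
    by (rule sum.cong) (simp_all add: card del_nth_def flip: xs_def)
  finally show ?thesis ..
qed

text \<open>Passes from sums over faces, as in the definition of boundaries, to sums over cofaces.\<close>

lemma sum_cofaces:
  assumes "finite V" "\<And>x s. \<not> s \<subseteq> V \<Longrightarrow> H x s = 0"
  shows "(\<Sum>s\<in>Pow V. \<Sum>x\<in>s. if s - {x} = t then H x s else 0) = (\<Sum>w\<in>V - t. H w (insert w t))"
proof -
  have "(\<Sum>s\<in>Pow V. \<Sum>x\<in>s. if s - {x} = t then H x s else 0)
    = (\<Sum>s\<in>Pow V. \<Sum>x\<in>V. if x \<in> s \<and> s - {x} = t then H x s else 0)"
    using assms(1) by (intro sum.cong refl sum.mono_neutral_cong_left) auto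
  also have "\<dots> = (\<Sum>x\<in>V. \<Sum>s\<in>Pow V. if x \<in> s \<and> s - {x} = t then H x s else 0)"
    by (rule sum.swap)
  also have "\<dots> = (\<Sum>x\<in>V. if x \<in> t then 0 else H x (insert x t))"
  proof (rule sum.cong)
    fix x assume "x \<in> V"
    have "(\<Sum>s\<in>Pow V. if x \<in> s \<and> s - {x} = t then H x s else 0)
      = (\<Sum>s\<in>Pow V. if s = insert x t then (if x \<in> t then 0 else H x (insert x t)) else 0)"
      by (intro sum.cong) auto
    also have "\<dots> = (if x \<in> t then 0 else H x (insert x t))"
      using assms by (simp add: sum.delta)
    finally show "(\<Sum>s\<in>Pow V. if x \<in> s \<and> s - {x} = t then H x s else 0)
      = (if x \<in> t then 0 else H x (insert x t))" .
  qed simp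
  also have "\<dots> = (\<Sum>w\<in>V - t. H w (insert w t))"
    using assms(1) by (intro sum.mono_neutral_cong_right) auto
  finally show ?thesis .
qed

lemma Diff_singleton_nonempty:
  assumes "\<not> card s \<le> 1"
  shows "s - {x} \<noteq> {}"
proof
  assume "s - {x} = {}"
  then have "s \<subseteq> {x}" by blast
  then have "card s \<le> card {x}" by (intro card_mono) auto
  then show False using assms by simp
qed

lemma coef_face_sum:
  fixes s :: "'v::linorder set" and a :: "'v set \<Rightarrow> 'r::comm_ring_1"
  assumes "finite s"
  shows "coef (if card s \<le> 1 then 0
      else \<Sum>k<card s. Poly_Mapping.single (f (del_nth k s)) ((- 1) ^ k * a (del_nth k s))) b
    = (\<Sum>x\<in>s. if s - {x} \<noteq> {} \<and> f (s - {x}) = b then pos_sign x s * a (s - {x}) else 0)"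
proof (cases "card s \<le> 1")
  case True
  then have "s - {x} = {}" if "x \<in> s" for x
    using assms that by (auto simp: card_le_Suc0_iff_eq)
  then show ?thesis using True by simp
next
  case False
  have "(\<Sum>k<card s. if f (del_nth k s) = b then (- 1) ^ k * a (del_nth k s) else 0)
    = (\<Sum>x\<in>s. if f (s - {x}) = b then pos_sign x s * a (s - {x}) else 0)"
    unfolding pos_sign_def
    using sum_del_nth[OF assms, of "\<lambda>s' k. if f s' = b then (- 1) ^ k * a s' else 0"] .
  then show ?thesis
    using False Diff_singleton_nonempty[OF False]
    by (simp add: coef_sum lookup_single when_def)
qed

lemma coef_bd_simplex:
  fixes s :: "'v::linorder set"
  assumes "finite s"
  shows "coef (bd_simplex s :: _ \<Rightarrow>\<^sub>0 'k::field) t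
    = (if t = {} then 0 else \<Sum>x\<in>s. if s - {x} = t then pos_sign x s else 0)"
proof -
  have "(bd_simplex s :: _ \<Rightarrow>\<^sub>0 'k) = (if card s \<le> 1 then 0
    else \<Sum>k<card s. Poly_Mapping.single (del_nth k s) ((- 1) ^ k * 1))"
    by (simp only: bd_simplex_def mult_1_right)
  then have "coef (bd_simplex s :: _ \<Rightarrow>\<^sub>0 'k) t
    = (\<Sum>x\<in>s. if s - {x} \<noteq> {} \<and> s - {x} = t then pos_sign x s else 0)"
    using coef_face_sum[OF assms, of "\<lambda>s. s" "\<lambda>_. 1 :: 'k" t] by (simp only: mult_1_right)
  moreover have "(if s - {x} \<noteq> {} \<and> s - {x} = t then a else 0)
    = (if t = {} then 0 else if s - {x} = t then a else 0)" for x and a :: 'k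
    by (cases "t = {}"; cases "s - {x} = t") (simp_all del: Diff_eq_empty_iff)
  ultimately show ?thesis by (cases "t = {}") (simp_all only: if_True if_False sum.neutral_const simp_thms)
qed

lemma coef_boundary:
  fixes c :: "'v::linorder set \<Rightarrow>\<^sub>0 'k::field"
  assumes V: "finite V" "supp c \<subseteq> Pow V"
  shows "coef (lin_ext bd_simplex c) t = (if t = {} then 0 else bdry V (coef c) t)"
proof -
  have fin: "finite s" if "s \<in> Pow V" for s using that V finite_subset by auto
  have c0: "coef c s = 0" if "\<not> s \<subseteq> V" for s using that V(2) by (auto simp: in_keys_iff)
  have "coef (lin_ext bd_simplex c) t = (\<Sum>s\<in>Pow V. coef c s * coef (bd_simplex s) t)"
    using V by (intro coef_lin_ext) auto
  also have "\<dots> = (if t = {} then 0 else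
      \<Sum>s\<in>Pow V. \<Sum>x\<in>s. if s - {x} = t then pos_sign x s * coef c s else 0)"
    using fin
  proof (cases "t = {}")
    case False
    have "coef c s * coef (bd_simplex s) t = (\<Sum>x\<in>s. if s - {x} = t then pos_sign x s * coef c s else 0)"
      if "s \<in> Pow V" for s
      using False fin[OF that] unfolding coef_bd_simplex[OF fin[OF that]]
      by (simp add: sum_distrib_left) (rule sum.cong, simp_all add: mult.commute)
    then show ?thesis using False by simp
  qed (simp add: coef_bd_simplex)
  also have "\<dots> = (if t = {} then 0 else bdry V (coef c) t)"
    unfolding bdry_def by (subst sum_cofaces) (use V c0 in auto)
  finally show ?thesis .
qed

lemma supp_cycle: "c \<in> cycles q K \<Longrightarrow> supp c \<subseteq> simplices q K"
  by (simp add: cycles_def chains_simps)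

lemma simplices_subset: "simplices q K \<subseteq> K"
  by (auto simp: simplices_def)

lemma cycles_iff:
  assumes "finite V" "K \<subseteq> Pow V"
  shows "c \<in> cycles q K \<longleftrightarrow> supp c \<subseteq> simplices q K \<and> (\<forall>t. t \<noteq> {} \<longrightarrow> bdry V (coef c) t = 0)"
proof -
  have "supp c \<subseteq> Pow V" if "supp c \<subseteq> simplices q K" using that assms simplices_subset by blast
  then have "lin_ext bd_simplex c = 0 \<longleftrightarrow> (\<forall>t. t \<noteq> {} \<longrightarrow> bdry V (coef c) t = 0)" if "supp c \<subseteq> simplices q K"
    using that by (auto simp: poly_mapping_eq_iff fun_eq_iff coef_boundary[OF assms(1)])
  then show ?thesis by (auto simp: cycles_def chains_simps)
qed

lemma linear_form_bdry: "linear_form (\<lambda>c. bdry V (coef c) t)"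
  by (simp add: linear_form_def bdry_def lookup_add algebra_simps sum.distrib sum_distrib_left)

lemma bdry_boundary_empty:
  assumes "finite V" "K \<subseteq> Pow V" "b \<in> boundaries q K"
  shows "bdry V (coef b) {} = 0"
proof -
  obtain y where y: "b = lin_ext bd_simplex y" "supp y \<subseteq> Pow V"
    using assms simplices_subset[of "q + 1" K] by (auto simp: boundaries_def chains_simps)
  have "bdry V (coef b) {} = bdry V (bdry V (coef y)) {}"
    by (rule bdry_cong) (simp add: y coef_boundary[OF assms(1)])
  then show ?thesis using assms by (simp add: bdry_bdry)
qed

text \<open>Only the cones over the \<open>q\<close>-simplices of \<open>K\<close> have to lie in \<open>L\<close>. This allows \<open>L\<close>
  to be a later stage of the filtration, and the nerve to miss its largest cones.\<close>

lemma boundary_via_cone: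
  assumes V: "finite V" "v \<in> V" "K \<subseteq> Pow V" "L \<subseteq> Pow V" "{} \<notin> K"
    and L: "\<And>s. s \<in> simplices q K \<Longrightarrow> insert v s \<in> L"
    and c: "c \<in> cycles q K" "bdry V (coef c) {} = 0"
  shows "c \<in> boundaries q L"
proof -
  define y where "y = of_fun (simplices (q + 1) L) (cone v (coef c))"
  have finL: "finite (simplices (q + 1) L)"
    using V simplices_subset[of "q + 1" L] by (meson finite_Pow_iff finite_subset)
  have kc: "supp c \<subseteq> simplices q K" and bc: "bdry V (coef c) t = 0" for t
    using c cycles_iff[OF V(1,3), of c q] by (simp_all, metis)
  have "coef y s = cone v (coef c) s" for s
  proof (cases "s \<in> simplices (q + 1) L")
    case False
    have "cone v (coef c) s = 0"
    proof (rule ccontr)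
      assume "cone v (coef c) s \<noteq> 0"
      then have vs: "v \<in> s" "coef c (s - {v}) \<noteq> 0" by (auto simp: cone_def split: if_splits)
      then have s': "s - {v} \<in> simplices q K" using kc by (auto simp: in_keys_iff)
      then have "finite (s - {v})"
        using V(1,3) simplices_subset[of q K] by (meson Pow_iff finite_subset subsetD)
      then have "int (card s) = int (card (s - {v})) + 1"
        using vs(1) by (metis card.remove finite_Diff finite_insert insert_Diff of_nat_Suc add.commute)
      moreover have "s \<in> L" using L[OF s'] vs(1) by (simp add: insert_absorb)
      ultimately show False using False s' by (simp add: simplices_def)
    qed
    then show ?thesis using False finL by (simp add: y_def coef_of_fun)
  qed (simp add: y_def coef_of_fun finL)
  then have y: "coef y = cone v (coef c)" by blast
  have ky: "supp y \<subseteq> simplices (q + 1) L" unfolding y_def using finL by (rule supp_of_fun)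
  then have kyV: "supp y \<subseteq> Pow V" using V simplices_subset by blast
  have "lin_ext bd_simplex y = c"
  proof (rule poly_mapping_eqI)
    fix t show "coef (lin_ext bd_simplex y) t = coef c t"
    proof (cases "t \<subseteq> V \<and> t \<noteq> {}")
      case True
      then have "finite t" using V finite_subset by blast
      then show ?thesis
        using True V bc by (simp add: coef_boundary[OF V(1) kyV] y bdry_cone cone_def)
    next
      case False
      have "bdry V (coef y) t = 0" if "\<not> t \<subseteq> V"
        using that kyV by (intro bdry_eq_0) (auto simp: in_keys_iff)
      moreover have "t \<notin> K" using False V(3,5) by auto
      then have "coef c t = 0" using kc simplices_subset[of q K] coef_eq_0[of c "simplices q K" t] by blast
      ultimately show ?thesis using False by (auto simp: coef_boundary[OF V(1) kyV])
    qed
  qed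
  then show ?thesis using ky by (auto simp: boundaries_def chains_simps)
qed

lemma cycles_empty: "c \<in> cycles q {} \<Longrightarrow> c = 0"
  by (auto simp: cycles_def chains_simps simplices_def)

lemma vertex_cycle:
  assumes "{v} \<in> K" "K \<subseteq> Pow V" "finite V" "v \<in> V"
  shows "Poly_Mapping.single {v} 1 \<in> (cycles 0 K :: ('v::linorder set \<Rightarrow>\<^sub>0 'k::field) set)"
    "bdry V (coef (Poly_Mapping.single {v} (1 :: 'k))) {} = 1"
proof -
  have "bdry V (coef (Poly_Mapping.single {v} (1 :: 'k))) t = 0" if "t \<noteq> {}" for t
    using that by (intro bdry_eq_0) (auto simp: lookup_single when_def)
  then show "Poly_Mapping.single {v} 1 \<in> (cycles 0 K :: ('v set \<Rightarrow>\<^sub>0 'k) set)"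
    using assms by (simp add: cycles_iff[of V] simplices_def)
  show "bdry V (coef (Poly_Mapping.single {v} (1 :: 'k))) {} = 1"
    using assms(3,4) by (subst bdry_single[where w = v]) (auto simp: lookup_single when_def)
qed

text \<open>The form is the augmentation, the generator the vertex \<open>v\<close>.\<close>

lemma persistent_homology_0:
  fixes Y :: "'v::linorder filtered_complex"
  assumes mono: "mono (filt Y)" and V: "finite V" "v \<in> V" and sub: "\<And>j. filt Y j \<subseteq> Pow V"
    and low: "\<And>j. j < a \<Longrightarrow> filt Y j = {}" and vertex: "\<And>j. a \<le> j \<Longrightarrow> {v} \<in> filt Y j"
    and fill: "\<And>j (c :: _ \<Rightarrow>\<^sub>0 'k::field). c \<in> cycles 0 (filt Y j) \<Longrightarrow> bdry V (coef c) {} = 0 \<Longrightarrow>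
      c \<in> boundaries 0 (filt Y (j + 2 * int \<eta>))"
  shows "interleaved \<eta> (persistent_homology 0 Y :: ('k, _) graded_module) (shifted_kt a)"
proof -
  let ?z = "Poly_Mapping.single {v} (1 :: 'k)"
  let ?F = "\<lambda>c :: 'v set \<Rightarrow>\<^sub>0 'k. bdry V (coef c) {}"
  have F: "linear_form ?F" by (rule linear_form_bdry)
  have z: "?z \<in> cycles 0 (filt Y j)" "?F ?z = 1" if "a \<le> j" for j
    using vertex_cycle[OF vertex[OF that] sub V] by blast+
  show ?thesis
  proof (rule persistent_homology_free[OF mono F _ z[OF order_refl]])
    show "?F b = 0" if "b \<in> boundaries 0 (filt Y j)" for j b
      by (rule bdry_boundary_empty[OF V(1) sub that])
    have c0: "c = 0" if "j < a" "c \<in> cycles 0 (filt Y j)" for j and c :: "'v set \<Rightarrow>\<^sub>0 'k"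
      using that(2) unfolding low[OF that(1)] by (rule cycles_empty)
    show "?F c = 0" if "j < a" "c \<in> cycles 0 (filt Y j)" for j c
      unfolding c0[OF that] by (simp add: bdry_def)
    show "c - scale (?F c) ?z \<in> boundaries 0 (filt Y (j + 2 * int \<eta>))"
      if c: "c \<in> cycles 0 (filt Y j)" for j c
    proof (cases "j < a")
      case True
      have "c = 0" using True c by (rule c0)
      then show ?thesis using lin_closedD(1)[OF lin_closed_boundaries] by (simp add: bdry_def)
    next
      case False
      then have le: "a \<le> j" by simp
      have "c - scale (?F c) ?z \<in> cycles 0 (filt Y j)"
        by (intro lin_closedD(3,5)[OF lin_closed_cycles] c z(1)[OF le])
      moreover have "?F (c - scale (?F c) ?z) = 0"
        using linear_form_residual[OF F z(2)[OF le]] .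
      ultimately show ?thesis by (rule fill)
    qed
  qed
qed

section \<open>The staircase cover\<close>

text \<open>The degree in which \<open>s\<close> enters \<open>X\<close>: it enters with the first \<open>U_i\<close> whose index \<open>i\<close> it misses.\<close>

definition birth :: "nat \<Rightarrow> nat set \<Rightarrow> nat"
  where "birth D s = 2 * Min ({0..D + 1} - s)"

lemma birth_eqI:
  assumes "m \<le> D + 1" "m \<notin> s" "\<And>i. i < m \<Longrightarrow> i \<in> s"
  shows "birth D s = 2 * m"
proof -
  have "m \<le> i" if "i \<in> {0..D + 1} - s" for i
    using assms(3)[of i] that by (cases "i < m") auto
  then have "Min ({0..D + 1} - s) = m" using assms(1,2) by (intro Min_eqI) auto
  then show ?thesis by (simp add: birth_def)
qed

lemma birth_leI: "i \<le> D + 1 \<Longrightarrow> i \<notin> s \<Longrightarrow> birth D s \<le> 2 * i"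
  unfolding birth_def by (simp add: Min_le)

lemma birth_le_iff:
  assumes "\<not> {0..D + 1} \<subseteq> s"
  shows "int (birth D s) \<le> m \<longleftrightarrow> (\<exists>i\<le>D + 1. i \<notin> s \<and> 2 * int i \<le> m)"
proof -
  let ?A = "{0..D + 1} - s"
  have "?A \<noteq> {}" using assms by blast
  then have "Min ?A \<in> ?A" by (intro Min_in) auto
  then have "Min ?A \<le> D + 1" "Min ?A \<notin> s" by auto
  moreover have "int (2 * Min ?A) \<le> m" if "i \<le> D + 1" "i \<notin> s" "2 * int i \<le> m" for i
  proof -
    have "Min ?A \<le> i" using that by (intro Min_le) auto
    then show ?thesis using that(3) by simp
  qed
  ultimately show ?thesis unfolding birth_def by (metis of_nat_mult of_nat_numeral)
qed

lemma birth_mono: "s \<subseteq> s' \<Longrightarrow> \<not> {0..D + 1} \<subseteq> s' \<Longrightarrow> birth D s \<le> birth D s'"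
  unfolding birth_def by (intro mult_left_mono Min_antimono) auto

lemma birth_vertex: "birth D {v} = (if v = 0 then 2 else 0)"
  using birth_eqI[of 1 D "{v}"] birth_eqI[of 0 D "{v}"] by auto

type_synonym 'k total_chain = "nat set \<times> nat set \<Rightarrow>\<^sub>0 'k poly"

locale staircase =
  fixes D :: nat
    and X :: "nat filtered_complex"
    and \<Lambda> :: "nat set"
    and U :: "nat \<Rightarrow> nat filtered_complex"
  assumes D_pos: "D \<ge> 1"
    and Lambda: "\<Lambda> = {0..D + 1}"
    and cplx_X: "cplx X = {\<sigma>. \<sigma> \<noteq> {} \<and> \<sigma> \<subset> {0..D + 1}}"
    and cplx_U: "\<forall>i\<in>\<Lambda>. cplx (U i) = {\<sigma>. \<sigma> \<noteq> {} \<and> \<sigma> \<subseteq> {0..D + 1} - {i}}"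
    and filt_neg: "\<forall>m<0. filt X m = {}"
    and filt_even: "\<forall>j\<le>D + 1. filt X (2 * int j) = (\<Union>i\<in>{0..j}. cplx (U i))"
    and filt_odd: "\<forall>j\<le>D + 1. filt X (2 * int j + 1) = (\<Union>i\<in>{0..j}. cplx (U i))"
    and filt_high: "\<forall>m\<ge>2 * int D + 2. filt X m = cplx X"
    and filt_Ui: "\<forall>i\<in>\<Lambda>. \<forall>m. filt (U i) m = cplx (U i) \<inter> filt X m"
begin

abbreviation V :: "nat set" where "V \<equiv> {0..D + 1}"

lemma filt_X: "filt X m = {s. s \<noteq> {} \<and> s \<subset> V \<and> int (birth D s) \<le> m}"
proof -
  consider "m < 0" | "m \<ge> 2 * int D + 2" | j where "j \<le> D + 1" "m = 2 * int j \<or> m = 2 * int j + 1"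
  proof -
    have "m < 0 \<or> m \<ge> 2 * int D + 2 \<or> (\<exists>j\<le>D + 1. m = 2 * int j \<or> m = 2 * int j + 1)"
    proof (cases "m < 0 \<or> m \<ge> 2 * int D + 2")
      case False
      then have "nat (m div 2) \<le> D + 1" "m = 2 * int (nat (m div 2)) \<or> m = 2 * int (nat (m div 2)) + 1"
        by auto
      then show ?thesis by blast
    qed blast
    then show ?thesis using that by blast
  qed
  then show ?thesis
  proof cases
    case 1
    then show ?thesis using filt_neg by auto
  next
    case 2
    have "int (birth D s) \<le> m" if "s \<subset> V" for s
    proof -
      have "\<not> V \<subseteq> s" using that by blast
      moreover from that obtain i where "i \<in> V" "i \<notin> s" by blast
      ultimately show ?thesis using 2 by (subst birth_le_iff) auto
    qed
    then show ?thesis using filt_high 2 cplx_X by auto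
  next
    case 3
    have "filt X m = (\<Union>i\<in>{0..j}. cplx (U i))"
      using 3(2) filt_even[rule_format, OF 3(1)] filt_odd[rule_format, OF 3(1)] by (elim disjE) simp_all
    also have "\<dots> = (\<Union>i\<in>{0..j}. {s. s \<noteq> {} \<and> s \<subseteq> V - {i}})"
      using cplx_U 3(1) by (simp add: Lambda)
    also have "\<dots> = {s. s \<noteq> {} \<and> s \<subset> V \<and> int (birth D s) \<le> m}" (is "?L = ?R")
    proof (intro subset_antisym subsetI)
      fix s assume "s \<in> ?L"
      then obtain i where i: "i \<le> j" "s \<noteq> {}" "s \<subseteq> V - {i}" by auto
      then have "i \<in> V" "i \<notin> s" using 3(1) by auto
      then have "\<not> V \<subseteq> s" by blast
      then have "int (birth D s) \<le> m" using i 3 by (subst birth_le_iff) (use \<open>i \<notin> s\<close> in \<open>auto intro!: exI[of _ i]\<close>)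
      then show "s \<in> ?R" using i \<open>\<not> V \<subseteq> s\<close> by blast
    next
      fix s assume s: "s \<in> ?R"
      then have "\<not> V \<subseteq> s" by blast
      then obtain i where "i \<le> D + 1" "i \<notin> s" "2 * int i \<le> m" using s birth_le_iff[of D s m] by blast
      then show "s \<in> ?L" using s 3 by auto
    qed
    finally show ?thesis .
  qed
qed

lemma filt_U:
  assumes "i \<in> V"
  shows "filt (U i) m = {s. s \<noteq> {} \<and> s \<subseteq> V - {i} \<and> int (birth D s) \<le> m}"
proof -
  have i: "i \<in> \<Lambda>" using assms by (simp add: Lambda)
  have sub: "s \<subset> V" if "s \<subseteq> V - {i}" for s using that assms by blast
  have "filt (U i) m = cplx (U i) \<inter> filt X m" using filt_Ui i by blast
  moreover have "cplx (U i) = {s. s \<noteq> {} \<and> s \<subseteq> V - {i}}" using cplx_U i by blast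
  ultimately have "filt (U i) m
    = {s. (s \<noteq> {} \<and> s \<subseteq> V - {i}) \<and> (s \<noteq> {} \<and> s \<subset> V \<and> int (birth D s) \<le> m)}"
    unfolding filt_X by (simp only: Collect_conj_eq[symmetric])
  also have "\<dots> = {s. s \<noteq> {} \<and> s \<subseteq> V - {i} \<and> int (birth D s) \<le> m}"
    using sub by (intro Collect_cong) metis
  finally show ?thesis .
qed

lemma cplx_intersection:
  assumes "I \<noteq> {}" "I \<subseteq> V"
  shows "cplx (intersection U I) = {s. s \<noteq> {} \<and> s \<subseteq> V - I}"
proof -
  have "cplx (intersection U I) = (\<Inter>i\<in>I. {s. s \<noteq> {} \<and> s \<subseteq> V - {i}})"
    unfolding intersection_def filtered_complex.simps
    using assms(2) by (intro INF_cong refl cplx_U[rule_format]) (unfold Lambda, rule subsetD)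
  also have "\<dots> = {s. s \<noteq> {} \<and> s \<subseteq> V - I}" using assms(1) by blast
  finally show ?thesis .
qed

lemma filt_intersection:
  assumes "I \<noteq> {}" "I \<subseteq> V"
  shows "filt (intersection U I) m = {s. s \<noteq> {} \<and> s \<subseteq> V - I \<and> int (birth D s) \<le> m}"
proof -
  have "filt (intersection U I) m = (\<Inter>i\<in>I. {s. s \<noteq> {} \<and> s \<subseteq> V - {i} \<and> int (birth D s) \<le> m})"
    unfolding intersection_def filtered_complex.simps
    using assms(2) by (intro INF_cong refl filt_U) (rule subsetD)
  also have "\<dots> = {s. s \<noteq> {} \<and> s \<subseteq> V - I \<and> int (birth D s) \<le> m}" using assms(1) by blast
  finally show ?thesis .
qed

lemma cplx_nerve: "cplx (nerve \<Lambda> U) = {I. I \<noteq> {} \<and> I \<subset> V}"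
proof -
  have "cplx (nerve \<Lambda> U) = {I. I \<noteq> {} \<and> finite I \<and> I \<subseteq> V \<and> cplx (intersection U I) \<noteq> {}}"
    by (simp add: nerve_def Let_def Lambda)
  also have "\<dots> = {I. I \<noteq> {} \<and> I \<subset> V}"
  proof (rule Collect_cong)
    fix I
    show "I \<noteq> {} \<and> finite I \<and> I \<subseteq> V \<and> cplx (intersection U I) \<noteq> {} \<longleftrightarrow> I \<noteq> {} \<and> I \<subset> V"
    proof (cases "I \<noteq> {} \<and> I \<subseteq> V")
      case True
      have "cplx (intersection U I) \<noteq> {} \<longleftrightarrow> V - I \<noteq> {}"
        using True unfolding cplx_intersection[OF conjunct1[OF True] conjunct2[OF True]] by blast
      also have "\<dots> \<longleftrightarrow> I \<noteq> V" using True by (metis Diff_cancel Diff_eq_empty_iff subset_antisym)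
      finally have "cplx (intersection U I) \<noteq> {} \<longleftrightarrow> I \<noteq> V" .
      moreover have "finite I" using True by (meson finite_atLeastAtMost finite_subset)
      ultimately show ?thesis using True unfolding psubset_eq by metis
    next
      case False
      then show ?thesis unfolding psubset_eq by metis
    qed
  qed
  finally show ?thesis .
qed

text \<open>Only the facet opposite to the vertex 0 is late: its intersection consists of the single point 0,
  which enters in degree 2, whereas any other intersection contains a vertex of degree 0.\<close>

lemma filt_nerve:
  "filt (nerve \<Lambda> U) j = {I. I \<noteq> {} \<and> I \<subset> V \<and> (if I = V - {0} then 2 else 0) \<le> j}"
proof -
  have least: "(LEAST j'. filt (intersection U I) j' \<noteq> {}) = (if I = V - {0} then 2 else 0)"
    if I: "I \<noteq> {}" "I \<subset> V" for I
  proof -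
    have IV: "I \<subseteq> V" "I \<noteq> V" using I(2) by (blast intro: psubset_imp_subset, metis psubset_eq)
    have ne: "filt (intersection U I) m \<noteq> {} \<longleftrightarrow> (\<exists>s. s \<noteq> {} \<and> s \<subseteq> V - I \<and> int (birth D s) \<le> m)" for m
      unfolding filt_intersection[OF I(1) IV(1)] by blast
    show ?thesis
    proof (cases "I = V - {0}")
      case True
      have "V - I = V - (V - {0})" by (rule arg_cong[OF True])
      also have "\<dots> = {0}" by (subst double_diff) auto
      finally have VI: "V - I = {0}" .
      have "s \<noteq> {} \<and> s \<subseteq> V - I \<longleftrightarrow> s = {0}" for s unfolding VI by blast
      then have "filt (intersection U I) m \<noteq> {} \<longleftrightarrow> int (birth D {0}) \<le> m" for m
        unfolding ne by metis
      then have "filt (intersection U I) m \<noteq> {} \<longleftrightarrow> 2 \<le> m" for m by (simp add: birth_vertex)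
      then have "(LEAST j'. filt (intersection U I) j' \<noteq> {}) = 2" by (intro Least_equality) auto
      then show ?thesis using True by simp
    next
      case False
      have "\<not> V - I \<subseteq> {0}"
      proof
        assume "V - I \<subseteq> {0}"
        moreover have "V - I \<noteq> {}" using IV by (metis Diff_eq_empty_iff subset_antisym)
        ultimately have "V - I = {0}" by (metis subset_singletonD)
        then show False using False IV(1) by (metis double_diff subset_refl)
      qed
      then obtain v where v: "v \<in> V - I" "v \<noteq> 0" by blast
      then have "\<exists>s. s \<noteq> {} \<and> s \<subseteq> V - I \<and> int (birth D s) \<le> 0"
        by (intro exI[of _ "{v}"]) (simp add: birth_vertex)
      then have "filt (intersection U I) 0 \<noteq> {}" unfolding ne .
      moreover have "0 \<le> m" if "filt (intersection U I) m \<noteq> {}" for m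
        using that unfolding ne by (metis of_nat_0_le_iff order_trans)
      ultimately have "(LEAST j'. filt (intersection U I) j' \<noteq> {}) = 0" by (rule Least_equality)
      then show ?thesis using False by simp
    qed
  qed
  have "filt (nerve \<Lambda> U) j
    = {I \<in> cplx (nerve \<Lambda> U). (LEAST j'. filt (intersection U I) j' \<noteq> {}) \<le> j}"
    by (simp add: nerve_def Let_def)
  also have "\<dots> = {I. (I \<noteq> {} \<and> I \<subset> V) \<and> (LEAST j'. filt (intersection U I) j' \<noteq> {}) \<le> j}"
    by (simp only: cplx_nerve mem_Collect_eq)
  also have "\<dots> = {I. I \<noteq> {} \<and> I \<subset> V \<and> (if I = V - {0} then 2 else 0) \<le> j}"
  proof (rule Collect_cong)
    fix I
    show "(I \<noteq> {} \<and> I \<subset> V) \<and> (LEAST j'. filt (intersection U I) j' \<noteq> {}) \<le> j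
      \<longleftrightarrow> I \<noteq> {} \<and> I \<subset> V \<and> (if I = V - {0} then 2 else 0) \<le> j"
    proof (cases "I \<noteq> {} \<and> I \<subset> V")
      case True
      then show ?thesis unfolding least[OF conjunct1[OF True] conjunct2[OF True]] by blast
    qed blast
  qed
  finally show ?thesis .
qed

lemma filtered_complexI:
  fixes Y :: "nat filtered_complex"
  assumes filt: "\<And>j. filt Y j = {s \<in> cplx Y. int (birth D s) \<le> j}"
    and proper: "\<And>s. s \<in> cplx Y \<Longrightarrow> s \<noteq> {} \<and> s \<subset> V"
    and down: "\<And>s t. s \<in> cplx Y \<Longrightarrow> t \<noteq> {} \<Longrightarrow> t \<subseteq> s \<Longrightarrow> t \<in> cplx Y"
  shows "is_filtered_complex Y"
  unfolding is_filtered_complex_def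
proof (intro conjI allI)
  have fin: "finite s \<and> s \<noteq> {}" if "s \<in> cplx Y" for s
    using proper[OF that] finite_subset[of s V] psubset_imp_subset by blast
  show "abstract_complex (cplx Y)"
    unfolding abstract_complex_def using fin down by metis
  have birth: "birth D t \<le> birth D s" if "s \<in> cplx Y" "t \<subseteq> s" for s t
    using that proper[OF that(1)] by (intro birth_mono) (simp_all only: psubset_eq subset_antisym, metis subset_antisym)
  show "abstract_complex (filt Y j)" for j
    unfolding abstract_complex_def filt
  proof (intro conjI ballI allI impI)
    fix s t assume "s \<in> {s \<in> cplx Y. int (birth D s) \<le> j}" "t \<noteq> {} \<and> t \<subseteq> s"
    then show "t \<in> {s \<in> cplx Y. int (birth D s) \<le> j}"
      using down[of s t] birth[of s t] by simp
  qed (use fin in simp_all)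
  show "mono (filt Y)" by (rule monoI) (auto simp: filt)
  have "s \<notin> filt Y (-1)" for s by (simp add: filt)
  then show "(\<Inter>j. filt Y j) = {}" by blast
  show "(\<Union>j. filt Y j) = cplx Y" unfolding filt by blast
qed

lemma filtered_cover: "filtered_cover X \<Lambda> U"
  unfolding filtered_cover_def
proof (intro conjI ballI allI)
  show "is_filtered_complex X"
  proof (rule filtered_complexI)
    show "s \<noteq> {} \<and> s \<subset> V" if "s \<in> cplx X" for s using that unfolding cplx_X by simp
    show "filt X j = {s \<in> cplx X. int (birth D s) \<le> j}" for j
      unfolding filt_X cplx_X by (simp only: mem_Collect_eq conj_assoc)
    show "t \<in> cplx X" if "s \<in> cplx X" "t \<noteq> {}" "t \<subseteq> s" for s t
      using that subset_psubset_trans[of t s V] unfolding cplx_X by simp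
  qed
  have sub: "s \<subset> V" if "s \<subseteq> V - {i}" "i \<in> V" for s i using that by blast
  show "is_filtered_complex (U i)" "cplx (U i) \<subseteq> cplx X" if "i \<in> \<Lambda>" for i
  proof -
    have i: "i \<in> V" using that by (simp add: Lambda)
    have c: "cplx (U i) = {s. s \<noteq> {} \<and> s \<subseteq> V - {i}}" using cplx_U that by blast
    show "cplx (U i) \<subseteq> cplx X"
      unfolding c cplx_X by (rule Collect_mono) (use sub[OF _ i] in blast)
    show "is_filtered_complex (U i)"
    proof (rule filtered_complexI)
      show "s \<noteq> {} \<and> s \<subset> V" if "s \<in> cplx (U i)" for s using that sub[OF _ i] unfolding c by simp
      show "filt (U i) j = {s \<in> cplx (U i). int (birth D s) \<le> j}" for j
        unfolding filt_U[OF i] c by (simp only: mem_Collect_eq conj_assoc)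
      show "t \<in> cplx (U i)" if "s \<in> cplx (U i)" "t \<noteq> {}" "t \<subseteq> s" for s t
        using that subset_trans[of t s "V - {i}"] unfolding c by simp
    qed
  qed
  show "filt X j = (\<Union>i\<in>\<Lambda>. filt (U i) j)" for j
  proof -
    have "(\<Union>i\<in>\<Lambda>. filt (U i) j) = (\<Union>i\<in>V. {s. s \<noteq> {} \<and> s \<subseteq> V - {i} \<and> int (birth D s) \<le> j})"
      unfolding Lambda by (intro SUP_cong refl filt_U)
    also have "\<dots> = {s. s \<noteq> {} \<and> (\<exists>i\<in>V. s \<subseteq> V - {i}) \<and> int (birth D s) \<le> j}" by blast
    also have "\<dots> = filt X j"
    proof -
      have "(\<exists>i\<in>V. s \<subseteq> V - {i}) \<longleftrightarrow> s \<subset> V" for s by (rule iffI) (use sub in blast, blast)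
      then show ?thesis unfolding filt_X by simp
    qed
    finally show ?thesis ..
  qed
qed

lemma mono_filt_intersection:
  assumes "I \<noteq> {}" "I \<subseteq> V"
  shows "mono (filt (intersection U I))"
proof (rule monoI)
  fix j k :: int assume "j \<le> k"
  then show "filt (intersection U I) j \<subseteq> filt (intersection U I) k"
    unfolding filt_intersection[OF assms] by (intro Collect_mono) (meson order_trans)
qed

lemma mono_filt_nerve: "mono (filt (nerve \<Lambda> U))"
proof (rule monoI)
  fix j k :: int assume "j \<le> k"
  then show "filt (nerve \<Lambda> U) j \<subseteq> filt (nerve \<Lambda> U) k"
    unfolding filt_nerve by (intro Collect_mono) (meson order_trans)
qed

text \<open>In degree \<open>2j\<close> or \<open>2j + 1\<close> the intersection consists of the simplices on \<open>V - I\<close> that do not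
  contain \<open>{0..j}\<close>. If \<open>j + 1\<close> lies in \<open>V - I\<close>, adding it preserves this condition, so the stage is
  already a cone. If not, no simplex on \<open>V - I\<close> contains \<open>{0..j + 1}\<close>, so two degrees later
  every simplex is present and any apex will do.\<close>

lemma cycle_in_intersection_bounds:
  fixes c :: "nat set \<Rightarrow>\<^sub>0 'k::field"
  assumes I: "I \<noteq> {}" "I \<subseteq> V" "I \<noteq> V"
    and c: "c \<in> cycles q (filt (intersection U I) m)" "bdry V (coef c) {} = 0"
  shows "c \<in> boundaries q (filt (intersection U I) (m + 2))"
proof (cases "m < 0")
  case True
  then have "filt (intersection U I) m = {}" using I by (subst filt_intersection) auto
  then have "c = 0" using c(1) by (simp add: cycles_empty)
  then show ?thesis using lin_closedD(1)[OF lin_closed_boundaries] by simp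
next
  case False
  note fl = filt_intersection[OF I(1,2)]
  define j where "j = nat (m div 2)"
  have j: "2 * int j \<le> m" "m \<le> 2 * int j + 1" using False unfolding j_def by auto
  have VI: "V - I \<noteq> {}" using I by blast
  define w where "w = (if j + 1 \<in> V - I then j + 1 else Max (V - I))"
  have wV: "w \<in> V - I" using Max_in[OF _ VI] unfolding w_def by (metis finite_Diff finite_atLeastAtMost)
  have not: "\<not> V \<subseteq> s" if "s \<subseteq> V - I" for s using that I by blast
  have sub: "filt (intersection U I) k \<subseteq> Pow V" for k unfolding fl by blast
  show ?thesis
  proof (rule boundary_via_cone[where V = V and v = w, OF _ _ sub sub _ _ c])
    fix s assume "s \<in> simplices q (filt (intersection U I) m)"
    then have s: "s \<noteq> {}" "s \<subseteq> V - I" "int (birth D s) \<le> m"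
      unfolding simplices_def fl by simp_all
    obtain i where i: "i \<le> D + 1" "i \<notin> s" "2 * int i \<le> m"
      using s(3) birth_le_iff[OF not[OF s(2)]] by blast
    have ws: "insert w s \<subseteq> V - I" using s(2) wV by blast
    have "\<exists>k\<le>D + 1. k \<notin> insert w s \<and> 2 * int k \<le> m + 2"
    proof (cases "j + 1 \<in> V - I")
      case True
      then have "i \<noteq> w" using i(3) j by (simp add: w_def)
      then show ?thesis using i by (intro exI[of _ i]) simp
    next
      case out: False
      show ?thesis
      proof (cases "j + 1 \<le> D + 1")
        case True
        then have "j + 1 \<notin> insert w s" using out ws by blast
        then show ?thesis using True j by (intro exI[of _ "j + 1"]) simp
      next
        case False
        obtain k where "k \<in> V" "k \<notin> insert w s" using not[OF ws] by blast
        then show ?thesis using False j by (intro exI[of _ k]) simp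
      qed
    qed
    then have "int (birth D (insert w s)) \<le> m + 2" using birth_le_iff[OF not[OF ws]] by blast
    then show "insert w s \<in> filt (intersection U I) (m + 2)" using ws unfolding fl by blast
  next
    show "{} \<notin> filt (intersection U I) m" unfolding fl by simp
    show "w \<in> V" using wV by blast
  qed simp
qed

lemma cycle_bnd_empty:
  assumes "c \<in> cycles q K" "q \<noteq> 0"
  shows "bdry V (coef c) {} = 0"
  using supp_cycle[OF assms(1)] assms(2)
  by (intro bdry_eq_0) (auto simp: simplices_def in_keys_iff)

lemma intersection_interleaved:
  assumes I: "I \<noteq> {}" "I \<subseteq> V" "I \<noteq> V"
  shows "q \<noteq> 0 \<Longrightarrow> interleaved 1
      (persistent_homology q (intersection U I) :: ('k::field, _) graded_module) zero_graded"
    and "\<exists>a. interleaved 1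
      (persistent_homology 0 (intersection U I) :: ('k, _) graded_module) (shifted_kt a)"
proof -
  note mono = mono_filt_intersection[OF I(1,2)] and fl = filt_intersection[OF I(1,2)]
  show "interleaved 1 (persistent_homology q (intersection U I) :: ('k, _) graded_module) zero_graded"
    if "q \<noteq> 0"
    using cycle_in_intersection_bounds[OF I _ cycle_bnd_empty[OF _ that]]
    by (intro persistent_homology_zero[OF mono]) simp
  define v where "v = Max (V - I)"
  have VI: "V - I \<noteq> {}" using I by blast
  then have v: "v \<in> V - I" unfolding v_def by (intro Max_in) simp_all
  have vmax: "u \<le> v" if "u \<in> V - I" for u using that unfolding v_def by (intro Max_ge) simp_all
  have low: "filt (intersection U I) j = {}" if "j < int (birth D {v})" for j
  proof (rule ccontr)
    assume "filt (intersection U I) j \<noteq> {}"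
    then obtain s where s: "s \<noteq> {}" "s \<subseteq> V - I" "int (birth D s) \<le> j" unfolding fl by blast
    then have "0 \<le> j" by linarith
    then have v0: "v = 0" "j < 2" using that by (simp_all add: birth_vertex split: if_splits)
    have "u = 0" if "u \<in> s" for u using vmax[of u] that s(2) v0 by blast
    then have "s = {0}" using s(1) by blast
    then show False using s(3) \<open>j < 2\<close> by (simp add: birth_vertex)
  qed
  have "interleaved 1 (persistent_homology 0 (intersection U I) :: ('k, _) graded_module)
    (shifted_kt (int (birth D {v})))"
  proof (rule persistent_homology_0[OF mono finite_atLeastAtMost _ _ low])
    show "v \<in> V" using v by blast
    show "filt (intersection U I) j \<subseteq> Pow V" for j unfolding fl by blast
    show "{v} \<in> filt (intersection U I) j" if "int (birth D {v}) \<le> j" for j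
      using v that unfolding fl by simp
    show "c \<in> boundaries 0 (filt (intersection U I) (j + 2 * int 1))"
      if "c \<in> cycles 0 (filt (intersection U I) j)" "bdry V (coef c) {} = 0"
      for j and c :: "nat set \<Rightarrow>\<^sub>0 'k"
      using cycle_in_intersection_bounds[OF I that] by simp
  qed
  then show "\<exists>a. interleaved 1
      (persistent_homology 0 (intersection U I) :: ('k, _) graded_module) (shifted_kt a)" by blast
qed

lemma acyclic: "acyclic_cover TYPE('k::field) 1 X \<Lambda> U"
  unfolding acyclic_cover_def cplx_nerve mem_Collect_eq psubset_eq
  by (intro conjI ballI filtered_cover allI impI intersection_interleaved) simp_all

end

section \<open>Homology of the nerve\<close>

lemma pos_sign_0 [simp]: "pos_sign (0::nat) s = 1"
  by (simp add: pos_sign_def)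

context staircase
begin

lemma nerve_sub: "filt (nerve \<Lambda> U) j \<subseteq> Pow V"
  unfolding filt_nerve by (auto dest: psubset_imp_subset)

text \<open>The nerve is contracted with apex 0: simplices containing 0 are never the late facet, and they
  are proper unless the base is a facet.\<close>

lemma nerve_insert_0:
  assumes "s \<in> simplices p (filt (nerve \<Lambda> U) j)" "p \<noteq> int D"
  shows "insert 0 s \<in> filt (nerve \<Lambda> U) j"
proof -
  have s: "s \<noteq> {}" "s \<subset> V" "(if s = V - {0} then 2 else 0) \<le> j" "int (card s) = p + 1"
    using assms(1) unfolding simplices_def filt_nerve by simp_all
  have sV: "s \<subseteq> V" using s(2) by (rule psubset_imp_subset)
  have "insert 0 s \<noteq> V"
  proof
    assume *: "insert 0 s = V"
    have "0 \<notin> s" using * s(2) by (metis insert_absorb psubset_eq)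
    then have "s = V - {0}" using * by blast
    then have "card s = D + 1" by simp
    then show False using s(4) assms(2) by simp
  qed
  moreover have "insert 0 s \<subseteq> V" using sV by simp
  ultimately have "insert 0 s \<subset> V" by (simp only: psubset_eq not_False_eq_True simp_thms)
  moreover have "0 \<le> j" using s(3) by (simp split: if_splits)
  moreover have "insert 0 s \<noteq> V - {0}" by blast
  ultimately show ?thesis unfolding filt_nerve by simp
qed

lemma nerve_cycle_bounds:
  fixes c :: "nat set \<Rightarrow>\<^sub>0 'k::field"
  assumes "c \<in> cycles p (filt (nerve \<Lambda> U) j)" "bdry V (coef c) {} = 0" "p \<noteq> int D"
  shows "c \<in> boundaries p (filt (nerve \<Lambda> U) j)"
proof (rule boundary_via_cone[where V = V and v = 0, OF _ _ nerve_sub nerve_sub _ _ assms(1,2)])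
  show "{} \<notin> filt (nerve \<Lambda> U) j" unfolding filt_nerve by simp
qed (use nerve_insert_0 assms(3) in simp_all)

lemma nerve_homology_other:
  assumes "p \<noteq> 0" "p \<noteq> int D"
  shows "interleaved 0 (persistent_homology p (nerve \<Lambda> U) :: ('k::field, _) graded_module) zero_graded"
  using nerve_cycle_bounds[OF _ cycle_bnd_empty[OF _ assms(1)] assms(2)]
  by (intro persistent_homology_zero[OF mono_filt_nerve]) simp

lemma nerve_homology_0:
  "interleaved 0 (persistent_homology 0 (nerve \<Lambda> U) :: ('k::field, _) graded_module) (shifted_kt 0)"
proof (rule persistent_homology_0[OF mono_filt_nerve finite_atLeastAtMost _ nerve_sub, where v = 0])
  show "filt (nerve \<Lambda> U) j = {}" if "j < 0" for j unfolding filt_nerve using that by auto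
  show "{0} \<in> filt (nerve \<Lambda> U) j" if "0 \<le> j" for j
  proof -
    have "{0} \<noteq> V - {0}" by blast
    moreover have "{0} \<subset> V" by (rule psubsetI) (auto simp: set_eq_iff intro: exI[of _ 1])
    ultimately show ?thesis using that unfolding filt_nerve by simp
  qed
  show "c \<in> boundaries 0 (filt (nerve \<Lambda> U) (j + 2 * int 0))"
    if "c \<in> cycles 0 (filt (nerve \<Lambda> U) j)" "bdry V (coef c) {} = 0"
    for j and c :: "nat set \<Rightarrow>\<^sub>0 'k"
    using nerve_cycle_bounds[OF that] D_pos by simp
qed simp

lemma card_facet:
  assumes "s \<subset> V" "card s = D + 1"
  obtains v where "v \<in> V" "s = V - {v}"
proof -
  obtain v where v: "v \<in> V" "v \<notin> s" using assms(1) by blast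
  then have "s \<subseteq> V - {v}" using assms(1) by blast
  moreover have "card s = card (V - {v})" using v assms(2) by simp
  ultimately have "s = V - {v}" by (intro card_subset_eq) simp_all
  then show thesis using v(1) that by blast
qed

text \<open>Two facets share a ridge, which lies on no other facet; so one coefficient of a cycle determines
  all of them.\<close>

lemma nerve_top_cycle_eq_0:
  fixes c :: "nat set \<Rightarrow>\<^sub>0 'k::field"
  assumes c: "c \<in> cycles (int D) (filt (nerve \<Lambda> U) j)" and 0: "coef c (V - {0}) = 0"
  shows "c = 0"
proof (rule poly_mapping_eqI, rule ccontr)
  fix s assume "coef c s \<noteq> coef 0 s"
  then have s: "coef c s \<noteq> 0" by simp
  have cyc: "supp c \<subseteq> simplices (int D) (filt (nerve \<Lambda> U) j)"
    "\<And>t. t \<noteq> {} \<Longrightarrow> bdry V (coef c) t = 0"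
    using c cycles_iff[OF _ nerve_sub, of c "int D" j] by simp_all
  have "s \<in> simplices (int D) (filt (nerve \<Lambda> U) j)" using cyc(1) s by (meson in_keys_iff subsetD)
  then have "s \<subset> V" "card s = D + 1" unfolding simplices_def filt_nerve by simp_all
  then obtain v where v: "v \<in> V" "s = V - {v}" by (rule card_facet)
  have "v \<noteq> 0" using s 0 v by metis
  let ?t = "V - {0, v}"
  have ins: "insert 0 ?t = s" "insert v ?t = V - {0}" using v \<open>v \<noteq> 0\<close> by auto
  obtain u where "u \<in> V" "u \<noteq> 0" "u \<noteq> v"
  proof (cases "v = 1")
    case True
    then show ?thesis using D_pos that[of 2] by simp
  next
    case False
    then show ?thesis using that[of 1] by simp
  qed
  then have "?t \<noteq> {}" by blast
  then have "bdry V (coef c) ?t = 0" by (rule cyc(2))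
  moreover have "bdry V (coef c) ?t = pos_sign 0 ?t * coef c (insert 0 ?t)"
  proof (rule bdry_single)
    fix w assume "w \<in> V" "w \<notin> ?t" "w \<noteq> 0"
    then have wv: "w = v" by blast
    show "coef c (insert w ?t) = 0" unfolding wv ins(2) by (rule 0)
  qed simp_all
  ultimately have "pos_sign 0 ?t * coef c s = 0" unfolding ins by simp
  then have "coef c s = 0" by (simp only: pos_sign_0 mult_1)
  then show False using s by simp
qed

text \<open>The fundamental cycle of the sphere, as the boundary of its missing interior. Being a cycle is then
  an instance of \<open>\<partial>\<partial> = 0\<close> and needs no computation with signs.\<close>

definition sphere :: "nat set \<Rightarrow> 'r::comm_ring_1"
  where "sphere = bdry V (\<lambda>s. if s = V then 1 else 0)"

lemma sphere_facet: "v \<in> V \<Longrightarrow> sphere (V - {v}) = pos_sign v V"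
  unfolding sphere_def
  by (subst bdry_single[where w = v]) (auto simp: insert_absorb)

lemma sphere_eq_0: "(\<And>v. v \<in> V \<Longrightarrow> s \<noteq> V - {v}) \<Longrightarrow> sphere s = 0"
  unfolding sphere_def by (rule bdry_eq_0) (metis Diff_insert_absorb)

lemma bdry_sphere: "finite t \<Longrightarrow> bdry V sphere t = 0"
  unfolding sphere_def by (rule bdry_bdry) simp_all

lemma nerve_homology_D:
  "interleaved 0 (persistent_homology (int D) (nerve \<Lambda> U) :: ('k::field, _) graded_module) (shifted_kt 2)"
proof -
  let ?F = "\<lambda>c :: nat set \<Rightarrow>\<^sub>0 'k. coef c (V - {0})"
  let ?S = "(\<lambda>v. V - {v}) ` V"
  define z :: "nat set \<Rightarrow>\<^sub>0 'k" where "z = of_fun ?S sphere"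
  have F: "linear_form ?F" by (simp add: linear_form_def lookup_add)
  have "coef z s = sphere s" for s
  proof -
    have "coef z s = (if s \<in> ?S then sphere s else 0)" unfolding z_def by (rule coef_of_fun) simp
    moreover have "sphere s = (0::'k)" if "s \<notin> ?S" using that by (intro sphere_eq_0) blast
    ultimately show ?thesis by presburger
  qed
  then have lz: "coef z = sphere" by blast
  have mem: "V - {v} \<in> simplices (int D) (filt (nerve \<Lambda> U) j)" if "2 \<le> j" "v \<in> V" for j v
  proof -
    have "card (V - {v}) = D + 1" using that(2) by simp
    moreover have "V - {v} \<subset> V" using that(2) by blast
    moreover have "V - {v} \<noteq> {}" using calculation(1) by (metis card.empty add_is_0 one_neq_zero)
    ultimately show ?thesis using that(1) unfolding simplices_def filt_nerve by simp
  qed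
  have z: "z \<in> cycles (int D) (filt (nerve \<Lambda> U) j)" if "2 \<le> j" for j
  proof -
    have "supp z \<subseteq> ?S" unfolding z_def by (rule supp_of_fun) simp
    also have "?S \<subseteq> simplices (int D) (filt (nerve \<Lambda> U) j)" using mem[OF that] by blast
    finally have "supp z \<subseteq> simplices (int D) (filt (nerve \<Lambda> U) j)" .
    moreover have "bdry V (coef z) t = 0" for t
    proof (cases "finite t")
      case True
      then show ?thesis unfolding lz by (rule bdry_sphere)
    next
      case False
      have "sphere (insert w t) = (0::'k)" for w
      proof (rule sphere_eq_0)
        fix v
        have "finite (V - {v})" by simp
        then show "insert w t \<noteq> V - {v}" using False by (metis finite_insert)
      qed
      then show ?thesis unfolding lz by (intro bdry_eq_0)
    qed
    ultimately show ?thesis using cycles_iff[OF _ nerve_sub, of z "int D" j] by blast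
  qed
  show ?thesis
  proof (rule persistent_homology_free[OF mono_filt_nerve F _ z[OF order_refl]])
    show "?F z = 1" unfolding lz by (subst sphere_facet) simp_all
    show "?F b = 0" if "b \<in> boundaries (int D) (filt (nerve \<Lambda> U) j)" for j b
    proof -
      have "simplices (int D + 1) (filt (nerve \<Lambda> U) j) = {}"
      proof -
        have False if "s \<in> simplices (int D + 1) (filt (nerve \<Lambda> U) j)" for s
        proof -
          from that have s: "s \<subset> V" "int (card s) = int D + 2" unfolding simplices_def filt_nerve by simp_all
          have "card s < card V" using s(1) by (rule psubset_card_mono[rotated]) simp
          then show False using s(2) by simp
        qed
        then show ?thesis by blast
      qed
      then have "b \<in> lin_ext bd_simplex ` {0}" using that by (simp add: boundaries_def chains_simps)
      then have "b = 0" by (simp add: linear_mapD(3)[OF linear_map_lin_ext])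
      then show ?thesis by simp
    qed
    show low: "?F c = 0" if "j < 2" "c \<in> cycles (int D) (filt (nerve \<Lambda> U) j)" for j c
    proof (rule ccontr)
      assume "?F c \<noteq> 0"
      then have "V - {0} \<in> simplices (int D) (filt (nerve \<Lambda> U) j)"
        using supp_cycle[OF that(2)] by (meson in_keys_iff subsetD)
      then show False using that(1) unfolding simplices_def filt_nerve by simp
    qed
    show "c - scale (?F c) z \<in> boundaries (int D) (filt (nerve \<Lambda> U) (j + 2 * int 0))"
      if c: "c \<in> cycles (int D) (filt (nerve \<Lambda> U) j)" for j c
    proof -
      have "c - scale (?F c) z \<in> cycles (int D) (filt (nerve \<Lambda> U) j)"
      proof (cases "j < 2")
        case True
        then show ?thesis using low[OF True c] c by simp
      next
        case False
        then have "2 \<le> j" by simp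
        then show ?thesis by (intro lin_closedD(3,5)[OF lin_closed_cycles] c z)
      qed
      moreover have "coef (c - scale (?F c) z) (V - {0}) = 0"
      proof -
        have "sphere (V - {0}) = (1::'k)" by (subst sphere_facet) simp_all
        then show ?thesis unfolding lookup_minus coef_scale lz by (simp only: mult_1_right diff_self)
      qed
      ultimately have "c - scale (?F c) z = 0" by (rule nerve_top_cycle_eq_0)
      then show ?thesis using lin_closedD(1)[OF lin_closed_boundaries] by metis
    qed
  qed
qed

end

section \<open>The double complex\<close>

lemma monom_sign: "monom ((- 1) ^ k) n = (- 1) ^ k * monom (1::'k::comm_ring_1) n"
  by (induction k) (simp_all flip: minus_monom)

lemma bdry_swap:
  "bdry V (\<lambda>s. bdry W (\<lambda>I. c s I) J) t = bdry W (\<lambda>I. bdry V (\<lambda>s. c s I) t) J"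
proof -
  have "bdry V (\<lambda>s. bdry W (c s) J) t
    = (\<Sum>w\<in>V - t. \<Sum>u\<in>W - J. pos_sign w t * (pos_sign u J * c (insert w t) (insert u J)))"
    by (simp add: bdry_def sum_distrib_left)
  also have "\<dots> = (\<Sum>u\<in>W - J. \<Sum>w\<in>V - t. pos_sign w t * (pos_sign u J * c (insert w t) (insert u J)))"
    by (rule sum.swap)
  also have "\<dots> = bdry W (\<lambda>I. bdry V (\<lambda>s. c s I) t) J"
    by (simp add: bdry_def sum_distrib_left mult.left_commute)
  finally show ?thesis .
qed

context staircase
begin

text \<open>The basis of the double complex: \<open>s\<close> is a simplex of \<open>U_I\<close> exactly if it avoids \<open>I\<close>.\<close>

definition pairs :: "(nat set \<times> nat set) set"
  where "pairs = {(s, I). s \<noteq> {} \<and> I \<noteq> {} \<and> s \<subseteq> V \<and> I \<subseteq> V \<and> s \<inter> I = {}}"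

definition basis :: "int \<Rightarrow> (nat set \<times> nat set) set"
  where "basis n = {b \<in> pairs. int (card (fst b)) + int (card (snd b)) = n + 2}"

lemma pairsD:
  assumes "(s, I) \<in> pairs"
  shows "s \<noteq> {}" "I \<noteq> {}" "s \<subseteq> V" "I \<subseteq> V" "s \<inter> I = {}" "s \<subseteq> V - I" "finite s" "finite I" "\<not> V \<subseteq> s"
proof -
  show *: "s \<noteq> {}" "I \<noteq> {}" "s \<subseteq> V" "I \<subseteq> V" "s \<inter> I = {}" using assms by (simp_all add: pairs_def)
  show "s \<subseteq> V - I" "\<not> V \<subseteq> s" using * by blast+
  show "finite s" "finite I" using * finite_subset[of _ V] by simp_all
qed

lemma pairsI: "s \<noteq> {} \<Longrightarrow> I \<noteq> {} \<Longrightarrow> s \<subseteq> V \<Longrightarrow> I \<subseteq> V \<Longrightarrow> s \<inter> I = {} \<Longrightarrow> (s, I) \<in> pairs"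
  by (simp add: pairs_def)

lemma pairs_subset: "pairs \<subseteq> Pow V \<times> Pow V"
  unfolding pairs_def by auto

lemma finite_pairs: "finite pairs"
  by (rule finite_subset[OF pairs_subset]) simp

lemma mv_basis_eq:
  "mv_basis \<Lambda> U p q = {b \<in> pairs. int (card (snd b)) = p + 1 \<and> int (card (fst b)) = q + 1}"
proof -
  have "(s, I) \<in> mv_basis \<Lambda> U p q \<longleftrightarrow>
    (s, I) \<in> {b \<in> pairs. int (card (snd b)) = p + 1 \<and> int (card (fst b)) = q + 1}" for s I
  proof (cases "I \<noteq> {} \<and> I \<subseteq> V \<and> I \<noteq> V")
    case True
    then have "I \<in> cplx (nerve \<Lambda> U)" unfolding cplx_nerve by (simp add: psubset_eq)
    moreover have "s \<in> cplx (intersection U I) \<longleftrightarrow> s \<noteq> {} \<and> s \<subseteq> V \<and> s \<inter> I = {}"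
      unfolding cplx_intersection[OF conjunct1[OF True] conjunct1[OF conjunct2[OF True]]] by blast
    ultimately show ?thesis using True unfolding mv_basis_def simplices_def pairs_def by auto
  next
    case False
    then have "I \<notin> cplx (nerve \<Lambda> U)" unfolding cplx_nerve psubset_eq by blast
    moreover have "(s, I) \<notin> pairs"
    proof
      assume *: "(s, I) \<in> pairs"
      then have "I = V" using False pairsD(2,4) by blast
      then show False using pairsD(1,6)[OF *] by simp
    qed
    ultimately show ?thesis unfolding mv_basis_def simplices_def by simp
  qed
  then show ?thesis by auto
qed

lemma mv_F_eq: "mv_F \<Lambda> U p n = {c. supp c \<subseteq> {b \<in> basis n. int (card (snd b)) \<le> p + 1}}"
proof -
  have "(\<Union>p'\<in>{..p}. mv_basis \<Lambda> U p' (n - p')) = {b \<in> basis n. int (card (snd b)) \<le> p + 1}"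
  proof -
    have "(\<exists>p'\<in>{..p}. int (card (snd b)) = p' + 1 \<and> int (card (fst b)) = n - p' + 1) \<longleftrightarrow>
      int (card (fst b)) + int (card (snd b)) = n + 2 \<and> int (card (snd b)) \<le> p + 1"
      for b :: "nat set \<times> nat set"
      by (auto intro!: bexI[of _ "int (card (snd b)) - 1"])
    then show ?thesis unfolding mv_basis_eq basis_def by blast
  qed
  then show ?thesis by (simp add: mv_F_def)
qed

lemma mv_deg_eq:
  assumes "(s, I) \<in> pairs"
  shows "mv_deg U (s, I) = int (birth D s)"
proof -
  have "s \<in> filt (intersection U I) j \<longleftrightarrow> int (birth D s) \<le> j" for j
    unfolding filt_intersection[OF pairsD(2,4)[OF assms]] using pairsD(1,6)[OF assms] by blast
  then have "(LEAST j. s \<in> filt (intersection U I) j) = int (birth D s)"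
    by (intro Least_equality) simp_all
  then show ?thesis by (simp add: mv_deg_def)
qed

lemma mv_total_eq: "mv_total \<Lambda> U = free_graded (mv_deg U) pairs"
proof -
  have "(\<Union>p q. mv_basis \<Lambda> U p q) = pairs"
    unfolding mv_basis_eq
    by (auto intro!: exI[of _ "int (card _) - 1"])
  then show ?thesis by (simp add: mv_total_def)
qed

abbreviation t_birth :: "nat set \<Rightarrow> 'k::field poly"
  where "t_birth s \<equiv> monom 1 (birth D s)"

lemma sum_if_const: "(\<Sum>x\<in>A. if P then f x else 0) = (if P then \<Sum>x\<in>A. f x else 0)"
  by simp

lemma coef_mv_d0:
  assumes b: "(s, I) \<in> pairs"
  shows "t_birth t * coef (mv_d0 U (s, I) :: 'k::field total_chain) (t, J)
    = (if J = I \<and> t \<noteq> {} then \<Sum>x\<in>s. if s - {x} = t then pos_sign x s * t_birth s else 0 else 0)"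
proof -
  let ?a = "\<lambda>s'. monom 1 (nat (mv_deg U (s, I) - mv_deg U (s', I))) :: 'k poly"
  have "mv_d0 U (s, I) = (if card s \<le> 1 then 0 else
      \<Sum>k<card s. Poly_Mapping.single (del_nth k s, I) ((- 1) ^ k * ?a (del_nth k s)))"
    by (simp add: mv_d0_def monom_sign)
  then have "t_birth t * coef (mv_d0 U (s, I) :: 'k total_chain) (t, J) = (\<Sum>x\<in>s. t_birth t *
      (if s - {x} \<noteq> {} \<and> (s - {x}, I) = (t, J) then pos_sign x s * ?a (s - {x}) else 0))"
    using coef_face_sum[OF pairsD(7)[OF b], of "\<lambda>s'. (s', I)" ?a "(t, J)"]
    by (simp only: sum_distrib_left)
  also have "\<dots> = (\<Sum>x\<in>s. if J = I \<and> t \<noteq> {} then if s - {x} = t then pos_sign x s * t_birth s else 0 else 0)"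
  proof (rule sum.cong)
    fix x assume "x \<in> s"
    show "t_birth t * (if s - {x} \<noteq> {} \<and> (s - {x}, I) = (t, J) then pos_sign x s * ?a (s - {x}) else 0)
      = (if J = I \<and> t \<noteq> {} then if s - {x} = t then pos_sign x s * t_birth s else 0 else 0)"
    proof (cases "J = I \<and> t \<noteq> {} \<and> s - {x} = t")
      case True
      then have tI: "(t, I) \<in> pairs" using pairsD[OF b] by (intro pairsI) auto
      have "birth D t \<le> birth D s" using True pairsD(9)[OF b] by (intro birth_mono) auto
      then have "birth D t + nat (int (birth D s) - int (birth D t)) = birth D s" by simp
      then have "t_birth t * ?a t = t_birth s" by (simp only: mv_deg_eq[OF b] mv_deg_eq[OF tI] mult_monom mult_1)
      then have "t_birth t * (pos_sign x s * ?a t) = pos_sign x s * t_birth s" by (simp only: mult.left_commute)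
      then show ?thesis using True by simp
    qed auto
  qed simp
  finally show ?thesis by (simp only: sum_if_const)
qed

lemma coef_mv_d1:
  assumes b: "(s, I) \<in> pairs"
  shows "t_birth t * coef (mv_d1 U (s, I) :: 'k::field total_chain) (t, J)
    = (if s = t \<and> J \<noteq> {} then \<Sum>x\<in>I. if I - {x} = J then pos_sign x I * t_birth s else 0 else 0)"
proof -
  let ?a = "\<lambda>J. monom 1 (nat (mv_deg U (s, I) - mv_deg U (s, J))) :: 'k poly"
  have "mv_d1 U (s, I) = (if card I \<le> 1 then 0 else
      \<Sum>k<card I. Poly_Mapping.single (s, del_nth k I) ((- 1) ^ k * ?a (del_nth k I)))"
    by (simp add: mv_d1_def monom_sign)
  then have "t_birth t * coef (mv_d1 U (s, I) :: 'k total_chain) (t, J) = (\<Sum>x\<in>I. t_birth t *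
      (if I - {x} \<noteq> {} \<and> (s, I - {x}) = (t, J) then pos_sign x I * ?a (I - {x}) else 0))"
    using coef_face_sum[OF pairsD(8)[OF b], of "\<lambda>J. (s, J)" ?a "(t, J)"]
    by (simp only: sum_distrib_left)
  also have "\<dots> = (\<Sum>x\<in>I. if s = t \<and> J \<noteq> {} then if I - {x} = J then pos_sign x I * t_birth s else 0 else 0)"
  proof (rule sum.cong)
    fix x assume "x \<in> I"
    show "t_birth t * (if I - {x} \<noteq> {} \<and> (s, I - {x}) = (t, J) then pos_sign x I * ?a (I - {x}) else 0)
      = (if s = t \<and> J \<noteq> {} then if I - {x} = J then pos_sign x I * t_birth s else 0 else 0)"
    proof (cases "s = t \<and> J \<noteq> {} \<and> I - {x} = J")
      case True
      then have "(s, J) \<in> pairs" using pairsD[OF b] by (intro pairsI) auto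
      then have "?a J = 1" by (simp add: mv_deg_eq b monom_0 pCons_one)
      then show ?thesis using True by (simp add: mult.commute)
    qed auto
  qed simp
  finally show ?thesis by (simp only: sum_if_const)
qed

text \<open>Rescaling \<open>(s, I)\<close> by \<open>t\<close> to the power of its degree removes all powers of \<open>t\<close> from the
  differential. Since \<open>k[t]\<close> is a domain, nothing is lost.\<close>

definition hat :: "'k::field total_chain \<Rightarrow> nat set \<Rightarrow> nat set \<Rightarrow> 'k poly"
  where "hat c s I = t_birth s * coef c (s, I)"

lemma hat_eq_0_iff: "hat c s I = 0 \<longleftrightarrow> coef c (s, I) = 0"
  by (simp add: hat_def)

lemma hat_add: "hat (c + c') s I = hat c s I + hat c' s I"
  by (simp add: hat_def lookup_add distrib_left)

lemma hat_diff: "hat (c - c') s I = hat c s I - hat c' s I"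
  by (simp add: hat_def lookup_minus right_diff_distrib)

lemma hat_scale: "hat (scale a c) s I = a * hat c s I"
  by (simp add: hat_def mult.left_commute)

lemma linear_map_mv_D: "linear_map (mv_D U)"
  unfolding mv_D_def by (rule linear_map_lin_ext)

text \<open>In rescaled coordinates the total differential is the sum of two simplicial boundaries, one in each
  variable. The case distinctions remove the augmentations.\<close>

lemma hat_D:
  fixes c :: "'k::field total_chain"
  assumes c: "supp c \<subseteq> pairs"
  shows "hat (mv_D U c) t J
    = (if t = {} then 0 else (- 1) ^ (card J - 1) * bdry V (\<lambda>s. hat c s J) t)
      + (if J = {} then 0 else bdry V (hat c t) J)"
proof -
  have out: "coef c (s, I) = 0" if "(s, I) \<notin> pairs" for s I
    using c that by (rule coef_eq_0)
  then have hat0: "hat c s I = 0" if "\<not> (s \<subseteq> V \<and> I \<subseteq> V)" for s I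
    using that pairsD(3,4) unfolding hat_eq_0_iff by blast
  define R0 :: "nat set \<Rightarrow> nat set \<Rightarrow> 'k poly" where "R0 s I =
    (if J = I \<and> t \<noteq> {} then \<Sum>x\<in>s. if s - {x} = t then pos_sign x s * hat c s I else 0 else 0)" for s I
  define R1 :: "nat set \<Rightarrow> nat set \<Rightarrow> 'k poly" where "R1 s I =
    (if s = t \<and> J \<noteq> {} then \<Sum>x\<in>I. if I - {x} = J then pos_sign x I * hat c s I else 0 else 0)" for s I
  have sub: "supp c \<subseteq> Pow V \<times> Pow V" using c pairs_subset by (rule subset_trans)
  have if_mult: "a * (if P then b else 0) = (if P then a * b else 0)" for a b :: "'k poly" and P by simp
  have summand: "t_birth t * (coef c (s, I) * coef (scale ((- 1) ^ (card (snd (s, I)) - 1)) (mv_d0 U (s, I)) + mv_d1 U (s, I)) (t, J))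
    = (- 1) ^ (card I - 1) * R0 s I + R1 s I" for s I
  proof (cases "(s, I) \<in> pairs")
    case True
    have "t_birth t * (coef c (s, I) * coef (scale ((- 1) ^ (card (snd (s, I)) - 1)) (mv_d0 U (s, I)) + mv_d1 U (s, I)) (t, J))
      = (- 1) ^ (card I - 1) * (coef c (s, I) * (t_birth t * coef (mv_d0 U (s, I)) (t, J)))
        + coef c (s, I) * (t_birth t * coef (mv_d1 U (s, I)) (t, J))"
      by (simp add: lookup_add algebra_simps)
    also have "coef c (s, I) * (t_birth t * coef (mv_d0 U (s, I)) (t, J)) = R0 s I"
      unfolding coef_mv_d0[OF True] R0_def hat_def if_mult sum_distrib_left
      by (simp only: mult.left_commute mult.commute)
    also have "coef c (s, I) * (t_birth t * coef (mv_d1 U (s, I)) (t, J)) = R1 s I"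
      unfolding coef_mv_d1[OF True] R1_def hat_def if_mult sum_distrib_left
      by (simp only: mult.left_commute mult.commute)
    finally show ?thesis .
  next
    case False
    then have "hat c s I = 0" using out by (simp add: hat_def)
    then have "R0 s I = 0" "R1 s I = 0"
      unfolding R0_def R1_def by (simp_all only: mult_zero_right if_cancel sum.neutral_const)
    then show ?thesis using out[OF False] by simp
  qed
  have "hat (mv_D U c) t J = (\<Sum>b\<in>Pow V \<times> Pow V. t_birth t * (coef c b *
      coef (scale ((- 1) ^ (card (snd b) - 1)) (mv_d0 U b) + mv_d1 U b) (t, J)))"
    unfolding hat_def mv_D_def by (subst coef_lin_ext[OF _ sub]) (simp_all only: finite_SigmaI finite_Pow_iff finite_atLeastAtMost sum_distrib_left)
  also have "\<dots> = (\<Sum>(s, I)\<in>Pow V \<times> Pow V. (- 1) ^ (card I - 1) * R0 s I + R1 s I)"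
    by (rule sum.cong) (use summand in auto)
  also have "\<dots> = (\<Sum>s\<in>Pow V. \<Sum>I\<in>Pow V. (- 1) ^ (card I - 1) * R0 s I + R1 s I)"
    by (rule sum.cartesian_product[symmetric])
  also have "\<dots> = (\<Sum>s\<in>Pow V. \<Sum>I\<in>Pow V. (- 1) ^ (card I - 1) * R0 s I) + (\<Sum>s\<in>Pow V. \<Sum>I\<in>Pow V. R1 s I)"
    by (simp only: sum.distrib)
  also have "(\<Sum>s\<in>Pow V. \<Sum>I\<in>Pow V. (- 1) ^ (card I - 1) * R0 s I)
    = (if t = {} then 0 else (- 1) ^ (card J - 1) * bdry V (\<lambda>s. hat c s J) t)"
  proof (cases "t = {}")
    case False
    have "(\<Sum>I\<in>Pow V. (- 1) ^ (card I - 1) * R0 s I)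
      = (- 1) ^ (card J - 1) * (\<Sum>x\<in>s. if s - {x} = t then pos_sign x s * hat c s J else 0)" for s
    proof -
      have "(\<Sum>I\<in>Pow V. (- 1) ^ (card I - 1) * R0 s I)
        = (\<Sum>I\<in>Pow V. if J = I then (- 1) ^ (card J - 1) * (\<Sum>x\<in>s. if s - {x} = t then pos_sign x s * hat c s J else 0) else 0)"
      proof (rule sum.cong)
        fix I
        show "(- 1) ^ (card I - 1) * R0 s I = (if J = I then (- 1) ^ (card J - 1)
          * (\<Sum>x\<in>s. if s - {x} = t then pos_sign x s * hat c s J else 0) else 0)"
        proof (cases "J = I")
          case True
          show ?thesis unfolding R0_def True[symmetric] using False by simp
        qed (simp add: R0_def)
      qed simp
      also have "\<dots> = (if J \<in> Pow V then (- 1) ^ (card J - 1) * (\<Sum>x\<in>s. if s - {x} = t then pos_sign x s * hat c s J else 0) else 0)"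
        by (subst sum.delta') simp_all
      also have "\<dots> = (- 1) ^ (card J - 1) * (\<Sum>x\<in>s. if s - {x} = t then pos_sign x s * hat c s J else 0)"
        using hat0[of _ J] by (cases "J \<subseteq> V") (simp_all cong: if_cong)
      finally show ?thesis .
    qed
    then have "(\<Sum>s\<in>Pow V. \<Sum>I\<in>Pow V. (- 1) ^ (card I - 1) * R0 s I)
      = (- 1) ^ (card J - 1) * (\<Sum>s\<in>Pow V. \<Sum>x\<in>s. if s - {x} = t then pos_sign x s * hat c s J else 0)"
      by (simp only: sum_distrib_left)
    also have "(\<Sum>s\<in>Pow V. \<Sum>x\<in>s. if s - {x} = t then pos_sign x s * hat c s J else 0) = bdry V (\<lambda>s. hat c s J) t"
      unfolding bdry_def using hat0 by (subst sum_cofaces) simp_all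
    finally show ?thesis using False by simp
  qed (simp add: R0_def)
  also have "(\<Sum>s\<in>Pow V. \<Sum>I\<in>Pow V. R1 s I) = (if J = {} then 0 else bdry V (hat c t) J)"
  proof (cases "J = {}")
    case False
    have "(\<Sum>s\<in>Pow V. \<Sum>I\<in>Pow V. R1 s I) = (\<Sum>I\<in>Pow V. \<Sum>s\<in>Pow V. R1 s I)" by (rule sum.swap)
    also have "\<dots> = (\<Sum>I\<in>Pow V. \<Sum>x\<in>I. if I - {x} = J then pos_sign x I * hat c t I else 0)"
    proof (rule sum.cong)
      fix I
      have "(\<Sum>s\<in>Pow V. R1 s I)
        = (\<Sum>s\<in>Pow V. if s = t then (\<Sum>x\<in>I. if I - {x} = J then pos_sign x I * hat c t I else 0) else 0)"
      proof (rule sum.cong)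
        fix s
        show "R1 s I = (if s = t then (\<Sum>x\<in>I. if I - {x} = J then pos_sign x I * hat c t I else 0) else 0)"
        proof (cases "s = t")
          case True
          show ?thesis unfolding R1_def True using False by simp
        qed (simp add: R1_def)
      qed simp
      also have "\<dots> = (if t \<in> Pow V then (\<Sum>x\<in>I. if I - {x} = J then pos_sign x I * hat c t I else 0) else 0)"
        by (subst sum.delta) simp_all
      also have "\<dots> = (\<Sum>x\<in>I. if I - {x} = J then pos_sign x I * hat c t I else 0)"
        using hat0[of t] by (cases "t \<subseteq> V") (simp_all cong: if_cong)
      finally show "(\<Sum>s\<in>Pow V. R1 s I) = (\<Sum>x\<in>I. if I - {x} = J then pos_sign x I * hat c t I else 0)" .
    qed simp
    also have "\<dots> = bdry V (hat c t) J"
      unfolding bdry_def using hat0 by (subst sum_cofaces) simp_all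
    finally show ?thesis using False by simp
  qed (simp add: R1_def)
  finally show ?thesis .
qed

end

section \<open>Row 0 of the spectral sequence\<close>

lemma lin_closed_sums:
  assumes A: "lin_closed A" and B: "lin_closed B"
  shows "lin_closed {u + v |u v. u \<in> A \<and> v \<in> B}"
proof (rule lin_closedI)
  show "0 \<in> {u + v |u v. u \<in> A \<and> v \<in> B}"
    using lin_closedD(1)[OF A] lin_closedD(1)[OF B] by force
  fix x assume "x \<in> {u + v |u v. u \<in> A \<and> v \<in> B}"
  then obtain u v where x: "x = u + v" "u \<in> A" "v \<in> B" by blast
  show "scale a x \<in> {u + v |u v. u \<in> A \<and> v \<in> B}" for a
    unfolding x scale_add using lin_closedD(3)[OF A x(2)] lin_closedD(3)[OF B x(3)] by blast
  fix y assume "y \<in> {u + v |u v. u \<in> A \<and> v \<in> B}"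
  then obtain u' v' where y: "y = u' + v'" "u' \<in> A" "v' \<in> B" by blast
  have "x + y = (u + u') + (v + v')" unfolding x y by (simp add: algebra_simps)
  then show "x + y \<in> {u + v |u v. u \<in> A \<and> v \<in> B}"
    using lin_closedD(2)[OF A x(2) y(2)] lin_closedD(2)[OF B x(3) y(3)] by blast
qed

lemma bdry_nonzero:
  assumes "bdry V c t \<noteq> 0"
  obtains w where "w \<in> V" "w \<notin> t" "c (insert w t) \<noteq> 0"
  using assms bdry_eq_0[of V t c] by blast

context staircase
begin

lemma basis_subset_pairs: "basis n \<subseteq> pairs"
  by (auto simp: basis_def)

lemma finite_basis: "finite (basis n)"
  by (rule finite_subset[OF basis_subset_pairs finite_pairs])

lemma basisI: "(s, I) \<in> pairs \<Longrightarrow> int (card s) + int (card I) = n + 2 \<Longrightarrow> (s, I) \<in> basis n"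
  by (simp add: basis_def)

lemma basisD: "(s, I) \<in> basis n \<Longrightarrow> (s, I) \<in> pairs" "(s, I) \<in> basis n \<Longrightarrow> int (card s) + int (card I) = n + 2"
  by (simp_all add: basis_def)

lemma supp_basis: "supp c \<subseteq> basis n \<Longrightarrow> coef c (s, I) \<noteq> 0 \<Longrightarrow> (s, I) \<in> basis n"
  using coef_eq_0[of c "basis n" "(s, I)"] by metis

lemma supp_pairs: "supp c \<subseteq> basis n \<Longrightarrow> supp c \<subseteq> pairs"
  by (rule subset_trans[OF _ basis_subset_pairs])

lemma supp_mv_D_pair:
  assumes c: "supp c \<subseteq> pairs" and tJ: "coef (mv_D U c) (t, J) \<noteq> 0"
  shows "(t, J) \<in> pairs \<and> (\<exists>w. (w \<notin> t \<and> coef c (insert w t, J) \<noteq> 0) \<or> (w \<notin> J \<and> coef c (t, insert w J) \<noteq> 0))"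
proof -
  have "hat (mv_D U c) t J \<noteq> 0" using tJ by (simp add: hat_eq_0_iff)
  then consider "t \<noteq> {}" "bdry V (\<lambda>s. hat c s J) t \<noteq> 0" | "J \<noteq> {}" "bdry V (hat c t) J \<noteq> 0"
  proof -
    assume "hat (mv_D U c) t J \<noteq> 0"
    then have "t \<noteq> {} \<and> bdry V (\<lambda>s. hat c s J) t \<noteq> 0 \<or> J \<noteq> {} \<and> bdry V (hat c t) J \<noteq> 0"
      unfolding hat_D[OF c] by (cases "t = {}"; cases "J = {}"; simp; metis mult_zero_right add_0)
    then show thesis using that by blast
  qed
  then show ?thesis
  proof cases
    case 1
    from 1(2) obtain w where w: "w \<notin> t" "hat c (insert w t) J \<noteq> 0" by (rule bdry_nonzero)
    then have nz: "coef c (insert w t, J) \<noteq> 0" by (simp add: hat_eq_0_iff)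
    then have p: "(insert w t, J) \<in> pairs" using coef_eq_0[OF c] by metis
    have "(t, J) \<in> pairs" using pairsD[OF p] 1(1) by (intro pairsI) auto
    then show ?thesis using w(1) nz by blast
  next
    case 2
    from 2(2) obtain w where w: "w \<notin> J" "hat c t (insert w J) \<noteq> 0" by (rule bdry_nonzero)
    then have nz: "coef c (t, insert w J) \<noteq> 0" by (simp add: hat_eq_0_iff)
    then have p: "(t, insert w J) \<in> pairs" using coef_eq_0[OF c] by metis
    have "(t, J) \<in> pairs" using pairsD[OF p] 2(1) by (intro pairsI) auto
    then show ?thesis using w(1) nz by blast
  qed
qed

lemma supp_mv_D_pairs: "supp c \<subseteq> pairs \<Longrightarrow> supp (mv_D U c) \<subseteq> pairs"
proof (rule subsetI)
  fix b assume "supp c \<subseteq> pairs" "b \<in> supp (mv_D U c)"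
  then show "b \<in> pairs" using supp_mv_D_pair[of c "fst b" "snd b"] by (simp add: in_keys_iff)
qed

lemma supp_mv_D:
  assumes c: "supp c \<subseteq> basis n"
  shows "supp (mv_D U c) \<subseteq> basis (n - 1)"
proof
  fix b assume b: "b \<in> supp (mv_D U c)"
  obtain t J where tJ: "b = (t, J)" by (cases b)
  have "(t, J) \<in> pairs" and ex: "\<exists>w. (w \<notin> t \<and> coef c (insert w t, J) \<noteq> 0) \<or> (w \<notin> J \<and> coef c (t, insert w J) \<noteq> 0)"
    using supp_mv_D_pair[OF supp_pairs[OF c], of t J] b tJ by (simp_all add: in_keys_iff)
  have fin: "finite t" "finite J" using \<open>(t, J) \<in> pairs\<close> by (simp_all add: pairsD)
  from ex obtain w where w: "(w \<notin> t \<and> coef c (insert w t, J) \<noteq> 0) \<or> (w \<notin> J \<and> coef c (t, insert w J) \<noteq> 0)" ..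
  then have "(w \<notin> t \<and> (insert w t, J) \<in> basis n) \<or> (w \<notin> J \<and> (t, insert w J) \<in> basis n)"
    using supp_basis[OF c] by blast
  then have "int (card t) + int (card J) = n - 1 + 2"
    using fin by (auto dest!: basisD(2))
  then show "b \<in> basis (n - 1)" using \<open>(t, J) \<in> pairs\<close> unfolding tJ by (intro basisI)
qed

text \<open>The mixed terms cancel because the sign \<open>(-1)^p\<close> changes when \<open>I\<close> loses an element.\<close>

lemma mv_D_mv_D:
  fixes c :: "'k::field total_chain"
  assumes c: "supp c \<subseteq> pairs"
  shows "mv_D U (mv_D U c) = 0"
proof (rule poly_mapping_eqI)
  fix b :: "nat set \<times> nat set"
  obtain t J where b: "b = (t, J)" by (cases b)
  note c1 = supp_mv_D_pairs[OF c]
  note c2 = supp_mv_D_pairs[OF c1]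
  show "coef (mv_D U (mv_D U c)) b = coef 0 b"
  proof (cases "(t, J) \<in> pairs")
    case False
    then show ?thesis using coef_eq_0[OF c2] by (simp add: b)
  next
    case True
    note tJ = pairsD[OF True]
    let ?M = "bdry V (\<lambda>s. bdry V (hat c s) J) t" and ?e = "(- 1) ^ (card J - 1) :: 'k poly"
    have "bdry V (\<lambda>s. hat (mv_D U c) s J) t
      = bdry V (\<lambda>s. ?e * bdry V (\<lambda>s. hat c s J) s + bdry V (hat c s) J) t"
      using tJ(2) by (intro bdry_cong) (simp add: hat_D[OF c])
    also have "\<dots> = ?e * bdry V (bdry V (\<lambda>s. hat c s J)) t + ?M"
      by (simp only: bdry_add bdry_scale)
    also have "\<dots> = ?M" using tJ(7) by (subst bdry_bdry) simp_all
    finally have 1: "bdry V (\<lambda>s. hat (mv_D U c) s J) t = ?M" .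
    have "bdry V (hat (mv_D U c) t) J
      = bdry V (\<lambda>I. (- 1) ^ card J * bdry V (\<lambda>s. hat c s I) t + bdry V (hat c t) I) J"
      using tJ(1,8) by (intro bdry_cong) (simp add: hat_D[OF c])
    also have "\<dots> = (- 1) ^ card J * bdry V (\<lambda>I. bdry V (\<lambda>s. hat c s I) t) J + bdry V (bdry V (hat c t)) J"
      by (simp only: bdry_add bdry_scale)
    also have "bdry V (bdry V (hat c t)) J = 0" using tJ(8) by (simp add: bdry_bdry)
    also have "bdry V (\<lambda>I. bdry V (\<lambda>s. hat c s I) t) J = ?M" by (rule bdry_swap[symmetric])
    finally have 2: "bdry V (hat (mv_D U c) t) J = (- 1) ^ card J * ?M" by simp
    have "card J \<noteq> 0" using tJ(2,8) by simp
    then obtain n where n: "card J = Suc n" by (metis not0_implies_Suc)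
    have "hat (mv_D U (mv_D U c)) t J = ?e * ?M + (- 1) ^ card J * ?M"
      unfolding hat_D[OF c1, of t J] 1 2 using tJ(1,2) by (simp only: if_False)
    also have "\<dots> = 0" by (simp add: n)
    finally show ?thesis by (simp add: hat_eq_0_iff b)
  qed
qed

text \<open>The parameter \<open>m\<close> says how far down the filtration the differential must land. On the second
  page \<open>m = p - 1\<close>; on the limit page \<open>m = 0\<close>, which means that the differential is zero, since
  index sets are nonempty. This treats both pages at once.\<close>

definition row_cycles :: "int \<Rightarrow> int \<Rightarrow> 'k::field total_chain set"
  where "row_cycles m p = {c. supp c \<subseteq> basis p \<and> supp (mv_D U c) \<subseteq> {b. int (card (snd b)) \<le> m}}"

definition row_cycles_below :: "int \<Rightarrow> int \<Rightarrow> 'k::field total_chain set"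
  where "row_cycles_below m p = row_cycles m p \<inter> {c. supp c \<subseteq> {b. int (card (snd b)) \<le> p}}"

definition row_boundaries :: "int \<Rightarrow> 'k::field total_chain set"
  where "row_boundaries p = mv_D U ` {c. supp c \<subseteq> basis (p + 1)}"

definition row_relations :: "int \<Rightarrow> int \<Rightarrow> 'k::field total_chain set"
  where "row_relations m p = {u + v |u v. u \<in> row_cycles_below m p \<and> v \<in> row_boundaries p}"

definition bottom_row :: "int \<Rightarrow> int \<Rightarrow> ('k::field, ('k total_chain) set) graded_module"
  where "bottom_row m p = graded_subquotient (free_graded (mv_deg U) pairs) (row_cycles m p) (row_relations m p)"

lemma lin_closed_row_cycles: "lin_closed (row_cycles m p)"
proof -
  have "row_cycles m p = {c. supp c \<subseteq> basis p} \<inter> {c. mv_D U c \<in> {c. supp c \<subseteq> {b. int (card (snd b)) \<le> m}}}"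
    unfolding row_cycles_def by blast
  then show ?thesis
    by (rule ssubst) (intro lin_closed_Int lin_closed_supp lin_closed_vimage linear_map_mv_D)
qed

lemma lin_closed_row_cycles_below: "lin_closed (row_cycles_below m p)"
  unfolding row_cycles_below_def by (intro lin_closed_Int lin_closed_supp lin_closed_row_cycles)

lemma lin_closed_row_boundaries: "lin_closed (row_boundaries p)"
  unfolding row_boundaries_def by (intro lin_closed_image lin_closed_supp linear_map_mv_D)

lemma lin_closed_row_relations: "lin_closed (row_relations m p)"
  unfolding row_relations_def by (intro lin_closed_sums lin_closed_row_cycles_below lin_closed_row_boundaries)

lemma row_relationsI: "u \<in> row_cycles_below m p \<Longrightarrow> v \<in> row_boundaries p \<Longrightarrow> u + v \<in> row_relations m p"
  unfolding row_relations_def by blast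

lemma unital_bottom_row: "unital (bottom_row m p)"
  unfolding bottom_row_def by (rule unital_graded_subquotient[OF lin_closed_row_relations])

lemma mv_F_top: "q \<le> p \<Longrightarrow> mv_F \<Lambda> U p q = {c. supp c \<subseteq> basis q}"
proof -
  assume "q \<le> p"
  have "int (card (snd b)) \<le> p + 1" if b: "b \<in> basis q" for b
  proof -
    have "(fst b, snd b) \<in> basis q" using b by simp
    then have "fst b \<noteq> {}" "finite (fst b)" "int (card (fst b)) + int (card (snd b)) = q + 2"
      using pairsD(1,7) basisD by blast+
    then have "card (fst b) \<noteq> 0" by simp
    then show ?thesis using \<open>int (card (fst b)) + int (card (snd b)) = q + 2\<close> \<open>q \<le> p\<close> by simp
  qed
  then show ?thesis unfolding mv_F_eq by blast
qed

lemma mv_Z_eq: "mv_Z \<Lambda> U r p 0 = row_cycles (p - r + 1) p"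
proof -
  have "supp (mv_D U c) \<subseteq> {b \<in> basis (p - 1). int (card (snd b)) \<le> p - r + 1} \<longleftrightarrow>
      supp (mv_D U c) \<subseteq> {b. int (card (snd b)) \<le> p - r + 1}" if "supp c \<subseteq> basis p"
    for c :: "'a total_chain"
    using supp_mv_D[OF that] by blast
  then show ?thesis unfolding mv_Z_def row_cycles_def by (auto simp: mv_F_top) (auto simp: mv_F_eq)
qed

lemma mv_Z_low_eq: "mv_Z \<Lambda> U r (p - 1) 1 = row_cycles_below (p - r) p"
proof -
  have "supp (mv_D U c) \<subseteq> {b \<in> basis (p - 1). int (card (snd b)) \<le> p - 1 - r + 1} \<longleftrightarrow>
      supp (mv_D U c) \<subseteq> {b. int (card (snd b)) \<le> p - r}" if "supp c \<subseteq> basis p"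
    for c :: "'a total_chain"
    using supp_mv_D[OF that] by auto
  then show ?thesis unfolding mv_Z_def row_cycles_below_def row_cycles_def mv_F_eq by auto
qed

text \<open>Row 0 is the top filtration step of its total degree, so all boundaries count from the first page on.\<close>

lemma mv_B_eq: "1 \<le> r \<Longrightarrow> mv_B \<Lambda> U r p 0 = row_boundaries p"
  using supp_mv_D[of _ "p + 1"] unfolding mv_B_def row_boundaries_def by (auto simp: mv_F_top)

lemma mv_B_subset: "mv_B \<Lambda> U r p 0 \<subseteq> row_boundaries p"
  unfolding mv_B_def row_boundaries_def mv_F_eq by auto

lemma row_cycles_0_iff: "(c :: 'k::field total_chain) \<in> row_cycles 0 p \<longleftrightarrow> supp c \<subseteq> basis p \<and> mv_D U c = 0"
proof -
  have "mv_D U c = 0" if "supp c \<subseteq> basis p" "supp (mv_D U c) \<subseteq> {b. int (card (snd b)) \<le> 0}"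
  proof -
    have "supp (mv_D U c) = {}"
    proof (rule equals0I)
      fix b assume b: "b \<in> supp (mv_D U c)"
      then have "(fst b, snd b) \<in> pairs" using supp_mv_D_pairs[OF supp_pairs[OF that(1)]] by auto
      moreover have "card (snd b) = 0" using b that(2) by auto
      ultimately show False using pairsD(2,8) by fastforce
    qed
    then show ?thesis by simp
  qed
  then show ?thesis unfolding row_cycles_def by auto
qed

lemma row_cycles_mono: "row_cycles 0 p \<subseteq> row_cycles m p"
  using row_cycles_0_iff[of _ p] unfolding row_cycles_def by fastforce

lemma mv_page_eq: "mv_page \<Lambda> U 2 p 0 = bottom_row (p - 1) p"
proof -
  have Z: "mv_Z \<Lambda> U 2 p 0 = (row_cycles (p - 1) p :: ('a total_chain) set)"
    using mv_Z_eq[of 2 p] by simp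
  have L: "mv_Z \<Lambda> U (2 - 1) (p - 1) (0 + 1) = (row_cycles_below (p - 1) p :: ('a total_chain) set)"
    using mv_Z_low_eq[of 1 p] by simp
  have B: "mv_B \<Lambda> U (2 - 1) p 0 = (row_boundaries p :: ('a total_chain) set)" by (rule mv_B_eq) simp
  show ?thesis
    unfolding mv_page_def mv_total_eq Z L B bottom_row_def row_relations_def set_add_plus[OF free_graded_simps(2)] ..
qed

lemma mv_limit_page_eq: "mv_limit_page \<Lambda> U p 0 = bottom_row 0 p"
proof -
  have Z: "(\<Inter>r. mv_Z \<Lambda> U r p 0) = (row_cycles 0 p :: ('a total_chain) set)"
  proof (rule subset_antisym)
    show "(\<Inter>r. mv_Z \<Lambda> U r p 0) \<subseteq> (row_cycles 0 p :: ('a total_chain) set)"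
      by (rule INF_lower2[of "p + 1"]) (simp_all add: mv_Z_eq)
    show "(row_cycles 0 p :: ('a total_chain) set) \<subseteq> (\<Inter>r. mv_Z \<Lambda> U r p 0)"
      unfolding mv_Z_eq by (intro INF_greatest row_cycles_mono)
  qed
  have L: "(\<Inter>r. mv_Z \<Lambda> U r (p - 1) (0 + 1)) = (row_cycles_below 0 p :: ('a total_chain) set)"
  proof (rule subset_antisym)
    show "(\<Inter>r. mv_Z \<Lambda> U r (p - 1) (0 + 1)) \<subseteq> (row_cycles_below 0 p :: ('a total_chain) set)"
      by (rule INF_lower2[of p]) (simp_all add: mv_Z_low_eq)
    have "row_cycles_below 0 p \<subseteq> (row_cycles_below m p :: ('a total_chain) set)" for m
      unfolding row_cycles_below_def using row_cycles_mono by (intro Int_mono) simp_all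
    then show "(row_cycles_below 0 p :: ('a total_chain) set) \<subseteq> (\<Inter>r. mv_Z \<Lambda> U r (p - 1) (0 + 1))"
      by (intro INF_greatest) (simp add: mv_Z_low_eq)
  qed
  have B: "(\<Union>r. mv_B \<Lambda> U r p 0) = (row_boundaries p :: ('a total_chain) set)"
  proof (rule subset_antisym)
    show "(row_boundaries p :: ('a total_chain) set) \<subseteq> (\<Union>r. mv_B \<Lambda> U r p 0)"
      by (rule SUP_upper2[of 1]) (simp_all add: mv_B_eq)
  qed (intro SUP_least mv_B_subset)
  show ?thesis
    unfolding mv_limit_page_def mv_total_eq Z L B bottom_row_def row_relations_def set_add_plus[OF free_graded_simps(2)] ..
qed

section \<open>Filling below the top dimension\<close>

text \<open>The augmentation of row 0 onto the chains of the nerve over \<open>k[t]\<close>, which forgets the vertex.\<close>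

definition aug :: "'k::field total_chain \<Rightarrow> nat set \<Rightarrow> 'k poly"
  where "aug c I = bdry V (\<lambda>s. hat c s I) {}"

lemma aug_sum: "aug c I = (\<Sum>v\<in>V. hat c {v} I)"
  unfolding aug_def by (rule bdry_empty)

lemma aug_diff: "aug (c - c') I = aug c I - aug c' I"
  unfolding aug_def hat_diff by (rule bdry_diff)

lemma aug_scale: "aug (scale a c) I = a * aug c I"
  unfolding aug_def hat_scale by (rule bdry_scale)

lemma aug_add: "aug (c + c') I = aug c I + aug c' I"
  unfolding aug_def hat_add by (rule bdry_add)

lemma aug_nonzero:
  assumes "supp c \<subseteq> basis p" "aug c I \<noteq> 0"
  shows "I \<noteq> {}" "I \<subseteq> V" "finite I" "int (card I) = p + 1"
proof -
  have "bdry V (\<lambda>s. hat c s I) {} \<noteq> 0" using assms(2) by (simp only: aug_def not_False_eq_True)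
  then obtain v where v: "hat c {v} I \<noteq> 0" by (rule bdry_nonzero)
  then have t: "({v}, I) \<in> basis p" using supp_basis[OF assms(1)] by (simp add: hat_eq_0_iff)
  show "I \<noteq> {}" "I \<subseteq> V" "finite I" using pairsD[OF basisD(1)[OF t]] by blast+
  show "int (card I) = p + 1" using basisD(2)[OF t] by simp
qed

lemma aug_mv_D:
  assumes y: "supp y \<subseteq> pairs" and I: "I \<noteq> {}"
  shows "aug (mv_D U y) I = bdry V (aug y) I"
proof -
  have "aug (mv_D U y) I
    = bdry V (\<lambda>s. (- 1) ^ (card I - 1) * bdry V (\<lambda>s. hat y s I) s + bdry V (hat y s) I) {}"
    unfolding aug_def by (rule bdry_cong) (use I in \<open>simp add: hat_D[OF y]\<close>)
  also have "\<dots> = (- 1) ^ (card I - 1) * bdry V (bdry V (\<lambda>s. hat y s I)) {}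
    + bdry V (\<lambda>s. bdry V (hat y s) I) {}"
    by (simp only: bdry_add bdry_scale)
  also have "bdry V (bdry V (\<lambda>s. hat y s I)) {} = 0" by (rule bdry_bdry) simp_all
  also have "bdry V (\<lambda>s. bdry V (hat y s) I) {} = bdry V (aug y) I"
    unfolding aug_def by (rule bdry_swap)
  finally show ?thesis by simp
qed

lemma hat_of_fun:
  "hat (of_fun (basis n) f) s I = (if (s, I) \<in> basis n then t_birth s * f (s, I) else 0)"
  unfolding hat_def coef_of_fun[OF finite_basis] by simp

lemma supp_of_fun_basis: "supp (of_fun (basis n) f) \<subseteq> basis n"
  by (rule supp_of_fun[OF finite_basis])

text \<open>The augmentation of \<open>c\<close> is a cycle of the nerve, hence bounded by its cone with apex 0. Lifting
  this cone to row 0 means choosing a vertex in each intersection, and none is lost: below the top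
  dimension the index sets of the cone are proper.\<close>

lemma fill_augmentation:
  fixes c :: "'k::field total_chain"
  assumes c: "supp c \<subseteq> basis p" and p: "p < int D" and cyc: "\<And>J. bdry V (aug c) J = 0"
  obtains y where "supp y \<subseteq> basis (p + 1)" "\<And>I. aug (c - mv_D U y) I = 0"
proof -
  let ?b = "cone 0 (aug c)"
  \<comment> \<open>The chosen vertex is not 0, as \<open>0 \<in> I\<close>; so it has degree 0 and no power of \<open>t\<close> is needed.\<close>
  define y :: "'k total_chain"
    where "y = of_fun (basis (p + 1)) (\<lambda>(s, I). if s = {Min (V - I)} then ?b I else 0)"
  have ky: "supp y \<subseteq> basis (p + 1)" unfolding y_def by (rule supp_of_fun_basis)
  have aug_y: "aug y I = ?b I" for I
  proof (cases "?b I = 0")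
    case True
    then have "hat y {v} I = 0" for v unfolding y_def hat_of_fun by simp
    then show ?thesis unfolding aug_sum True by simp
  next
    case False
    then have 0: "0 \<in> I" and nz: "aug c (I - {0}) \<noteq> 0" by (auto simp: cone_def split: if_splits)
    note J = aug_nonzero[OF c nz]
    have "finite I" using J(3) by simp
    then have "card I = Suc (card (I - {0}))" using 0 by (rule card.remove)
    then have card: "int (card I) = p + 2" using J(4) by simp
    have IV: "I \<subseteq> V" using J(2) 0 by auto
    have "V - I \<noteq> {}"
    proof
      assume "V - I = {}"
      then have "I = V" using IV by blast
      then show False using card p by simp
    qed
    then have m: "Min (V - I) \<in> V - I" by (intro Min_in) simp_all
    let ?v = "Min (V - I)"
    have v: "?v \<in> V" "?v \<notin> I" "?v \<noteq> 0" using m 0 by (blast, blast, metis DiffD2)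
    have t: "({?v}, I) \<in> basis (p + 1)"
      using v IV 0 card by (intro basisI pairsI) auto
    have "hat y {u} I = (if u = ?v then ?b I else 0)" for u
    proof (cases "u = ?v")
      case True
      have "hat y {?v} I = ?b I"
        unfolding y_def hat_of_fun using t v(3) by (simp add: birth_vertex monom_0 pCons_one)
      then show ?thesis unfolding True by simp
    next
      case False
      then show ?thesis unfolding y_def hat_of_fun by simp
    qed
    then have "aug y I = (\<Sum>u\<in>V. if u = ?v then ?b I else 0)" unfolding aug_sum by simp
    also have "\<dots> = ?b I" using v(1) by (subst sum.delta) simp_all
    finally show ?thesis .
  qed
  then have aug_y': "aug y = ?b" by blast
  have "aug (c - mv_D U y) I = 0" for I
  proof (cases "I \<noteq> {} \<and> finite I")
    case True
    have "bdry V ?b I = aug c I - cone 0 (bdry V (aug c)) I"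
      using True by (intro bdry_cone) simp_all
    also have "cone 0 (bdry V (aug c)) I = 0" unfolding cone_def cyc by simp
    finally show ?thesis
      unfolding aug_diff aug_mv_D[OF supp_pairs[OF ky] conjunct1[OF True]] aug_y' by simp
  next
    case False
    have k: "supp (c - mv_D U y) \<subseteq> basis p"
      using supp_mv_D[OF ky] c lin_closedD(5)[OF lin_closed_supp[of "basis p"], of c "mv_D U y"] by simp
    show ?thesis using aug_nonzero(1,3)[OF k] False by blast
  qed
  then show thesis using that ky by blast
qed

text \<open>The intersection with vertices 0 and 1 is the only one whose torsion reaches \<open>H_0\<close>: the edge \<open>01\<close>
  appears two degrees after the vertex 0. The torsion class is killed by the lift of the
  fundamental cycle of the nerve, whose boundary in this intersection is \<open>0 - t^2 1\<close> up to sign. This is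
  why no torsion is left on the second page below dimension \<open>D\<close>.\<close>

lemma fill_last_edge:
  fixes c :: "'k::field total_chain"
  assumes c: "supp c \<subseteq> basis (int D - 1)" and aug: "\<And>I. aug c I = 0"
  obtains y where "supp y \<subseteq> basis (int D)" "\<And>I. aug (c - mv_D U y) I = 0"
    "coef (c - mv_D U y) ({0}, V - {0, 1}) = 0"
proof -
  let ?I = "V - {0, 1} :: nat set"
  \<comment> \<open>The rescaled coefficient is \<open>t^2\<close> times the fundamental cycle; 2 is the largest degree of a vertex.\<close>
  define w :: "'k total_chain"
    where "w = of_fun (basis (int D))
      (\<lambda>(s, I). if card s = 1 then monom 1 (2 - birth D s) * sphere I else 0)"
  have kw: "supp w \<subseteq> basis (int D)" unfolding w_def by (rule supp_of_fun_basis)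
  have facet: "({v}, V - {v}) \<in> basis (int D)" if "v \<in> V" for v
  proof (intro basisI pairsI)
    have c: "card (V - {v}) = D + 1" using that by simp
    then show "V - {v} \<noteq> {}" by (metis card.empty add_is_0 one_neq_zero)
    show "int (card {v}) + int (card (V - {v})) = int D + 2" using c by simp
  qed (use that in auto)
  have hat_w: "hat w {v} I = (if v \<in> V \<and> I = V - {v} then monom 1 2 * sphere I else 0)" for v I
  proof (cases "({v}, I) \<in> basis (int D)")
    case True
    note pD = pairsD[OF basisD(1)[OF True]]
    have vV: "v \<in> V" using pD(3) by simp
    have "I \<subseteq> V - {v}" using pD(4,5) by blast
    moreover have "card I = card (V - {v})" using basisD(2)[OF True] vV by simp
    ultimately have I: "I = V - {v}" by (intro card_subset_eq) simp_all
    have "birth D {v} \<le> 2" by (simp add: birth_vertex)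
    then have "t_birth {v} * monom 1 (2 - birth D {v}) = (monom 1 2 :: 'k poly)" by (simp add: mult_monom)
    then have "hat w {v} I = monom 1 2 * sphere I"
      unfolding w_def hat_of_fun using True by (simp add: mult.assoc[symmetric])
    moreover have "v \<in> V \<and> I = V - {v}" using vV I by blast
    ultimately show ?thesis using if_P by metis
  next
    case False
    then have "\<not> (v \<in> V \<and> I = V - {v})" using facet by blast
    moreover have "hat w {v} I = 0" unfolding w_def hat_of_fun using False by simp
    ultimately show ?thesis using if_not_P by metis
  qed
  have aug_w: "aug w I = monom 1 2 * sphere I" for I
  proof (cases "\<exists>v\<in>V. I = V - {v}")
    case True
    then obtain v where v: "v \<in> V" "I = V - {v}" by blast
    have "hat w {u} I = (if u = v then monom 1 2 * sphere I else 0)" if "u \<in> V" for u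
    proof -
      have "I = V - {u} \<longleftrightarrow> u = v" using v that by blast
      then show ?thesis unfolding hat_w using that by simp
    qed
    then have "aug w I = (\<Sum>u\<in>V. if u = v then monom 1 2 * sphere I else 0)"
      unfolding aug_sum by (rule sum.cong[OF refl])
    also have "\<dots> = monom 1 2 * sphere I" using v(1) by (subst sum.delta) simp_all
    finally show ?thesis .
  next
    case False
    then have "hat w {u} I = 0" if "u \<in> V" for u unfolding hat_w using that by metis
    then have "aug w I = 0" unfolding aug_sum by (intro sum.neutral) blast
    moreover have "sphere I = (0 :: 'k poly)" using False by (intro sphere_eq_0) blast
    ultimately show ?thesis by simp
  qed
  have kDw: "supp (mv_D U w) \<subseteq> basis (int D - 1)" using kw by (rule supp_mv_D)
  have aug_Dw: "aug (mv_D U w) I = 0" for I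
  proof (cases "I \<noteq> {} \<and> finite I")
    case True
    have "aug (mv_D U w) I = bdry V (\<lambda>I. monom 1 2 * sphere I) I"
      unfolding aug_mv_D[OF supp_pairs[OF kw] conjunct1[OF True]] aug_w ..
    also have "\<dots> = 0" unfolding bdry_scale using True by (simp only: bdry_sphere mult_zero_right)
    finally show ?thesis .
  next
    case False
    then show ?thesis using aug_nonzero(1,3)[OF kDw] by blast
  qed
  have ins: "insert 1 ?I = V - {0}" "insert 0 ?I = V - {1}" using D_pos by auto
  have Ine: "?I \<noteq> {}"
  proof -
    have "2 \<in> ?I" using D_pos by simp
    then show ?thesis by blast
  qed
  have "bdry V (\<lambda>s. hat w s ?I) {0} = 0"
    by (rule bdry_eq_0) (simp add: w_def hat_of_fun)
  moreover have "bdry V (hat w {0}) ?I = pos_sign 1 ?I * hat w {0} (insert 1 ?I)"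
  proof (rule bdry_single)
    fix u assume u: "u \<in> V" "u \<notin> ?I" "u \<noteq> 1"
    then have u0: "u = 0" by blast
    have "0 \<in> V - {1}" "0 \<notin> V - {0}" by simp_all
    then have "\<not> (0 \<in> V \<and> V - {1} = V - {0})" by metis
    then show "hat w {0} (insert u ?I) = 0" unfolding u0 ins hat_w by (rule if_not_P)
  qed (use D_pos in simp_all)
  moreover have "pos_sign 1 ?I = (1 :: 'k poly)"
  proof -
    have "{y \<in> ?I. y < 1} = {}" by auto
    then show ?thesis unfolding pos_sign_def by (simp only: card.empty power_0)
  qed
  moreover have "hat w {0} (insert 1 ?I) = monom 1 2"
  proof -
    have "sphere (V - {0}) = (1 :: 'k poly)" by (subst sphere_facet) simp_all
    then show ?thesis unfolding ins hat_w by simp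
  qed
  ultimately have "hat (mv_D U w) {0} ?I = monom 1 2"
    unfolding hat_D[OF supp_pairs[OF kw]] using Ine by simp
  then have "t_birth {0} * coef (mv_D U w) ({0}, ?I) = t_birth {0} * 1"
    unfolding hat_def by (simp add: birth_vertex)
  then have Dw: "coef (mv_D U w) ({0}, ?I) = 1" by (simp only: mult_cancel_left) simp
  define y where "y = scale (coef c ({0}, ?I)) w"
  have Dy: "mv_D U y = scale (coef c ({0}, ?I)) (mv_D U w)"
    unfolding y_def by (rule linear_mapD(2)[OF linear_map_mv_D])
  show thesis
  proof (rule that)
    show "supp y \<subseteq> basis (int D)" unfolding y_def using kw by (rule supp_scale_subset)
    show "aug (c - mv_D U y) I = 0" for I unfolding aug_diff Dy aug_scale aug_Dw aug by simp
    show "coef (c - mv_D U y) ({0}, ?I) = 0" unfolding lookup_minus Dy coef_scale Dw by simp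
  qed
qed

text \<open>Chains of augmentation 0 bound within each intersection, by the cone on its largest vertex. An edge
  \<open>uw\<close> with \<open>w \<ge> 2\<close> appears together with \<open>u\<close>, so no power of \<open>t\<close> gets in the way; in the
  remaining intersection, with vertices 0 and 1, the last assumption and the vanishing augmentation
  leave nothing to fill.\<close>

lemma fill_edges:
  fixes c :: "'k::field total_chain"
  assumes c: "supp c \<subseteq> basis p" and p: "p < int D" and aug: "\<And>I. aug c I = 0"
    and last: "p = int D - 1 \<Longrightarrow> coef c ({0}, V - {0, 1}) = 0"
  obtains y where "supp y \<subseteq> basis (p + 1)" "\<And>v I. coef (c - mv_D U y) ({v}, I) = 0"
proof -
  let ?w = "\<lambda>I. Max (V - I)"
  let ?e = "\<lambda>I. (- 1) ^ (card I - 1) :: 'k poly"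
  \<comment> \<open>The sign cancels the factor \<open>(-1)^p\<close> in the total differential.\<close>
  define y :: "'k total_chain"
    where "y = of_fun (basis (p + 1))
      (\<lambda>(s, I). if card s = 2 then ?e I * cone (?w I) (\<lambda>s. coef c (s, I)) s else 0)"
  have ky: "supp y \<subseteq> basis (p + 1)" unfolding y_def by (rule supp_of_fun_basis)
  have hat_y: "hat y s I = ?e I * cone (?w I) (\<lambda>s. hat c s I) s" if s2: "card s = 2" for s I
  proof (cases "?w I \<in> s \<and> coef c (s - {?w I}, I) \<noteq> 0")
    case False
    then have "cone (?w I) (\<lambda>s. coef c (s, I)) s = 0" "cone (?w I) (\<lambda>s. hat c s I) s = 0"
      by (auto simp: cone_def hat_eq_0_iff)
    then show ?thesis unfolding y_def hat_of_fun by simp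
  next
    case True
    let ?v = "?w I"
    have "card (s - {?v}) = 1" using s2 True by simp
    then obtain u where u: "s - {?v} = {u}" by (rule card_1_singletonE)
    then have s: "s = {u, ?v}" "u \<noteq> ?v" using True by blast+
    have t: "({u}, I) \<in> basis p" using supp_basis[OF c] True u by simp
    note pD = pairsD[OF basisD(1)[OF t]]
    have uI: "u \<in> V - I" using pD(6) by simp
    then have "V - I \<noteq> {}" by blast
    then have v: "?v \<in> V - I" by (intro Max_in) simp_all
    have umax: "u \<le> ?v" using uI by (intro Max_ge) simp_all
    have t': "(s, I) \<in> basis (p + 1)"
      using uI v pD(2,4) basisD(2)[OF t] s by (intro basisI pairsI) auto
    have "birth D s = birth D {u}"
    proof (cases "u = 0")
      case False
      then have "0 \<notin> s" using s umax by simp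
      then show ?thesis using False birth_eqI[of 0 D s] by (simp add: birth_vertex)
    next
      case u0: True
      have "?v \<noteq> 1"
      proof
        assume v1: "?v = 1"
        have "x = 0 \<or> x = 1" if "x \<in> V - I" for x
        proof -
          have "x \<le> ?v" using that by (intro Max_ge) simp_all
          then show ?thesis unfolding v1 by linarith
        qed
        then have "V - I \<subseteq> {0, 1}" by blast
        moreover have "{0, 1} \<subseteq> V - I" using uI v unfolding u0 v1 by blast
        ultimately have "V - I = {0, 1}" by blast
        then have I: "I = V - {0, 1}" using pD(4) by (metis double_diff subset_refl)
        have "card (V - {0, 1}) = card V - card {0, 1::nat}" using D_pos by (intro card_Diff_subset) auto
        then have "card I = D" unfolding I by simp
        then have "p = int D - 1" using basisD(2)[OF t] by simp
        then have "coef c ({0}, I) = 0" unfolding I by (rule last)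
        then show False using True u u0 by simp
      qed
      then have "1 \<notin> s" using s u0 by simp
      then have "birth D s = 2 * 1" using s u0 by (intro birth_eqI) auto
      then show ?thesis using u0 by (simp add: birth_vertex)
    qed
    then have "t_birth s * coef c ({u}, I) = hat c {u} I" by (simp add: hat_def)
    then have "t_birth s * (?e I * (pos_sign ?v s * coef c ({u}, I))) = ?e I * (pos_sign ?v s * hat c {u} I)"
      by (simp only: mult.left_commute[of "t_birth s"])
    then show ?thesis
      unfolding y_def hat_of_fun cone_def using t' True s2 u by simp
  qed
  have "hat (mv_D U y) {v} I = hat c {v} I" for v I
  proof (cases "I \<noteq> {}")
    case True
    have "hat y {v} J = 0" for J unfolding y_def hat_of_fun by simp
    then have 1: "bdry V (hat y {v}) I = 0" by (intro bdry_eq_0)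
    have "bdry V (\<lambda>s. hat y s I) {v} = bdry V (\<lambda>s. ?e I * cone (?w I) (\<lambda>s. hat c s I) s) {v}"
      by (rule bdry_cong) (simp add: hat_y)
    then have "bdry V (\<lambda>s. hat y s I) {v} = ?e I * bdry V (cone (?w I) (\<lambda>s. hat c s I)) {v}"
      by (simp only: bdry_scale)
    then have "?e I * bdry V (\<lambda>s. hat y s I) {v} = bdry V (cone (?w I) (\<lambda>s. hat c s I)) {v}"
      by (simp add: mult.assoc[symmetric] flip: power_mult_distrib)
    also have "\<dots> = hat c {v} I"
    proof (cases "?w I \<in> V")
      case True
      have "cone (?w I) (bdry V (\<lambda>s. hat c s I)) {v} = 0"
        using aug[of I] unfolding aug_def by (simp add: cone_def)
      then show ?thesis using True by (subst bdry_cone) simp_all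
    next
      case False
      have "cone (?w I) (\<lambda>s. hat c s I) (insert u {v}) = 0" if "u \<in> V" "u \<noteq> v" for u
      proof (rule ccontr)
        assume *: "cone (?w I) (\<lambda>s. hat c s I) (insert u {v}) \<noteq> 0"
        let ?r = "insert u {v} - {?w I}"
        from * have "coef c (?r, I) \<noteq> 0" by (auto simp: cone_def hat_eq_0_iff split: if_splits)
        then have "(?r, I) \<in> pairs" using supp_basis[OF c] basisD(1) by blast
        note rD = pairsD[OF this]
        have "V - I \<noteq> {}" using rD(1,6) by blast
        then have "?w I \<in> V - I" by (intro Max_in) simp_all
        then show False using False by blast
      qed
      then have "bdry V (cone (?w I) (\<lambda>s. hat c s I)) {v} = 0" by (intro bdry_eq_0) simp
      moreover have "hat c {v} I = 0"
      proof (rule ccontr)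
        assume "hat c {v} I \<noteq> 0"
        then have "({v}, I) \<in> pairs" using supp_basis[OF c] basisD(1) by (simp add: hat_eq_0_iff) blast
        note rD = pairsD[OF this]
        have "V - I \<noteq> {}" using rD(1,6) by blast
        then have "?w I \<in> V - I" by (intro Max_in) simp_all
        then show False using False by blast
      qed
      ultimately show ?thesis by simp
    qed
    finally show ?thesis unfolding hat_D[OF supp_pairs[OF ky]] 1 using True by simp
  next
    case False
    have "(s, {}) \<notin> pairs" for s using pairsD(2)[of s "{}"] by blast
    then have "coef c ({v}, {}) = 0" "coef (mv_D U y) ({v}, {}) = 0"
      using coef_eq_0[OF supp_pairs[OF c]] coef_eq_0[OF supp_mv_D_pairs[OF supp_pairs[OF ky]]] by blast+
    then show ?thesis using False by (simp add: hat_def)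
  qed
  then have "hat (c - mv_D U y) {v} I = 0" for v I unfolding hat_diff by simp
  then have "coef (c - mv_D U y) ({v}, I) = 0" for v I by (simp add: hat_eq_0_iff)
  then show thesis using that ky by blast
qed

text \<open>The nerve has no reduced homology below dimension \<open>D\<close>, so a chain whose augmentation is a
  reduced cycle can be moved into lower filtration by a boundary.\<close>

lemma fill:
  fixes c :: "'k::field total_chain"
  assumes c: "supp c \<subseteq> basis p" and p: "p < int D" and cyc: "\<And>J. bdry V (aug c) J = 0"
  obtains y where "supp y \<subseteq> basis (p + 1)" "\<And>v I. coef (c - mv_D U y) ({v}, I) = 0"
proof -
  note lb = lin_closed_supp[of "basis p"]
  have kD: "supp (x - mv_D U y) \<subseteq> basis p" if "supp x \<subseteq> basis p" "supp y \<subseteq> basis (p + 1)"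
    for x y :: "'k total_chain"
    using that supp_mv_D[OF that(2)] lin_closedD(5)[OF lb, of x "mv_D U y"] by simp
  obtain y1 where y1: "supp y1 \<subseteq> basis (p + 1)" "\<And>I. aug (c - mv_D U y1) I = 0"
    using fill_augmentation[OF c p cyc] by blast
  obtain y2 where y2: "supp y2 \<subseteq> basis (p + 1)" "\<And>I. aug (c - mv_D U y1 - mv_D U y2) I = 0"
    "p = int D - 1 \<Longrightarrow> coef (c - mv_D U y1 - mv_D U y2) ({0}, V - {0, 1}) = 0"
  proof (cases "p = int D - 1")
    case True
    have "supp (c - mv_D U y1) \<subseteq> basis (int D - 1)" using kD[OF c y1(1)] True by simp
    then obtain y where y: "supp y \<subseteq> basis (int D)" "\<And>I. aug (c - mv_D U y1 - mv_D U y) I = 0"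
      "coef (c - mv_D U y1 - mv_D U y) ({0}, V - {0, 1}) = 0"
      using fill_last_edge[of "c - mv_D U y1"] y1(2) by blast
    then show thesis using True by (intro that[of y]) simp_all
  next
    case False
    have "mv_D U 0 = (0 :: 'k total_chain)" by (rule linear_mapD(3)[OF linear_map_mv_D])
    then show thesis using False y1 by (intro that[of 0]) simp_all
  qed
  obtain y3 where y3: "supp y3 \<subseteq> basis (p + 1)"
    "\<And>v I. coef (c - mv_D U y1 - mv_D U y2 - mv_D U y3) ({v}, I) = 0"
    using fill_edges[OF kD[OF kD[OF c y1(1)] y2(1)] p y2(2,3)] by blast
  have "mv_D U (y1 + y2 + y3) = mv_D U y1 + mv_D U y2 + mv_D U y3"
    by (simp only: linear_mapD(1)[OF linear_map_mv_D])
  then have eq: "c - mv_D U (y1 + y2 + y3) = c - mv_D U y1 - mv_D U y2 - mv_D U y3" by simp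
  show thesis
  proof (rule that)
    show "supp (y1 + y2 + y3) \<subseteq> basis (p + 1)" using y1(1) y2(1) y3(1) by (intro supp_add_subset)
    show "coef (c - mv_D U (y1 + y2 + y3)) ({v}, I) = 0" for v I unfolding eq by (rule y3(2))
  qed
qed

end

lemma birth_le_card:
  assumes "finite s" "card s \<le> D + 1"
  shows "birth D s \<le> 2 * card s"
proof -
  have "\<not> {0..card s} \<subseteq> s"
  proof
    assume "{0..card s} \<subseteq> s"
    then have "card {0..card s} \<le> card s" using assms(1) by (intro card_mono)
    then show False by simp
  qed
  then obtain i where "i \<in> {0..card s}" and i': "i \<notin> s" by blast
  then have i: "i \<le> card s" by simp
  then have "birth D s \<le> 2 * i" using assms(2) i i' by (intro birth_leI) simp_all
  then show ?thesis using i by simp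
qed

lemma pos_sign_mult_complement:
  fixes w :: nat
  assumes "finite s" "finite J" "s \<inter> J = {}" "{..<w} \<subseteq> s \<union> J"
  shows "pos_sign w s * pos_sign w J = (- 1) ^ w"
proof -
  have "{y \<in> s. y < w} \<union> {y \<in> J. y < w} = {..<w}" using assms(4) by auto
  moreover have "card ({y \<in> s. y < w} \<union> {y \<in> J. y < w}) = card {y \<in> s. y < w} + card {y \<in> J. y < w}"
    using assms(1-3) by (intro card_Un_disjoint) auto
  ultimately have "card {y \<in> s. y < w} + card {y \<in> J. y < w} = w" by simp
  then show ?thesis by (simp add: pos_sign_def flip: power_add)
qed

lemma minus_one_power_cancel: "(- 1) ^ n * ((- 1) ^ n * a) = (a :: 'r::comm_ring_1)"
  by (simp add: mult.assoc[symmetric] flip: power_mult_distrib)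

context staircase
begin

lemma bottom_row_zeroI:
  assumes "\<And>c :: 'k::field total_chain. c \<in> row_cycles m p \<Longrightarrow>
    \<exists>y. supp y \<subseteq> basis (p + 1) \<and> supp (c - mv_D U y) \<subseteq> {b. int (card (snd b)) \<le> p}"
  shows "interleaved 0 (bottom_row m p :: ('k, _) graded_module) zero_graded"
  unfolding bottom_row_def
proof (rule graded_subquotient_zero[OF lin_closed_row_cycles lin_closed_row_relations])
  show "(row_cycles m p :: ('k total_chain) set) \<subseteq> row_relations m p"
  proof
    fix c :: "'k total_chain" assume c: "c \<in> row_cycles m p"
    obtain y where y: "supp y \<subseteq> basis (p + 1)" "supp (c - mv_D U y) \<subseteq> {b. int (card (snd b)) \<le> p}"
      using assms[OF c] by blast
    have "mv_D U y \<in> row_cycles m p"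
      unfolding row_cycles_def using supp_mv_D[OF y(1)] mv_D_mv_D[OF supp_pairs[OF y(1)]] by simp
    then have "c - mv_D U y \<in> row_cycles m p" by (rule lin_closedD(5)[OF lin_closed_row_cycles c])
    then have "c - mv_D U y \<in> row_cycles_below m p" unfolding row_cycles_below_def using y(2) by blast
    moreover have "mv_D U y \<in> row_boundaries p" unfolding row_boundaries_def using y(1) by blast
    ultimately have "(c - mv_D U y) + mv_D U y \<in> row_relations m p" by (rule row_relationsI)
    then show "c \<in> row_relations m p" by simp
  qed
qed

lemma supp_low:
  assumes c: "supp c \<subseteq> basis p" and v: "\<And>v I. coef c ({v}, I) = 0"
  shows "supp c \<subseteq> {b. int (card (snd b)) \<le> p}"
proof
  fix b assume b: "b \<in> supp c"
  obtain s I where sI: "b = (s, I)" by (cases b)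
  have t: "(s, I) \<in> basis p" using b c sI by blast
  have "card s \<noteq> 1"
  proof
    assume "card s = 1"
    then obtain v where "s = {v}" by (rule card_1_singletonE)
    then show False using b v by (simp add: sI in_keys_iff)
  qed
  moreover have "card s \<noteq> 0" using pairsD(1,7)[OF basisD(1)[OF t]] by simp
  ultimately show "b \<in> {b. int (card (snd b)) \<le> p}" using basisD(2)[OF t] by (simp add: sI)
qed

lemma bdry_aug_eq_0:
  assumes "supp c \<subseteq> basis p" "int (card J) \<noteq> p \<or> infinite J"
  shows "bdry V (aug c) J = 0"
proof (rule ccontr)
  assume "bdry V (aug c) J \<noteq> 0"
  then obtain w where w: "w \<notin> J" "aug c (insert w J) \<noteq> 0" by (rule bdry_nonzero)
  note n = aug_nonzero[OF assms(1) w(2)]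
  then show False using w(1) assms(2) by simp
qed

text \<open>For \<open>0 < p < D\<close> the differential of \<open>c\<close> has no vertex components in column \<open>p - 1\<close>, so the
  augmentation of \<open>c\<close> is a cycle and \<open>c\<close> can be filled. Outside this range \<open>c\<close> itself has no
  vertex components.\<close>

lemma bottom_row_other:
  assumes "p \<noteq> 0" "p \<noteq> int D" "m < p \<or> p < 0"
  shows "interleaved 0 (bottom_row m p :: ('k::field, _) graded_module) zero_graded"
proof (rule bottom_row_zeroI)
  fix c :: "'k total_chain" assume c: "c \<in> row_cycles m p"
  then have kc: "supp c \<subseteq> basis p" by (simp add: row_cycles_def)
  show "\<exists>y. supp y \<subseteq> basis (p + 1) \<and> supp (c - mv_D U y) \<subseteq> {b. int (card (snd b)) \<le> p}"
  proof (cases "0 < p \<and> p < int D")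
    case True
    have "bdry V (aug c) J = 0" for J
    proof (cases "int (card J) = p \<and> finite J")
      case J: True
      have "J \<noteq> {}" using J True by auto
      have "hat (mv_D U c) {v} J = 0" for v
      proof (rule ccontr)
        assume "hat (mv_D U c) {v} J \<noteq> 0"
        then have "({v}, J) \<in> supp (mv_D U c)" by (simp add: hat_eq_0_iff in_keys_iff)
        then have "int (card J) \<le> m" using c unfolding row_cycles_def by auto
        then show False using J assms(3) True by simp
      qed
      then have "aug (mv_D U c) J = 0" unfolding aug_sum by simp
      then show ?thesis unfolding aug_mv_D[OF supp_pairs[OF kc] \<open>J \<noteq> {}\<close>] .
    next
      case False
      then show ?thesis using bdry_aug_eq_0[OF kc] by blast
    qed
    then obtain y where y: "supp y \<subseteq> basis (p + 1)" "\<And>v I. coef (c - mv_D U y) ({v}, I) = 0"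
      using fill[OF kc conjunct2[OF True]] by blast
    have "supp (mv_D U y) \<subseteq> basis p" using supp_mv_D[OF y(1)] by simp
    then have "supp (c - mv_D U y) \<subseteq> basis p"
      using lin_closedD(5)[OF lin_closed_supp[of "basis p"], of c "mv_D U y"] kc by simp
    then show ?thesis using y(1) supp_low[OF _ y(2)] by blast
  next
    case False
    have "coef c ({v}, I) = 0" for v I
    proof (rule ccontr)
      assume "coef c ({v}, I) \<noteq> 0"
      then have t: "({v}, I) \<in> basis p" by (rule supp_basis[OF kc])
      note P = pairsD[OF basisD(1)[OF t]]
      have card: "int (card I) = p + 1" using basisD(2)[OF t] by simp
      have "card I \<noteq> 0" using P(2,8) by simp
      moreover have "card I \<le> card (V - {v})" using P(4,5) by (intro card_mono) auto
      moreover have "card (V - {v}) = D + 1" using P(3) by simp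
      ultimately show False using card False assms(1,2) by simp
    qed
    then have "supp c \<subseteq> {b. int (card (snd b)) \<le> p}" by (rule supp_low[OF kc])
    moreover have "mv_D U 0 = (0 :: 'k total_chain)" by (rule linear_mapD(3)[OF linear_map_mv_D])
    ultimately show ?thesis by (intro exI[of _ 0]) simp
  qed
qed

lemma basis_minus_one: "basis (- 1) = {}"
proof (rule equals0I)
  fix b assume "b \<in> basis (- 1)"
  then have t: "(fst b, snd b) \<in> basis (- 1)" by simp
  have "card (fst b) \<noteq> 0" "card (snd b) \<noteq> 0" using pairsD(1,2,7,8)[OF basisD(1)[OF t]] by simp_all
  then show False using basisD(2)[OF t] by simp
qed

lemma row_cycles_below_0: "row_cycles_below m 0 = {0}"
proof -
  have "c = 0" if c: "c \<in> row_cycles_below m 0" for c :: "'a total_chain"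
  proof -
    have "supp c = {}"
    proof (rule equals0I)
      fix b assume b: "b \<in> supp c"
      then have "b \<in> basis 0" "card (snd b) = 0" using c unfolding row_cycles_below_def row_cycles_def by auto
      moreover have "(fst b, snd b) \<in> basis 0" using calculation(1) by simp
      then have "card (snd b) \<noteq> 0" using pairsD(2,8) basisD(1) by fastforce
      ultimately show False by simp
    qed
    then show ?thesis by simp
  qed
  moreover have "(0 :: 'a total_chain) \<in> row_cycles_below m 0" by (rule lin_closedD(1)[OF lin_closed_row_cycles_below])
  ultimately show ?thesis by blast
qed

lemma sum_monom_closed:
  assumes "\<And>x. x \<in> A \<Longrightarrow> \<exists>b. f x = monom b n"
  shows "\<exists>b. sum f A = monom b n"
  using assms
proof (induction A rule: infinite_finite_induct)
  case (insert x A)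
  then obtain b b' where "f x = monom b n" "sum f A = monom b' n" by blast
  then show ?case using insert by (auto simp: add_monom)
qed (auto intro: exI[of _ 0])

text \<open>The isomorphism is the augmentation to a point, in rescaled coordinates.\<close>

lemma bottom_row_0: "interleaved 0 (bottom_row m 0 :: ('k::field, _) graded_module) (shifted_kt 0)"
  unfolding bottom_row_def
proof -
  let ?F = "\<lambda>c :: 'k total_chain. bdry V (aug c) {}"
  let ?z = "Poly_Mapping.single ({1}, {0}) 1 :: 'k total_chain"
  have F: "linear_form ?F"
    unfolding linear_form_def
  proof (intro conjI allI)
    show "?F (x + y) = ?F x + ?F y" for x y
      unfolding bdry_empty aug_add by (rule sum.distrib)
    show "?F (scale a x) = a * ?F x" for a x
      unfolding bdry_empty aug_scale by (rule sum_distrib_left[symmetric])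
  qed
  have F_D: "?F (mv_D U y) = 0" if y: "supp y \<subseteq> pairs" for y
  proof -
    have "?F (mv_D U y) = bdry V (bdry V (aug y)) {}"
      by (rule bdry_cong) (rule aug_mv_D[OF y insert_not_empty])
    then show ?thesis by (simp add: bdry_bdry)
  qed
  have cyc0: "c \<in> row_cycles m 0" if "supp c \<subseteq> basis 0" for c :: "'k total_chain"
  proof -
    have "supp (mv_D U c) \<subseteq> {}" using supp_mv_D[OF that] basis_minus_one by simp
    then show ?thesis using that unfolding row_cycles_def by blast
  qed
  have "({1}, {0}) \<in> basis 0" by (intro basisI pairsI) auto
  then have kz: "supp ?z \<subseteq> basis 0" by simp
  have hz: "hat ?z {v} {i} = (if i = 0 then if v = 1 then 1 else 0 else 0)" for v i
    unfolding hat_def lookup_single when_def by (simp add: birth_vertex monom_0 pCons_one)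
  have Fz: "?F ?z = 1"
  proof -
    have "aug ?z {i} = (if i = 0 then 1 else 0)" if "i \<in> V" for i
      unfolding aug_sum hz by (cases "i = 0") (simp_all only: if_True if_False sum.delta finite_atLeastAtMost, simp_all)
    then have "?F ?z = (\<Sum>i\<in>V. if i = 0 then 1 else 0)"
      unfolding bdry_empty by (rule sum.cong[OF refl])
    also have "\<dots> = 1" by (subst sum.delta) simp_all
    finally show ?thesis .
  qed
  have zA: "?z \<in> row_cycles m 0" by (rule cyc0[OF kz])
  show "interleaved 0 (graded_subquotient (free_graded (mv_deg U) pairs) (row_cycles m 0 :: ('k total_chain) set)
    (row_relations m 0)) (shifted_kt 0)"
  proof (rule graded_subquotient_free[OF lin_closed_row_cycles lin_closed_row_relations F _ _ zA _ Fz])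
    show "?F b = 0" if "b \<in> row_relations m 0" for b
    proof -
      from that obtain u v where uv: "b = u + v" "u \<in> row_cycles_below m 0" "v \<in> row_boundaries 0"
        unfolding row_relations_def by blast
      from uv(3) obtain y where y: "v = mv_D U y" "supp y \<subseteq> basis (0 + 1)"
        unfolding row_boundaries_def by blast
      have "u = 0" using uv(2) unfolding row_cycles_below_0 by simp
      then show ?thesis unfolding uv(1) y(1) using F_D[OF supp_pairs[OF y(2)]] by simp
    qed
    show "if j < 0 then ?F x = 0 else \<exists>b. ?F x = monom b (nat (j - 0))"
      if x: "x \<in> hcomp (free_graded (mv_deg U) pairs) j" for j x
    proof -
      have h: "if j < 0 then hat x {v} {i} = 0 else \<exists>b. hat x {v} {i} = monom b (nat j)" for v i
      proof (cases "({v}, {i}) \<in> supp x")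
        case True
        then have p: "({v}, {i}) \<in> pairs" and b: "mv_deg U ({v}, {i}) \<le> j"
          and "\<exists>a. coef x ({v}, {i}) = monom a (nat (j - mv_deg U ({v}, {i})))"
          using x unfolding free_graded_simps by auto
        then obtain a where a: "coef x ({v}, {i}) = monom a (nat (j - int (birth D {v})))"
          by (auto simp: mv_deg_eq)
        have le: "int (birth D {v}) \<le> j" using b by (simp add: mv_deg_eq[OF p])
        then have "birth D {v} + nat (j - int (birth D {v})) = nat j" by simp
        then have "hat x {v} {i} = monom a (nat j)" unfolding hat_def a by (simp add: mult_monom)
        moreover have "0 \<le> j" using le by linarith
        ultimately show ?thesis by auto
      next
        case False
        then have "hat x {v} {i} = 0" by (simp add: hat_def in_keys_iff)
        then show ?thesis by (auto intro: exI[of _ 0])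
      qed
      show ?thesis
      proof (cases "j < 0")
        case True
        then have "hat x {v} {i} = 0" for v i using h by simp
        then have "?F x = 0" unfolding bdry_empty aug_sum by simp
        then show ?thesis using True by (simp only: if_True)
      next
        case False
        then have "\<exists>b. hat x {v} {i} = monom b (nat j)" for v i using h by simp
        then have "\<exists>b. ?F x = monom b (nat j)"
          unfolding bdry_empty aug_sum by (intro sum_monom_closed)
        then show ?thesis using False by (simp only: if_False diff_0_right)
      qed
    qed
    show "?z \<in> hcomp (free_graded (mv_deg U) pairs) 0"
    proof -
      have p: "({1}, {0}) \<in> pairs" using \<open>({1}, {0}) \<in> basis 0\<close> by (rule basisD(1))
      have d: "mv_deg U ({1}, {0}) = 0" unfolding mv_deg_eq[OF p] birth_vertex by simp
      show ?thesis
        unfolding free_graded_simps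
      proof (intro CollectI conjI ballI)
        show "supp ?z \<subseteq> pairs" using kz basis_subset_pairs by blast
        fix b assume "b \<in> supp ?z"
        then have b: "b = ({1}, {0})" by simp
        show "mv_deg U b \<le> 0" unfolding b d by simp
        show "\<exists>a. coef ?z b = monom a (nat (0 - mv_deg U b))"
          unfolding b d by (intro exI[of _ 1]) (simp add: monom_0 pCons_one)
      qed
    qed
    show "x - scale (?F x) ?z \<in> row_relations m 0" if x: "x \<in> row_cycles m 0" for x
    proof -
      let ?c = "x - scale (?F x) ?z"
      have "?c \<in> row_cycles m 0"
        by (intro lin_closedD(5)[OF lin_closed_row_cycles x] lin_closedD(3)[OF lin_closed_row_cycles zA])
      then have kc: "supp ?c \<subseteq> basis 0" by (simp add: row_cycles_def)
      have Fc: "?F ?c = 0"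
        using linear_form_residual[OF F Fz] .
      have "bdry V (aug ?c) J = 0" for J
      proof (cases "J = {}")
        case True
        then show ?thesis using Fc by (simp only:)
      next
        case False
        then show ?thesis by (intro bdry_aug_eq_0[OF kc]) auto
      qed
      moreover have "0 < int D" using D_pos by simp
      ultimately obtain y where y: "supp y \<subseteq> basis (0 + 1)" "\<And>v I. coef (?c - mv_D U y) ({v}, I) = 0"
        using fill[OF kc] by blast
      have kD: "supp (mv_D U y) \<subseteq> basis 0" using supp_mv_D[OF y(1)] by simp
      then have k: "supp (?c - mv_D U y) \<subseteq> basis 0"
        using lin_closedD(5)[OF lin_closed_supp[of "basis 0"], of ?c "mv_D U y"] kc by simp
      have "?c - mv_D U y \<in> row_cycles_below m 0"
        unfolding row_cycles_below_def using cyc0[OF k] supp_low[OF k y(2)] by blast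
      moreover have "mv_D U y \<in> row_boundaries 0" unfolding row_boundaries_def using y(1) by blast
      ultimately have "(?c - mv_D U y) + mv_D U y \<in> row_relations m 0" by (rule row_relationsI)
      then show ?thesis by simp
    qed
  qed
qed

section \<open>The top dimension\<close>

lemma top_complement:
  assumes "(s, I) \<in> basis (int D)"
  shows "I = V - s"
proof -
  note P = pairsD[OF basisD(1)[OF assms]]
  have "I \<subseteq> V - s" using P(4,5) by blast
  moreover have "card I = card (V - s)"
    using basisD(2)[OF assms] P(3,7) by (simp add: card_Diff_subset)
  ultimately show ?thesis by (intro card_subset_eq) simp_all
qed

lemma topI:
  assumes "s \<noteq> {}" "s \<subseteq> V" "V - s \<noteq> {}"
  shows "(s, V - s) \<in> basis (int D)"
proof (intro basisI pairsI)
  have "finite s" using assms(2) finite_subset by blast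
  then have "card (V - s) = card V - card s" using assms(2) by (rule card_Diff_subset)
  moreover have "card s \<le> card V" using assms(2) by (intro card_mono) simp_all
  ultimately show "int (card s) + int (card (V - s)) = int D + 2" by simp
qed (use assms in auto)

text \<open>In total degree \<open>D\<close> the two parts of a basis pair are complementary. A pair \<open>(s, J)\<close> in the next lower
  degree misses a single vertex \<open>w\<close>, so its coefficient in \<open>D c\<close> has only two terms.\<close>

lemma hat_D_top:
  fixes c :: "'k::field total_chain"
  assumes c: "supp c \<subseteq> basis (int D)" and s: "s \<noteq> {}" "s \<subseteq> V" and w: "w \<in> V" "w \<notin> s"
    and J: "J = V - insert w s" "J \<noteq> {}"
  shows "hat (mv_D U c) s J = (- 1) ^ (card J - 1) * (pos_sign w s * hat c (insert w s) J)
    + pos_sign w J * hat c s (V - s)"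
proof -
  have ins: "insert w J = V - s" using w J(1) by blast
  have out: "hat c t I = 0" if "t \<inter> I \<noteq> {}" for t I
  proof (rule ccontr)
    assume "hat c t I \<noteq> 0"
    then have "(t, I) \<in> basis (int D)" using supp_basis[OF c] by (simp add: hat_eq_0_iff)
    then show False using that pairsD(5) basisD(1) by blast
  qed
  have "bdry V (\<lambda>s. hat c s J) s = pos_sign w s * hat c (insert w s) J"
  proof (rule bdry_single)
    fix u assume "u \<in> V" "u \<notin> s" "u \<noteq> w"
    then have "u \<in> J" unfolding J(1) by blast
    then show "hat c (insert u s) J = 0" by (intro out) blast
  qed (use w in simp_all)
  moreover have "bdry V (hat c s) J = pos_sign w J * hat c s (insert w J)"
  proof (rule bdry_single)
    fix u assume "u \<in> V" "u \<notin> J" "u \<noteq> w"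
    then have "u \<in> s" unfolding J(1) by blast
    then show "hat c s (insert u J) = 0" by (intro out) blast
  qed (use w J in simp_all)
  ultimately show ?thesis
    unfolding hat_D[OF supp_pairs[OF c]] ins using s(1) J(2) by (simp only: if_False)
qed

text \<open>The signs of the total cycle that represents the fundamental class of \<open>X\<close>. Adding \<open>w\<close> to \<open>s\<close>
  has to multiply the sign by \<open>(-1)^w\<close> and by \<open>(-1)^(D + 1 + card s)\<close>; the exponent adds up
  these contributions.\<close>

definition top_sign :: "nat set \<Rightarrow> 'r::comm_ring_1"
  where "top_sign s = (- 1) ^ (\<Sum>s + (\<Sum>i<card s. D + 1 + i))"

lemma top_sign_insert:
  assumes "finite s" "w \<notin> s"
  shows "top_sign (insert w s) = (- 1) ^ w * ((- 1) ^ (D + 1 + card s) * top_sign s)"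
proof -
  have "\<Sum>(insert w s) + (\<Sum>i<card (insert w s). D + 1 + i)
    = w + ((D + 1 + card s) + (\<Sum>s + (\<Sum>i<card s. D + 1 + i)))"
    using assms by simp
  then show ?thesis unfolding top_sign_def by (simp only: power_add)
qed

lemma top_sign_square: "top_sign s * top_sign s = (1 :: 'r::comm_ring_1)"
  unfolding top_sign_def by (simp flip: power_mult_distrib)

lemma top_sign_cancel:
  assumes s: "s \<subseteq> V" and w: "w \<in> V" "w \<notin> s" and J: "J = V - insert w s" "J \<noteq> {}"
  shows "(- 1) ^ (card J - 1) * (pos_sign w s * top_sign (insert w s)) + pos_sign w J * top_sign s = (0 :: 'r::comm_ring_1)"
proof -
  have fs: "finite s" using s finite_subset by blast
  have fJ: "finite J" using J(1) by simp
  have "card (insert w s) + card J = card V"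
  proof -
    have "card (insert w s) \<le> card V" using s w(1) by (intro card_mono) simp_all
    moreover have "card J = card V - card (insert w s)"
      unfolding J(1) using fs s w(1) by (intro card_Diff_subset) simp_all
    ultimately show ?thesis by simp
  qed
  then have card: "card s + card J = D + 1" using fs w(2) by simp
  have "card J \<noteq> 0" using J(2) fJ by simp
  then have odd: "card J - 1 + (D + 1 + card s) = Suc (2 * D)" using card by simp
  then have e: "(- 1) ^ (card J - 1) * (- 1) ^ (D + 1 + card s) = (- 1 :: 'r)"
    unfolding power_add[symmetric] odd by simp
  have "{..<w} \<subseteq> s \<union> J" unfolding J(1) using w(1) by auto
  then have w': "pos_sign w s * pos_sign w J = (- 1 :: 'r) ^ w"
    using fs fJ by (intro pos_sign_mult_complement) (auto simp: J(1))
  have "(- 1) ^ (card J - 1) * (pos_sign w s * top_sign (insert w s))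
    = ((- 1) ^ (card J - 1) * (- 1) ^ (D + 1 + card s)) * (pos_sign w s * (- 1) ^ w * top_sign s :: 'r)"
    unfolding top_sign_insert[OF fs w(2)] by (simp only: ac_simps)
  also have "\<dots> = - (pos_sign w s * (pos_sign w s * pos_sign w J) * top_sign s)" unfolding e w' by simp
  also have "\<dots> = - (pos_sign w J * top_sign s)" by simp
  finally show ?thesis by simp
qed

text \<open>The two terms determine each other up to sign, in rescaled coordinates.\<close>

lemma top_zero_iff:
  fixes c :: "'k::field total_chain"
  assumes c: "c \<in> row_cycles (int D - int n) (int D)" and s: "s \<noteq> {}" "s \<subseteq> V" "card s \<le> n"
    and w: "w \<in> V" "w \<notin> s" and ne: "V - insert w s \<noteq> {}"
  shows "coef c (s, V - s) = 0 \<longleftrightarrow> coef c (insert w s, V - insert w s) = 0"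
proof -
  let ?J = "V - insert w s"
  have kc: "supp c \<subseteq> basis (int D)" using c by (simp add: row_cycles_def)
  have "hat (mv_D U c) s ?J = 0"
  proof (rule ccontr)
    assume "hat (mv_D U c) s ?J \<noteq> 0"
    then have k: "(s, ?J) \<in> supp (mv_D U c)" by (simp only: hat_eq_0_iff in_keys_iff not_False_eq_True)
    then have le: "int (card ?J) \<le> int D - int n" using c unfolding row_cycles_def by auto
    have "(s, ?J) \<in> basis (int D - 1)" using k supp_mv_D[OF kc] by blast
    then have "int (card s) + int (card ?J) = int D + 1" using basisD(2) by fastforce
    then show False using le s(3) by linarith
  qed
  then have eq: "(- 1) ^ (card ?J - 1) * (pos_sign w s * hat c (insert w s) ?J) + pos_sign w ?J * hat c s (V - s) = 0"
    unfolding hat_D_top[OF kc s(1,2) w refl ne] .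
  have "hat c s (V - s) = 0 \<longleftrightarrow> hat c (insert w s) ?J = 0"
  proof
    assume "hat c s (V - s) = 0"
    then have "(- 1) ^ (card ?J - 1) * (pos_sign w s * hat c (insert w s) ?J) = 0" using eq by (simp only: mult_zero_right add_0_right)
    then have "pos_sign w s * hat c (insert w s) ?J = 0" by (metis minus_one_power_cancel mult_zero_right)
    then show "hat c (insert w s) ?J = 0" by (metis pos_sign_square(2) mult_zero_right)
  next
    assume "hat c (insert w s) ?J = 0"
    then have "pos_sign w ?J * hat c s (V - s) = 0" using eq by (simp only: mult_zero_right add_0_left)
    then show "hat c s (V - s) = 0" by (metis pos_sign_square(2) mult_zero_right)
  qed
  then show ?thesis by (simp only: hat_eq_0_iff)
qed

text \<open>Transport along the flag \<open>{0}, {0, 1}, ..., {0..n}\<close>.\<close>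

lemma top_flag_zero_iff:
  assumes c: "c \<in> row_cycles (int D - int n) (int D)" and "i \<le> n" "n \<le> D"
  shows "coef c ({0}, V - {0}) = 0 \<longleftrightarrow> coef c ({0..i}, V - {0..i}) = 0"
  using assms(2)
proof (induction i)
  case (Suc i)
  have "coef c ({0..i}, V - {0..i}) = 0 \<longleftrightarrow> coef c (insert (Suc i) {0..i}, V - insert (Suc i) {0..i}) = 0"
  proof (rule top_zero_iff[OF c])
    have "D + 1 \<in> V - insert (Suc i) {0..i}" using Suc.prems assms(3) by simp
    then show "V - insert (Suc i) {0..i} \<noteq> {}" by blast
  qed (use Suc.prems assms(3) in auto)
  moreover have "insert (Suc i) {0..i} = {0..Suc i}" by auto
  ultimately show ?case using Suc by simp
qed simp

lemma top_vertex_zero: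
  assumes c: "c \<in> row_cycles (int D - int n) (int D)" and n: "1 \<le> n" and 0: "coef c ({0}, V - {0}) = 0"
    and v: "v \<in> V"
  shows "coef c ({v}, V - {v}) = 0"
proof (cases "v = 0")
  case False
  have ne: "V - {0, v} \<noteq> {}"
  proof -
    have "(if v = 1 then 2 else 1) \<in> V - {0, v}" using D_pos by simp
    then show ?thesis by blast
  qed
  have "coef c ({0}, V - {0}) = 0 \<longleftrightarrow> coef c (insert v {0}, V - insert v {0}) = 0"
    by (rule top_zero_iff[OF c]) (use n v False ne in \<open>simp_all add: insert_commute\<close>)
  moreover have "coef c ({v}, V - {v}) = 0 \<longleftrightarrow> coef c (insert 0 {v}, V - insert 0 {v}) = 0"
    by (rule top_zero_iff[OF c]) (use n v False ne in simp_all)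
  ultimately show ?thesis using 0 insert_commute[of v 0 "{}"] by metis
qed (use 0 in simp)

text \<open>The generator has its coefficient 1 at the last member \<open>{0..n}\<close> of the flag along which coefficients
  can be transported, and the degree of this simplex is \<open>2n + 2\<close>. Any other row cycle is, modulo
  lower filtration, the multiple given by its own coefficient there. So each page up to the limit
  pushes the top class two degrees further.\<close>

lemma bottom_row_D:
  assumes n: "1 \<le> n" "n \<le> D"
  shows "interleaved 0 (bottom_row (int D - int n) (int D) :: ('k::field, _) graded_module)
    (shifted_kt (2 * int n + 2))"
proof -
  let ?m = "int D - int n" and ?N = "2 * n + 2"
  define s0 where "s0 = {0..n}"
  define b0 where "b0 = (s0, V - s0)"
  define F where "F c = top_sign s0 * coef c b0" for c :: "'k total_chain"
  \<comment> \<open>Homogeneous of degree \<open>2n + 2\<close>; simplices with more than \<open>n + 1\<close> vertices may be born later and are left out.\<close>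
  define z :: "'k total_chain" where "z = of_fun (basis (int D))
      (\<lambda>(s, I). if card s \<le> n + 1 then top_sign s * monom 1 (?N - birth D s) else 0)"
  have s0: "s0 \<noteq> {}" "s0 \<subseteq> V" "V - s0 \<noteq> {}" "card s0 = n + 1"
  proof -
    have "D + 1 \<in> V - s0" unfolding s0_def using n(2) by simp
    then show "V - s0 \<noteq> {}" by blast
  qed (use n in \<open>simp_all add: s0_def\<close>)
  have birth0: "birth D s0 = ?N"
  proof -
    have "birth D s0 = 2 * (n + 1)" unfolding s0_def using n(2) by (intro birth_eqI) simp_all
    then show ?thesis by simp
  qed
  have b0: "b0 \<in> basis (int D)" unfolding b0_def by (rule topI[OF s0(1-3)])
  have deg0: "mv_deg U b0 = 2 * int n + 2"
    using mv_deg_eq[OF basisD(1)[OF b0[unfolded b0_def]]] by (simp add: b0_def birth0)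
  have kz: "supp z \<subseteq> basis (int D)" unfolding z_def by (rule supp_of_fun_basis)
  have birth_le: "birth D s \<le> ?N" if "(s, I) \<in> basis (int D)" "card s \<le> n + 1" for s I
  proof -
    note P = pairsD[OF basisD(1)[OF that(1)]]
    have "card s \<le> D + 1" using that(2) n(2) by simp
    then have "birth D s \<le> 2 * card s" using P(7) by (intro birth_le_card)
    then show ?thesis using that(2) by simp
  qed
  have lz: "coef z (s, I) = top_sign s * monom 1 (?N - birth D s)"
    if "(s, I) \<in> basis (int D)" "card s \<le> n + 1" for s I
    unfolding z_def coef_of_fun[OF finite_basis] using that by simp
  have hz: "hat z s (V - s) = top_sign s * monom 1 ?N"
    if "s \<noteq> {}" "s \<subseteq> V" "V - s \<noteq> {}" "card s \<le> n + 1" for s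
  proof -
    have t: "(s, V - s) \<in> basis (int D)" using that(1-3) by (rule topI)
    have "t_birth s * monom 1 (?N - birth D s) = (monom 1 ?N :: 'k poly)"
      using birth_le[OF t that(4)] by (simp add: mult_monom)
    then show ?thesis unfolding hat_def lz[OF t that(4)] by (simp only: mult.left_commute)
  qed
  have F: "linear_form F"
    by (simp add: linear_form_def F_def lookup_add distrib_left mult.left_commute)
  have Fz: "F z = 1"
  proof -
    have "coef z b0 = top_sign s0 * monom 1 (?N - birth D s0)"
      unfolding b0_def by (rule lz) (use b0 s0(4) in \<open>simp_all add: b0_def\<close>)
    also have "\<dots> = top_sign s0" by (simp add: birth0 monom_0 pCons_one)
    finally show ?thesis unfolding F_def by (simp only: top_sign_square)
  qed
  have zA: "z \<in> row_cycles ?m (int D)"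
    unfolding row_cycles_def
  proof (rule CollectI, rule conjI[OF kz], rule subsetI)
    fix b assume b: "b \<in> supp (mv_D U z)"
    obtain s J where sJ: "b = (s, J)" by (cases b)
    have t: "(s, J) \<in> basis (int D - 1)" using b supp_mv_D[OF kz] sJ by blast
    note P = pairsD[OF basisD(1)[OF t]]
    have card: "card s + card J = D + 1" using basisD(2)[OF t] by simp
    show "b \<in> {b. int (card (snd b)) \<le> ?m}"
    proof (rule ccontr)
      assume "b \<notin> {b. int (card (snd b)) \<le> ?m}"
      then have "card s \<le> n" using card by (simp add: sJ)
      have "card (s \<union> J) = D + 1" using P(5,7,8) card by (simp add: card_Un_disjoint)
      moreover have "card (V - (s \<union> J)) = card V - card (s \<union> J)"
        using P(3,4,7,8) by (intro card_Diff_subset) simp_all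
      ultimately have "card (V - (s \<union> J)) = 1" by simp
      then obtain w where w: "V - (s \<union> J) = {w}" by (rule card_1_singletonE)
      have w': "w \<in> V" "w \<notin> s" "w \<notin> J" using w by blast+
      have J: "J = V - insert w s"
      proof (intro subset_antisym subsetI)
        show "x \<in> V - insert w s" if "x \<in> J" for x using that P(4,5) w'(3) by blast
        show "x \<in> J" if "x \<in> V - insert w s" for x using that w by blast
      qed
      have Jne: "V - insert w s \<noteq> {}" using P(2) J by simp
      have "hat z (insert w s) J = top_sign (insert w s) * monom 1 ?N"
        unfolding J
      proof (rule hz)
        show "insert w s \<subseteq> V" using w'(1) P(3) by simp
        show "card (insert w s) \<le> n + 1" using \<open>card s \<le> n\<close> w'(2) P(7) by simp
      qed (use Jne in simp_all)
      moreover have "hat z s (V - s) = top_sign s * monom 1 ?N"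
      proof (rule hz[OF P(1,3)])
        show "V - s \<noteq> {}" using w'(1,2) by blast
      qed (use \<open>card s \<le> n\<close> in simp)
      \<comment> \<open>Both \<open>s\<close> and \<open>insert w s\<close> are small enough to occur in \<open>z\<close>, so the two terms cancel.\<close>
      ultimately have "hat (mv_D U z) s J
        = ((- 1) ^ (card J - 1) * (pos_sign w s * top_sign (insert w s)) + pos_sign w J * top_sign s) * monom 1 ?N"
        unfolding hat_D_top[OF kz P(1,3) w'(1,2) J P(2)] by (simp only: distrib_right mult.assoc)
      also have "\<dots> = 0" unfolding top_sign_cancel[OF P(3) w'(1,2) J P(2)] by simp
      finally have "coef (mv_D U z) b = 0" by (simp add: sJ hat_eq_0_iff)
      then show False using b by (simp add: in_keys_iff)
    qed
  qed
  have zero: "F c = 0 \<longleftrightarrow> coef c ({0}, V - {0}) = 0" if "c \<in> row_cycles ?m (int D)" for c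
  proof -
    have "coef c b0 = top_sign s0 * F c" by (simp add: F_def mult.assoc[symmetric] top_sign_square)
    then have "F c = 0 \<longleftrightarrow> coef c b0 = 0" unfolding F_def by (metis mult_zero_right)
    then show ?thesis
      using top_flag_zero_iff[OF that order_refl n(2)] unfolding b0_def s0_def by blast
  qed
  have basis_above: "basis (int D + 1) = {}"
  proof (rule equals0I)
    fix b assume "b \<in> basis (int D + 1)"
    then have t: "(fst b, snd b) \<in> basis (int D + 1)" by simp
    note P = pairsD[OF basisD(1)[OF t]]
    have "card (fst b \<union> snd b) \<le> card V" using P(3,4) by (intro card_mono) simp_all
    then have "card (fst b) + card (snd b) \<le> D + 2" using P(5,7,8) by (simp add: card_Un_disjoint)
    then show False using basisD(2)[OF t] by simp
  qed
  have boundaries_0: "row_boundaries (int D) = {0 :: 'k total_chain}"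
  proof -
    have "{c :: 'k total_chain. supp c \<subseteq> basis (int D + 1)} = {0}" unfolding basis_above by auto
    then show ?thesis unfolding row_boundaries_def by (simp add: linear_mapD(3)[OF linear_map_mv_D])
  qed
  show ?thesis
    unfolding bottom_row_def
  proof (rule graded_subquotient_free[OF lin_closed_row_cycles lin_closed_row_relations F _ _ zA _ Fz])
    show "F b = 0" if "b \<in> row_relations ?m (int D)" for b
    proof -
      from that have b: "b \<in> row_cycles_below ?m (int D)" unfolding row_relations_def boundaries_0 by auto
      then have bc: "b \<in> row_cycles ?m (int D)" and low: "supp b \<subseteq> {b. int (card (snd b)) \<le> int D}"
        unfolding row_cycles_below_def by blast+
      have "coef b ({0}, V - {0}) = 0"
      proof (rule ccontr)
        assume "coef b ({0}, V - {0}) \<noteq> 0"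
        then have "({0}, V - {0}) \<in> supp b" by (simp only: in_keys_iff not_False_eq_True)
        then have "int (card (V - {0})) \<le> int D" using low by auto
        then show False by simp
      qed
      then show ?thesis using zero[OF bc] by blast
    qed
    show "if j < 2 * int n + 2 then F x = 0 else \<exists>b. F x = monom b (nat (j - (2 * int n + 2)))"
      if x: "x \<in> hcomp (free_graded (mv_deg U) pairs) j" for j x
    proof (cases "b0 \<in> supp x")
      case True
      then have "mv_deg U b0 \<le> j" and "\<exists>a. coef x b0 = monom a (nat (j - mv_deg U b0))"
        using x unfolding free_graded_simps by blast+
      then obtain a where le: "\<not> j < 2 * int n + 2" and a: "coef x b0 = monom a (nat (j - (2 * int n + 2)))"
        unfolding deg0 by fastforce
      have sgn: "top_sign s0 = (monom (top_sign s0) 0 :: 'k poly)" unfolding top_sign_def monom_sign by simp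
      have "F x = monom (top_sign s0 * a) (nat (j - (2 * int n + 2)))"
        unfolding F_def a by (subst sgn) (simp add: mult_monom)
      then show ?thesis using le by auto
    next
      case False
      then have "F x = 0" by (simp add: F_def in_keys_iff)
      then show ?thesis by (auto intro: exI[of _ 0])
    qed
    show "z \<in> hcomp (free_graded (mv_deg U) pairs) (2 * int n + 2)"
      unfolding free_graded_simps
    proof (intro CollectI conjI ballI)
      show "supp z \<subseteq> pairs" by (rule supp_pairs[OF kz])
      fix b assume b: "b \<in> supp z"
      obtain s I where sI: "b = (s, I)" by (cases b)
      have t: "(s, I) \<in> basis (int D)" using b kz sI by blast
      have c: "card s \<le> n + 1"
        using b unfolding sI in_keys_iff z_def coef_of_fun[OF finite_basis] by (auto split: if_splits)
      have d: "mv_deg U b = int (birth D s)" unfolding sI by (rule mv_deg_eq[OF basisD(1)[OF t]])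
      show "mv_deg U b \<le> 2 * int n + 2" unfolding d using birth_le[OF t c] by simp
      have "nat (2 * int n + 2 - int (birth D s)) = ?N - birth D s" by simp
      then show "\<exists>a. coef z b = monom a (nat (2 * int n + 2 - mv_deg U b))"
        unfolding d unfolding sI lz[OF t c] top_sign_def by (metis monom_sign)
    qed
    show "x - scale (F x) z \<in> row_relations ?m (int D)" if x: "x \<in> row_cycles ?m (int D)" for x
    proof -
      let ?c = "x - scale (F x) z"
      have c: "?c \<in> row_cycles ?m (int D)"
        by (intro lin_closedD(5)[OF lin_closed_row_cycles x] lin_closedD(3)[OF lin_closed_row_cycles zA])
      have "F ?c = 0"
        using linear_form_residual[OF F Fz] .
      then have 0: "coef ?c ({0}, V - {0}) = 0" using zero[OF c] by blast
      have kc: "supp ?c \<subseteq> basis (int D)" using c unfolding row_cycles_def by blast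
      have "coef ?c ({v}, I) = 0" for v I
      proof (rule ccontr)
        assume nz: "coef ?c ({v}, I) \<noteq> 0"
        then have t: "({v}, I) \<in> basis (int D)" by (rule supp_basis[OF kc])
        have "v \<in> V" using pairsD(3)[OF basisD(1)[OF t]] by simp
        then have "coef ?c ({v}, V - {v}) = 0" by (rule top_vertex_zero[OF c n(1) 0])
        then show False using nz unfolding top_complement[OF t] by (rule notE[rotated])
      qed
      then have "?c \<in> row_cycles_below ?m (int D)"
        unfolding row_cycles_below_def using c supp_low[OF kc] by blast
      moreover have "0 \<in> row_boundaries (int D)" by (rule lin_closedD(1)[OF lin_closed_row_boundaries])
      ultimately have "?c + 0 \<in> row_relations ?m (int D)" by (rule row_relationsI)
      then show ?thesis by simp
    qed
  qed
qed

end

section \<open>The comparison\<close>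

lemma sphere_family_interleaved:
  fixes M N :: "int \<Rightarrow> ('k::field, _) graded_module"
  assumes p: "p \<noteq> 0"
    and M: "interleaved 0 (M 0) (shifted_kt 0)" "interleaved 0 (M p) (shifted_kt a)"
      "\<And>q. q \<noteq> 0 \<Longrightarrow> q \<noteq> p \<Longrightarrow> interleaved 0 (M q) zero_graded"
    and N: "interleaved 0 (N 0) (shifted_kt 0)" "interleaved 0 (N p) (shifted_kt b)"
      "\<And>q. q \<noteq> 0 \<Longrightarrow> q \<noteq> p \<Longrightarrow> interleaved 0 (N q) zero_graded"
    and unital: "\<And>q. unital (M q)" "\<And>q. unital (N q)"
  shows "family_interleaved \<eta> M N \<longleftrightarrow> \<bar>a - b\<bar> \<le> int \<eta>"
proof -
  have "interleaved \<eta> (M q) (N q) \<longleftrightarrow> q = p \<longrightarrow> \<bar>a - b\<bar> \<le> int \<eta>" for q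
  proof -
    consider "q = 0" | "q = p" | "q \<noteq> 0" "q \<noteq> p" by blast
    then show ?thesis
    proof cases
      case 1
      have "interleaved \<eta> (M 0) (N 0) \<longleftrightarrow> interleaved \<eta> (shifted_kt 0 :: ('k, _) graded_module) (shifted_kt 0 :: ('k, _) graded_module)"
        by (rule interleaved_iso[OF M(1) N(1) unital(1) unital_shifted_kt unital(2) unital_shifted_kt])
      then show ?thesis using 1 p by (simp add: interleaved_shifted_kt_iff)
    next
      case 2
      have "interleaved \<eta> (M p) (N p) \<longleftrightarrow> interleaved \<eta> (shifted_kt a :: ('k, _) graded_module) (shifted_kt b :: ('k, _) graded_module)"
        by (rule interleaved_iso[OF M(2) N(2) unital(1) unital_shifted_kt unital(2) unital_shifted_kt])
      then show ?thesis using 2 by (simp add: interleaved_shifted_kt_iff)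
    next
      case 3
      have "interleaved \<eta> (M q) (N q) \<longleftrightarrow> interleaved \<eta> (zero_graded :: ('k, _) graded_module) (zero_graded :: ('k, _) graded_module)"
        by (rule interleaved_iso[OF M(3)[OF 3] N(3)[OF 3] unital(1) unital_zero_graded unital(2) unital_zero_graded])
      then show ?thesis using 3 by (simp add: interleaved_zero_graded)
    qed
  qed
  then show ?thesis unfolding family_interleaved_def by blast
qed

context staircase
begin

lemma page_vs_nerve:
  "family_interleaved \<eta> (\<lambda>p. mv_page \<Lambda> U 2 p 0 :: ('k::field, _) graded_module)
      (\<lambda>p. persistent_homology p (nerve \<Lambda> U) :: ('k, _) graded_module) \<longleftrightarrow> 2 \<le> \<eta>"
proof -
  have "family_interleaved \<eta> (\<lambda>p. mv_page \<Lambda> U 2 p 0 :: ('k, _) graded_module)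
      (\<lambda>p. persistent_homology p (nerve \<Lambda> U) :: ('k, _) graded_module)
      \<longleftrightarrow> \<bar>(2 * int 1 + 2) - 2\<bar> \<le> int \<eta>"
    unfolding mv_page_eq
  proof (rule sphere_family_interleaved[where p = "int D"])
    show "interleaved 0 (bottom_row (int D - 1) (int D) :: ('k, _) graded_module) (shifted_kt (2 * int 1 + 2))"
      using bottom_row_D[of 1] D_pos by simp
  qed (use D_pos in \<open>simp_all add: bottom_row_0 bottom_row_other nerve_homology_0 nerve_homology_D nerve_homology_other
      unital_bottom_row unital_persistent_homology mono_filt_nerve\<close>)
  then show ?thesis by simp
qed

lemma page_vs_limit:
  "family_interleaved \<eta> (\<lambda>p. mv_page \<Lambda> U 2 p 0 :: ('k::field, _) graded_module)
      (\<lambda>p. mv_limit_page \<Lambda> U p 0 :: ('k, _) graded_module) \<longleftrightarrow> 2 * (D - 1) \<le> \<eta>"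
proof -
  have "family_interleaved \<eta> (\<lambda>p. mv_page \<Lambda> U 2 p 0 :: ('k, _) graded_module)
      (\<lambda>p. mv_limit_page \<Lambda> U p 0 :: ('k, _) graded_module)
      \<longleftrightarrow> \<bar>(2 * int 1 + 2) - (2 * int D + 2)\<bar> \<le> int \<eta>"
    unfolding mv_page_eq mv_limit_page_eq
  proof (rule sphere_family_interleaved[where p = "int D"])
    show "interleaved 0 (bottom_row (int D - 1) (int D) :: ('k, _) graded_module) (shifted_kt (2 * int 1 + 2))"
      using bottom_row_D[of 1] D_pos by simp
    show "interleaved 0 (bottom_row 0 (int D) :: ('k, _) graded_module) (shifted_kt (2 * int D + 2))"
      using bottom_row_D[of D] D_pos by simp
    show "interleaved 0 (bottom_row 0 q :: ('k, _) graded_module) zero_graded" if "q \<noteq> 0" "q \<noteq> int D" for q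
      using that by (intro bottom_row_other) auto
  qed (use D_pos in \<open>simp_all add: bottom_row_0 bottom_row_other unital_bottom_row\<close>)
  then show ?thesis using D_pos by (simp add: of_nat_diff) linarith
qed

end

theorem mainTheorem2:
  fixes D :: nat
    and X :: "nat filtered_complex"
    and \<Lambda> :: "nat set"
    and U :: "nat \<Rightarrow> nat filtered_complex"
  assumes "D \<ge> 1"
    and "\<Lambda> = {0..D + 1}"
    and "cplx X = {\<sigma>. \<sigma> \<noteq> {} \<and> \<sigma> \<subset> {0..D + 1}}"
    and "\<forall>i\<in>\<Lambda>. cplx (U i) = {\<sigma>. \<sigma> \<noteq> {} \<and> \<sigma> \<subseteq> {0..D + 1} - {i}}"
    and "\<forall>m<0. filt X m = {}"
    and "\<forall>j\<le>D + 1. filt X (2 * int j) = (\<Union>i\<in>{0..j}. cplx (U i))"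
    and "\<forall>j\<le>D + 1. filt X (2 * int j + 1) = (\<Union>i\<in>{0..j}. cplx (U i))"
    and "\<forall>m\<ge>2 * int D + 2. filt X m = cplx X"
    and "\<forall>i\<in>\<Lambda>. \<forall>m. filt (U i) m = cplx (U i) \<inter> filt X m"
  shows "acyclic_cover TYPE('k::field) 1 X \<Lambda> U \<and>
    (let E2 = (\<lambda>p. mv_page \<Lambda> U 2 p 0 :: ('k, _) graded_module);
         Einf = (\<lambda>p. mv_limit_page \<Lambda> U p 0 :: ('k, _) graded_module);
         HN = (\<lambda>p. persistent_homology p (nerve \<Lambda> U) :: ('k, _) graded_module)
     in (family_interleaved 2 E2 HN \<and> (\<forall>\<eta><2. \<not> family_interleaved \<eta> E2 HN)) \<and>
        (family_interleaved (2 * (D - 1)) E2 Einf \<and>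
         (\<forall>\<eta><2 * (D - 1). \<not> family_interleaved \<eta> E2 Einf)))"
proof -
  interpret staircase D X \<Lambda> U by (unfold_locales) (fact assms)+
  show ?thesis
    unfolding Let_def page_vs_nerve page_vs_limit
    by (intro conjI acyclic) simp_all
qed

end
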